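(* Let $Y^*_{\nu}$, $\nu>2$, be a standard $t$ process with $\nu$ degrees of freedom and underlying correlation $\rho(\boldsymbol{h})$, i.e. $Y^*_{\nu}(\boldsymbol{s})=W_{\nu}(\boldsymbol{s})^{-1/2}G(\boldsymbol{s})$ with $G$ a weakly stationary standard Gaussian process with correlation function $\rho(\boldsymbol{h})$ and $W_\nu$ the independent Gamma mixing process built from $\rho$. Let $\rho_{Y^*_\nu}(\boldsymbol{h})$ be the correlation function of $Y^*_\nu$. Then: (a) $Y^*_{\nu}$ is also weakly stationary; (b) $Y^*_{\nu}$ is mean-square continuous if and only if $G$ is mean-square continuous; (c) Let $G$ be $m$-times mean-square differentiable, for $m=0,1,\ldots$. - If $\nu>2(2m+1)$, then $Y^*_{\nu}$ is $m$-times mean-square differentiable. - If $\nu\le 2(2m+1)$, then $Y^*_{\nu}$ is $(m-k)$-times mean-square differentiable if $2(2(m-k)+1)<\nu\le 2(2(m-k)+3)$, for $k=1,\ldots,m$; (d) $Y^*_{\nu}$ is a long-range dependent process if and only if $G$ is a long-range dependent process; (e) $\rho_{Y^*_{\nu}}(\boldsymbol{h})\le\rho(\boldsymbol{h})$ and $\lim_{\nu\to\infty}\rho_{Y^*_{\nu}}(\boldsymbol{h})=\rho(\boldsymbol{h})$.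
   Context: For a process $Q=\{Q(\boldsymbol{s}),\boldsymbol{s}\in A\}$, $A\subseteq\mathbb{R}^d$, the correlation function is $\rho_Q(\boldsymbol{h})=\mathrm{Corr}(Q(\boldsymbol{s}_i),Q(\boldsymbol{s}_j))$ with $\boldsymbol{h}=\boldsymbol{s}_i-\boldsymbol{s}_j$. Parent process: $G=\{G(\boldsymbol{s}),\boldsymbol{s}\in A\}$ is a weakly stationary Gaussian process with zero mean, unit variance and correlation function $\rho(\boldsymbol{h})$. Mixing process: for an integer $\nu$, $W_{\nu}(\boldsymbol{s}):=\frac1\nu\sum_{i=1}^{\nu}G_i(\boldsymbol{s})^2$, where $G_1,\dots,G_\nu$ are independent copies of $G$, also independent of $G$. The marginals of $W_\nu$ are $\Gamma(\nu/2,\nu/2)$ (shape, rate). The $t$ process is well defined for $\nu=3,4,\ldots$; for non-integer $\nu>2$ it is considered whenever the Gamma process exists (which is the case if $G^2$ is infinitely divisible). In that case $W_\nu$ is a positive process independent of $G$ with $\Gamma(\nu/2,\nu/2)$ marginals, whose bivariate density at two points with lag $\boldsymbol{h}$ and $\rho=\rho(\boldsymbol{h})$, $|\rho|<1$, is $$f(w_i,w_j)=\frac{2^{-\nu}\nu^{\nu}(w_iw_j)^{\nu/2-1}}{\Gamma^2(\nu/2)(1-\rho^2)^{\nu/2}}\,e^{-\frac{\nu(w_i+w_j)}{2(1-\rho^2)}}\,{}_0F_1\left(;\frac{\nu}{2};\frac{\nu^2\rho^2w_iw_j}{4(1-\rho^2)^2}\right),\quad w_i,w_j>0,$$ with ${}_0F_1(;b;x)=\sum_{k\ge0}\frac{x^k}{k!(b)_k}$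 and $(b)_k=\Gamma(b+k)/\Gamma(b)$ (the same formula holds for integer $\nu$), and $W_\nu(\boldsymbol{s}_i)=W_\nu(\boldsymbol{s}_j)$ almost surely if $|\rho|=1$. For a weakly stationary process, mean-square continuity is equivalent to continuity of its correlation function at $\boldsymbol{h}=\boldsymbol{0}$, and $m$-times mean-square differentiability is equivalent to $2m$-times differentiability of its correlation function at $\boldsymbol{h}=\boldsymbol{0}$ ($0$-times mean-square differentiable being read as mean-square continuous). "$m$-times differentiable" does not exclude higher-order differentiability. A process $F$ (indexed by $A=\mathbb{R}^n$) with correlation function $\rho_F$ is long-range dependent if $\int_{\mathbb{R}^n_+}|\rho_F(\boldsymbol{h})|\,d^n\boldsymbol{h}=\infty$. In (e) the limit is taken with $\rho(\boldsymbol{h})$ fixed and $\nu$ varying over the values for which $Y^*_\nu$ is defined.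
   Formalization: In (e) the inequality ρ_Y(h) ≤ ρ(h), false when -1 < ρ(h) < 0, is stated for ρ(h) ≥ 0, together with |ρ_Y(h)| ≤ |ρ(h)| for all h; (c) is stated for open index sets A, where mean-square derivatives are defined. *)

theory Defs
  imports "HOL-Probability.Probability"
begin

text \<open>A process indexed by \<open>A\<close> is a function \<open>Q :: 'a \<Rightarrow> 'w \<Rightarrow> real\<close> of which only the values
  \<open>Q s\<close> with \<open>s \<in> A\<close> matter.\<close>

section \<open>Second-order structure\<close>

definition second_order :: "'w measure \<Rightarrow> 'a set \<Rightarrow> ('a \<Rightarrow> 'w \<Rightarrow> real) \<Rightarrow> bool" where
  "second_order M A Q \<longleftrightarrow>
     (\<forall>s\<in>A. Q s \<in> borel_measurable M \<and> integrable M (\<lambda>\<omega>. (Q s \<omega>)\<^sup>2))"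

definition covariance :: "'w measure \<Rightarrow> ('w \<Rightarrow> real) \<Rightarrow> ('w \<Rightarrow> real) \<Rightarrow> real" where
  "covariance M X Y =
     (\<integral>\<omega>. (X \<omega> - integral\<^sup>L M X) * (Y \<omega> - integral\<^sup>L M Y) \<partial>M)"

definition correlation :: "'w measure \<Rightarrow> ('w \<Rightarrow> real) \<Rightarrow> ('w \<Rightarrow> real) \<Rightarrow> real" where
  "correlation M X Y = covariance M X Y / sqrt (covariance M X X * covariance M Y Y)"

definition weakly_stationary ::
  "'w measure \<Rightarrow> 'a::real_vector set \<Rightarrow> ('a \<Rightarrow> 'w \<Rightarrow> real) \<Rightarrow> bool" where
  "weakly_stationary M A Q \<longleftrightarrow> second_order M A Q \<and>
     (\<forall>s\<in>A. \<forall>t\<in>A. integral\<^sup>L M (Q s) = integral\<^sup>L M (Q t)) \<and>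
     (\<forall>s\<in>A. \<forall>t\<in>A. \<forall>s'\<in>A. \<forall>t'\<in>A. s - t = s' - t' \<longrightarrow>
        covariance M (Q s) (Q t) = covariance M (Q s') (Q t'))"

definition lags :: "'a::real_vector set \<Rightarrow> 'a set" where
  "lags A = {s - t | s t. s \<in> A \<and> t \<in> A}"

text \<open>Only meaningful for \<open>h \<in> lags A\<close> and when the correlation depends on the lag alone (in
  particular under weak stationarity), so that the description is unique.\<close>

definition correlation_function ::
  "'w measure \<Rightarrow> 'a::real_vector set \<Rightarrow> ('a \<Rightarrow> 'w \<Rightarrow> real) \<Rightarrow> 'a \<Rightarrow> real" where
  "correlation_function M A Q h =
     (THE r. \<exists>s\<in>A. \<exists>t\<in>A. h = s - t \<and> r = correlation M (Q s) (Q t))"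

text \<open>The integral is a \<open>nn_integral\<close>, hence defined (as a lower integral) even if the correlation
  function is not measurable.\<close>

definition long_range_dependent ::
  "'w measure \<Rightarrow> ('a::euclidean_space \<Rightarrow> 'w \<Rightarrow> real) \<Rightarrow> bool" where
  "long_range_dependent M Q \<longleftrightarrow>
     (\<integral>\<^sup>+h\<in>{h. \<forall>i\<in>Basis. 0 \<le> h \<bullet> i}. ennreal \<bar>correlation_function M UNIV Q h\<bar> \<partial>lborel) = \<infinity>"

section \<open>Mean-square continuity and differentiability\<close>

definition ms_continuous ::
  "'w measure \<Rightarrow> 'a::euclidean_space set \<Rightarrow> ('a \<Rightarrow> 'w \<Rightarrow> real) \<Rightarrow> bool" where
  "ms_continuous M A Q \<longleftrightarrow> second_order M A Q \<and>
     (\<forall>s\<in>A. ((\<lambda>t. \<integral>\<omega>. (Q t \<omega> - Q s \<omega>)\<^sup>2 \<partial>M) \<longlongrightarrow> 0) (at s within A))"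

text \<open>Frechet differentiability of \<open>Q\<close> at every point of \<open>A\<close> as a map into \<open>L\<^sup>2(M)\<close>; \<open>D i\<close> is the
  process of mean-square partial derivatives in the coordinate direction \<open>i\<close>.\<close>

definition ms_has_derivative ::
  "'w measure \<Rightarrow> 'a::euclidean_space set \<Rightarrow> ('a \<Rightarrow> 'w \<Rightarrow> real) \<Rightarrow> ('a \<Rightarrow> 'a \<Rightarrow> 'w \<Rightarrow> real) \<Rightarrow> bool" where
  "ms_has_derivative M A Q D \<longleftrightarrow> second_order M A Q \<and> (\<forall>i\<in>Basis. second_order M A (D i)) \<and>
     (\<forall>s\<in>A. ((\<lambda>t. (\<integral>\<omega>. (Q t \<omega> - Q s \<omega> - (\<Sum>i\<in>Basis. ((t - s) \<bullet> i) * D i s \<omega>))\<^sup>2 \<partial>M)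
                   / (norm (t - s))\<^sup>2) \<longlongrightarrow> 0) (at s within A))"

primrec ms_derivatives_exist ::
  "nat \<Rightarrow> 'w measure \<Rightarrow> 'a::euclidean_space set \<Rightarrow> ('a \<Rightarrow> 'w \<Rightarrow> real) \<Rightarrow> bool" where
  "ms_derivatives_exist 0 M A Q \<longleftrightarrow> second_order M A Q"
| "ms_derivatives_exist (Suc m) M A Q \<longleftrightarrow>
     (\<exists>D. ms_has_derivative M A Q D \<and> (\<forall>i\<in>Basis. ms_derivatives_exist m M A (D i)))"

text \<open>The first conjunct matters only for \<open>m = 0\<close>, which is read as mean-square continuity; it does
  not demand continuity of the derivatives of order \<open>m > 0\<close>.\<close>

definition ms_differentiable ::
  "nat \<Rightarrow> 'w measure \<Rightarrow> 'a::euclidean_space set \<Rightarrow> ('a \<Rightarrow> 'w \<Rightarrow> real) \<Rightarrow> bool" where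
  "ms_differentiable m M A Q \<longleftrightarrow> ms_continuous M A Q \<and> ms_derivatives_exist m M A Q"

section \<open>Gaussian processes\<close>

text \<open>Constants are included as degenerate Gaussian variables.\<close>

definition gaussian_variable :: "'w measure \<Rightarrow> ('w \<Rightarrow> real) \<Rightarrow> bool" where
  "gaussian_variable M X \<longleftrightarrow> X \<in> borel_measurable M \<and>
     ((\<exists>\<mu> \<sigma>. 0 < \<sigma> \<and> distributed M lborel X (normal_density \<mu> \<sigma>)) \<or> (\<exists>\<mu>. AE \<omega> in M. X \<omega> = \<mu>))"

definition gaussian_process :: "'w measure \<Rightarrow> 'a set \<Rightarrow> ('a \<Rightarrow> 'w \<Rightarrow> real) \<Rightarrow> bool" where
  "gaussian_process M A G \<longleftrightarrow>
     (\<forall>F c. finite F \<and> F \<subseteq> A \<longrightarrow> gaussian_variable M (\<lambda>\<omega>. \<Sum>s\<in>F. c s * G s \<omega>))"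

definition standard_gaussian_process ::
  "'w measure \<Rightarrow> 'a::real_vector set \<Rightarrow> ('a \<Rightarrow> real) \<Rightarrow> ('a \<Rightarrow> 'w \<Rightarrow> real) \<Rightarrow> bool" where
  "standard_gaussian_process M A \<rho> G \<longleftrightarrow>
     gaussian_process M A G \<and> weakly_stationary M A G \<and>
     (\<forall>s\<in>A. integral\<^sup>L M (G s) = 0 \<and> covariance M (G s) (G s) = 1) \<and>
     (\<forall>s\<in>A. \<forall>t\<in>A. correlation M (G s) (G t) = \<rho> (s - t))"

section \<open>The Gamma mixing process\<close>

text \<open>A process as a single random element of the product space \<open>\<real>\<^sup>A\<close>.\<close>

definition path :: "'a set \<Rightarrow> ('a \<Rightarrow> 'w \<Rightarrow> real) \<Rightarrow> 'w \<Rightarrow> 'a \<Rightarrow> real" where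
  "path A Q = (\<lambda>\<omega>. \<lambda>s\<in>A. Q s \<omega>)"

abbreviation path_space :: "'a set \<Rightarrow> ('a \<Rightarrow> real) measure" where
  "path_space A \<equiv> Pi\<^sub>M A (\<lambda>_. borel)"

definition gamma_density :: "real \<Rightarrow> real \<Rightarrow> real \<Rightarrow> real" where
  "gamma_density a r x =
     (if 0 < x then r powr a / Gamma a * x powr (a - 1) * exp (- r * x) else 0)"

definition hypergeom_0F1 :: "real \<Rightarrow> real \<Rightarrow> real" where
  "hypergeom_0F1 b x = (\<Sum>k. x ^ k / (fact k * pochhammer b k))"

definition bivariate_gamma_density :: "real \<Rightarrow> real \<Rightarrow> real \<times> real \<Rightarrow> real" where
  "bivariate_gamma_density \<nu> r = (\<lambda>(x, y).
     if 0 < x \<and> 0 < y then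
       2 powr (- \<nu>) * \<nu> powr \<nu> * (x * y) powr (\<nu> / 2 - 1)
         / ((Gamma (\<nu> / 2))\<^sup>2 * (1 - r\<^sup>2) powr (\<nu> / 2))
         * exp (- (\<nu> * (x + y) / (2 * (1 - r\<^sup>2))))
         * hypergeom_0F1 (\<nu> / 2) (\<nu>\<^sup>2 * r\<^sup>2 * x * y / (4 * (1 - r\<^sup>2)\<^sup>2))
     else 0)"

text \<open>Integer degrees of freedom: \<open>H 0\<close> is the parent process, \<open>H 1, \<dots>, H n\<close> are its copies.\<close>

definition chi_square_mixing ::
  "'w measure \<Rightarrow> 'a set \<Rightarrow> nat \<Rightarrow> ('a \<Rightarrow> 'w \<Rightarrow> real) \<Rightarrow> ('a \<Rightarrow> 'w \<Rightarrow> real) \<Rightarrow> bool" where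
  "chi_square_mixing M A n G W \<longleftrightarrow>
     (\<exists>H :: nat \<Rightarrow> 'a \<Rightarrow> 'w \<Rightarrow> real. H 0 = G \<and>
        prob_space.indep_vars M (\<lambda>_. path_space A) (\<lambda>i. path A (H i)) {0..n} \<and>
        (\<forall>i\<in>{1..n}. distr M (path_space A) (path A (H i)) = distr M (path_space A) (path A G)) \<and>
        (\<forall>s\<in>A. \<forall>\<omega>\<in>space M. W s \<omega> = 1 / real n * (\<Sum>i=1..n. (H i s \<omega>)\<^sup>2)))"

text \<open>Non-integer degrees of freedom: the process is specified through its bivariate laws.\<close>

definition gamma_law_mixing ::
  "'w measure \<Rightarrow> 'a::real_vector set \<Rightarrow> ('a \<Rightarrow> real) \<Rightarrow> real \<Rightarrow>
     ('a \<Rightarrow> 'w \<Rightarrow> real) \<Rightarrow> ('a \<Rightarrow> 'w \<Rightarrow> real) \<Rightarrow> bool" where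
  "gamma_law_mixing M A \<rho> \<nu> G W \<longleftrightarrow>
     prob_space.indep_var M (path_space A) (path A G) (path_space A) (path A W) \<and>
     (\<forall>s\<in>A. (AE \<omega> in M. 0 < W s \<omega>) \<and>
        distributed M lborel (W s) (gamma_density (\<nu> / 2) (\<nu> / 2))) \<and>
     (\<forall>s\<in>A. \<forall>t\<in>A. \<bar>\<rho> (s - t)\<bar> < 1 \<longrightarrow>
        distributed M (lborel \<Otimes>\<^sub>M lborel) (\<lambda>\<omega>. (W s \<omega>, W t \<omega>))
          (bivariate_gamma_density \<nu> (\<rho> (s - t)))) \<and>
     (\<forall>s\<in>A. \<forall>t\<in>A. \<bar>\<rho> (s - t)\<bar> = 1 \<longrightarrow> (AE \<omega> in M. W s \<omega> = W t \<omega>))"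

definition gamma_mixing ::
  "'w measure \<Rightarrow> 'a::real_vector set \<Rightarrow> ('a \<Rightarrow> real) \<Rightarrow> real \<Rightarrow>
     ('a \<Rightarrow> 'w \<Rightarrow> real) \<Rightarrow> ('a \<Rightarrow> 'w \<Rightarrow> real) \<Rightarrow> bool" where
  "gamma_mixing M A \<rho> \<nu> G W \<longleftrightarrow>
     (if \<nu> \<in> \<nat> then chi_square_mixing M A (nat \<lfloor>\<nu>\<rfloor>) G W else gamma_law_mixing M A \<rho> \<nu> G W)"

section \<open>The standard t process\<close>

definition standard_t_process ::
  "'w measure \<Rightarrow> 'a::real_vector set \<Rightarrow> ('a \<Rightarrow> real) \<Rightarrow> real \<Rightarrow>
     ('a \<Rightarrow> 'w \<Rightarrow> real) \<Rightarrow> ('a \<Rightarrow> 'w \<Rightarrow> real) \<Rightarrow> ('a \<Rightarrow> 'w \<Rightarrow> real) \<Rightarrow> bool" where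
  "standard_t_process M A \<rho> \<nu> G W Y \<longleftrightarrow>
     prob_space M \<and> standard_gaussian_process M A \<rho> G \<and> gamma_mixing M A \<rho> \<nu> G W \<and>
     (\<forall>s\<in>A. \<forall>\<omega>\<in>space M. Y s \<omega> = W s \<omega> powr (- 1 / 2) * G s \<omega>)"

end

theory Submission
  imports Defs "HOL-Real_Asymp.Real_Asymp"
begin

text \<open>Put \<open>a = \<nu> / 2\<close>. Both kinds of mixing process have the joint Laplace transform
  \<open>((1 + \<theta>/a)(1 + \<eta>/a) - \<rho>\<^sup>2 \<theta>\<eta>/a\<^sup>2)\<^sup>-\<^sup>a\<close>. Integrating it against \<open>(\<theta>\<eta>)\<^sup>-\<^sup>1\<^sup>/\<^sup>2\<close> and expanding
  binomially shows that \<open>E (W(s) W(t))\<^sup>-\<^sup>1\<^sup>/\<^sup>2\<close> is a constant times \<open>F(\<rho>\<^sup>2)\<close>, where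
  \<open>F = \<^sub>2F\<^sub>1(1/2, 1/2; a; \<cdot>)\<close> has positive coefficients of order \<open>k\<^sup>-\<^sup>a\<close>. Hence the correlation of
  the \<open>t\<close> process is \<open>\<rho> F(\<rho>\<^sup>2) / F(1)\<close>, which lies between \<open>\<rho> / F(1)\<close> and \<open>\<rho>\<close>, and \<open>F(1)\<close>
  tends to 1 as \<open>a\<close> grows. The function \<open>r F(r\<^sup>2)\<close> is \<open>2m\<close> times differentiable on the closed
  interval \<open>[-1, 1]\<close> as soon as \<open>a > 2m + 1\<close>. Mean-square differentiability of order \<open>m\<close>
  transfers because it is inherited by the correlation at order \<open>2m\<close>, preserved by composition
  with this function, and recovered from the correlation by completeness of \<open>L\<^sup>2\<close>.\<close>

section \<open>Square-integrable variables\<close>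

text \<open>The inverse square roots enter through the Gamma integral of
  \<open>\<theta>^(-1/2) exp(-\<theta> w)\<close>, which equals \<open>sqrt pi * w^(-1/2)\<close>;
  this is why a Laplace transform suffices. Unlike a bivariate density, a transform also exists when
  \<open>|\<rho>| = 1\<close>, and lag 0, which decides continuity and smoothness, is of this kind.
  There \<open>F\<close> is evaluated on the boundary of its disc of convergence: \<open>n\<close>
  differentiations turn coefficients of order \<open>k^(-a)\<close> into \<open>k^(n-a)\<close>,
  summable when \<open>a > n + 1\<close>, and \<open>n = 2m\<close> gives the threshold
  \<open>\<nu> > 2(2m + 1)\<close>. The highest derivatives of the correlation need not be
  continuous, so the Taylor estimates rest on differentiability at a point and the mean value
  theorem. Since the factor \<open>F(\<rho>^2)/F(1)\<close> is at most 1, the correlation is pulled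
  towards 0. For negative \<open>\<rho>\<close> this can only raise it, so the inequality in (e) is
  stated for nonnegative \<open>\<rho>\<close> and for absolute values.\<close>

definition square_integrable :: "'w measure \<Rightarrow> ('w \<Rightarrow> real) \<Rightarrow> bool" where
  "square_integrable M f \<longleftrightarrow> f \<in> borel_measurable M \<and> integrable M (\<lambda>\<omega>. (f \<omega>)\<^sup>2)"

lemma second_order_iff: "second_order M A Q \<longleftrightarrow> (\<forall>s\<in>A. square_integrable M (Q s))"
  by (simp add: second_order_def square_integrable_def)

lemma integrable_mult_square_integrable:
  assumes "square_integrable M f" "square_integrable M g"
  shows "integrable M (\<lambda>\<omega>. f \<omega> * g \<omega>)"
proof -
  have [measurable]: "f \<in> borel_measurable M" "g \<in> borel_measurable M"
    using assms by (auto simp: square_integrable_def)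
  have "integrable M (\<lambda>\<omega>. (f \<omega>)\<^sup>2 + (g \<omega>)\<^sup>2)"
    using assms by (auto simp: square_integrable_def)
  then show ?thesis
  proof (rule Bochner_Integration.integrable_bound)
    show "AE \<omega> in M. norm (f \<omega> * g \<omega>) \<le> norm ((f \<omega>)\<^sup>2 + (g \<omega>)\<^sup>2)"
    proof (rule AE_I2)
      fix \<omega>
      have "2 * (\<bar>f \<omega>\<bar> * \<bar>g \<omega>\<bar>) \<le> (f \<omega>)\<^sup>2 + (g \<omega>)\<^sup>2"
        using sum_squares_bound[of "\<bar>f \<omega>\<bar>" "\<bar>g \<omega>\<bar>"] by simp
      then show "norm (f \<omega> * g \<omega>) \<le> norm ((f \<omega>)\<^sup>2 + (g \<omega>)\<^sup>2)"
        unfolding real_norm_def abs_mult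
        using mult_nonneg_nonneg[OF abs_ge_zero[of "f \<omega>"] abs_ge_zero[of "g \<omega>"]] by linarith
    qed
  qed simp
qed

lemma square_integrable_add:
  assumes "square_integrable M f" "square_integrable M g"
  shows "square_integrable M (\<lambda>\<omega>. f \<omega> + g \<omega>)"
  using assms integrable_mult_square_integrable[OF assms]
  by (auto simp: square_integrable_def power2_sum mult.assoc)

lemma square_integrable_cmult:
  assumes "square_integrable M f"
  shows "square_integrable M (\<lambda>\<omega>. c * f \<omega>)"
  using assms by (auto simp: square_integrable_def power_mult_distrib)

lemma square_integrable_diff:
  assumes "square_integrable M f" "square_integrable M g"
  shows "square_integrable M (\<lambda>\<omega>. f \<omega> - g \<omega>)"
  using square_integrable_add[OF assms(1) square_integrable_cmult[OF assms(2), of "-1"]] by simp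

lemma square_integrable_sum:
  assumes "\<And>i. i \<in> I \<Longrightarrow> square_integrable M (f i)"
  shows "square_integrable M (\<lambda>\<omega>. \<Sum>i\<in>I. f i \<omega>)"
  using assms
proof (induction I rule: infinite_finite_induct)
  case (insert x F)
  then show ?case by (auto intro!: square_integrable_add)
qed (auto simp: square_integrable_def)

lemma square_integrable_divide:
  "square_integrable M f \<Longrightarrow> square_integrable M (\<lambda>\<omega>. f \<omega> / c)"
  using square_integrable_cmult[of M f "1 / c"] by simp

lemmas square_integrable_intros = square_integrable_add square_integrable_diff
  square_integrable_cmult square_integrable_sum square_integrable_divide

lemma Cauchy_Schwarz_integral:
  assumes "square_integrable M f" "square_integrable M g"
  shows "\<bar>\<integral>\<omega>. f \<omega> * g \<omega> \<partial>M\<bar> \<le> sqrt (\<integral>\<omega>. (f \<omega>)\<^sup>2 \<partial>M) * sqrt (\<integral>\<omega>. (g \<omega>)\<^sup>2 \<partial>M)"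
proof -
  have [measurable]: "f \<in> borel_measurable M" "g \<in> borel_measurable M"
    and sq: "integrable M (\<lambda>\<omega>. (f \<omega>)\<^sup>2)" "integrable M (\<lambda>\<omega>. (g \<omega>)\<^sup>2)"
    using assms by (auto simp: square_integrable_def)
  let ?I = "\<integral>\<omega>. \<bar>f \<omega>\<bar> * \<bar>g \<omega>\<bar> \<partial>M"
  have int: "integrable M (\<lambda>\<omega>. \<bar>f \<omega>\<bar> * \<bar>g \<omega>\<bar>)"
    using integrable_abs[OF integrable_mult_square_integrable[OF assms]] by (simp add: abs_mult)
  have "(\<integral>\<^sup>+\<omega>. ennreal \<bar>f \<omega>\<bar> * ennreal \<bar>g \<omega>\<bar> \<partial>M)\<^sup>2
      \<le> (\<integral>\<^sup>+\<omega>. (ennreal \<bar>f \<omega>\<bar>)\<^sup>2 \<partial>M) * (\<integral>\<^sup>+\<omega>. (ennreal \<bar>g \<omega>\<bar>)\<^sup>2 \<partial>M)"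
    by (rule Cauchy_Schwarz_nn_integral) auto
  also have "(\<integral>\<^sup>+\<omega>. ennreal \<bar>f \<omega>\<bar> * ennreal \<bar>g \<omega>\<bar> \<partial>M) = ennreal ?I"
    using nn_integral_eq_integral[OF int] by (simp add: ennreal_mult)
  also have "(\<integral>\<^sup>+\<omega>. (ennreal \<bar>f \<omega>\<bar>)\<^sup>2 \<partial>M) = ennreal (\<integral>\<omega>. (f \<omega>)\<^sup>2 \<partial>M)"
    using nn_integral_eq_integral[OF sq(1)] by (simp add: ennreal_power)
  also have "(\<integral>\<^sup>+\<omega>. (ennreal \<bar>g \<omega>\<bar>)\<^sup>2 \<partial>M) = ennreal (\<integral>\<omega>. (g \<omega>)\<^sup>2 \<partial>M)"
    using nn_integral_eq_integral[OF sq(2)] by (simp add: ennreal_power)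
  finally have "?I\<^sup>2 \<le> (\<integral>\<omega>. (f \<omega>)\<^sup>2 \<partial>M) * (\<integral>\<omega>. (g \<omega>)\<^sup>2 \<partial>M)"
    by (simp add: ennreal_power flip: ennreal_mult)
  then have "?I \<le> sqrt ((\<integral>\<omega>. (f \<omega>)\<^sup>2 \<partial>M) * (\<integral>\<omega>. (g \<omega>)\<^sup>2 \<partial>M))"
    by (rule real_le_rsqrt)
  moreover have "\<bar>\<integral>\<omega>. f \<omega> * g \<omega> \<partial>M\<bar> \<le> ?I"
    using integral_abs_bound[of M "\<lambda>\<omega>. f \<omega> * g \<omega>"] by (simp add: abs_mult)
  ultimately show ?thesis by (simp add: real_sqrt_mult)
qed

lemma tendsto_integral_mult_square_integrable:
  assumes "\<forall>\<^sub>F n in F. square_integrable M (f n)" "square_integrable M f0" "square_integrable M g"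
    and "((\<lambda>n. \<integral>\<omega>. (f n \<omega> - f0 \<omega>)\<^sup>2 \<partial>M) \<longlongrightarrow> 0) F"
  shows "((\<lambda>n. \<integral>\<omega>. f n \<omega> * g \<omega> \<partial>M) \<longlongrightarrow> (\<integral>\<omega>. f0 \<omega> * g \<omega> \<partial>M)) F"
proof (rule Lim_null[THEN iffD2], rule Lim_null_comparison)
  show "\<forall>\<^sub>F n in F. norm ((\<integral>\<omega>. f n \<omega> * g \<omega> \<partial>M) - (\<integral>\<omega>. f0 \<omega> * g \<omega> \<partial>M))
      \<le> sqrt (\<integral>\<omega>. (f n \<omega> - f0 \<omega>)\<^sup>2 \<partial>M) * sqrt (\<integral>\<omega>. (g \<omega>)\<^sup>2 \<partial>M)"
    using assms(1)
  proof eventually_elim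
    case (elim n)
    have "(\<integral>\<omega>. f n \<omega> * g \<omega> \<partial>M) - (\<integral>\<omega>. f0 \<omega> * g \<omega> \<partial>M) = (\<integral>\<omega>. (f n \<omega> - f0 \<omega>) * g \<omega> \<partial>M)"
      using elim assms by (simp add: left_diff_distrib integrable_mult_square_integrable)
    then show ?case
      using Cauchy_Schwarz_integral[OF square_integrable_diff[OF elim assms(2)] assms(3)] by simp
  qed
  show "((\<lambda>n. sqrt (\<integral>\<omega>. (f n \<omega> - f0 \<omega>)\<^sup>2 \<partial>M) * sqrt (\<integral>\<omega>. (g \<omega>)\<^sup>2 \<partial>M)) \<longlongrightarrow> 0) F"
    using tendsto_mult_right[OF tendsto_real_sqrt[OF assms(4)], of "sqrt (\<integral>\<omega>. (g \<omega>)\<^sup>2 \<partial>M)"]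
    by (simp add: mult.commute)
qed

text \<open>On a probability space the L2 distance dominates the L1 distance, so a Cauchy sequence
  in L2 has a subsequence converging almost everywhere; Fatou's lemma then bounds the L2 distance to
  the pointwise limit.\<close>

lemma (in prob_space) square_integrable_complete:
  assumes sq: "\<And>n::nat. square_integrable M (f n)"
    and cauchy: "\<And>e. e > 0 \<Longrightarrow> \<exists>N. \<forall>m\<ge>N. \<forall>n\<ge>N. (\<integral>\<omega>. (f m \<omega> - f n \<omega>)\<^sup>2 \<partial>M) < e"
  shows "\<exists>g. square_integrable M g \<and> (\<lambda>n. \<integral>\<omega>. (f n \<omega> - g \<omega>)\<^sup>2 \<partial>M) \<longlonglongrightarrow> 0"
proof -
  have [measurable]: "f n \<in> borel_measurable M" for n
    using sq by (auto simp: square_integrable_def)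
  have one: "square_integrable M (\<lambda>_. 1)" by (simp add: square_integrable_def)
  have int: "integrable M (f n)" for n
    using integrable_mult_square_integrable[OF sq[of n] one] by simp
  have L1: "(\<integral>\<omega>. norm (f m \<omega> - f n \<omega>) \<partial>M) \<le> sqrt (\<integral>\<omega>. (f m \<omega> - f n \<omega>)\<^sup>2 \<partial>M)" for m n
  proof -
    have "square_integrable M (\<lambda>\<omega>. \<bar>f m \<omega> - f n \<omega>\<bar>)"
      using square_integrable_diff[OF sq[of m] sq[of n]] by (simp add: square_integrable_def)
    from Cauchy_Schwarz_integral[OF this one] show ?thesis
      by (simp add: prob_space)
  qed
  obtain r where r: "strict_mono r" "AE \<omega> in M. Cauchy (\<lambda>i. f (r i) \<omega>)"
  proof (rule cauchy_L1_AE_cauchy_subseq[OF int])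
    fix e :: real assume "e > 0"
    then obtain N where N: "\<forall>m\<ge>N. \<forall>n\<ge>N. (\<integral>\<omega>. (f m \<omega> - f n \<omega>)\<^sup>2 \<partial>M) < e\<^sup>2"
      using cauchy[of "e\<^sup>2"] by auto
    have "(\<integral>\<omega>. norm (f m \<omega> - f n \<omega>) \<partial>M) < e" if "m \<ge> N" "n \<ge> N" for m n
    proof -
      have "sqrt (\<integral>\<omega>. (f m \<omega> - f n \<omega>)\<^sup>2 \<partial>M) < e"
        using N that \<open>e > 0\<close> by (intro real_less_lsqrt) auto
      then show ?thesis using L1[of m n] by simp
    qed
    then show "\<exists>N. \<forall>i\<ge>N. \<forall>j\<ge>N. (\<integral>\<omega>. norm (f i \<omega> - f j \<omega>) \<partial>M) < e" by blast
  qed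
  define g where "g \<omega> = lim (\<lambda>i. f (r i) \<omega>)" for \<omega>
  have [measurable]: "g \<in> borel_measurable M" unfolding g_def by measurable
  have lim: "AE \<omega> in M. (\<lambda>i. f (r i) \<omega>) \<longlonglongrightarrow> g \<omega>"
    using r(2) by eventually_elim (simp add: g_def Cauchy_convergent_iff convergent_LIMSEQ_iff)
  \<comment> \<open>Fatou is applied along the subsequence only, with \<open>f n\<close> held fixed;
    the Cauchy bound between \<open>f n\<close> and \<open>f (r i)\<close> survives because
    \<open>r i\<close> is at least \<open>i\<close>.\<close>
  have fatou: "(\<integral>\<^sup>+\<omega>. ennreal ((f n \<omega> - g \<omega>)\<^sup>2) \<partial>M) \<le> ennreal e"
    if N: "\<forall>m\<ge>N. \<forall>n\<ge>N. (\<integral>\<omega>. (f m \<omega> - f n \<omega>)\<^sup>2 \<partial>M) < e" and "n \<ge> N" for N n e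
  proof -
    have "(\<integral>\<^sup>+\<omega>. ennreal ((f n \<omega> - g \<omega>)\<^sup>2) \<partial>M)
        = (\<integral>\<^sup>+\<omega>. liminf (\<lambda>i. ennreal ((f n \<omega> - f (r i) \<omega>)\<^sup>2)) \<partial>M)"
    proof (rule nn_integral_cong_AE)
      show "AE \<omega> in M. ennreal ((f n \<omega> - g \<omega>)\<^sup>2) = liminf (\<lambda>i. ennreal ((f n \<omega> - f (r i) \<omega>)\<^sup>2))"
        using lim
      proof eventually_elim
        case (elim \<omega>)
        have "(\<lambda>i. ennreal ((f n \<omega> - f (r i) \<omega>)\<^sup>2)) \<longlonglongrightarrow> ennreal ((f n \<omega> - g \<omega>)\<^sup>2)"
          using elim by (intro tendsto_intros)
        then show ?case
          using lim_imp_Liminf[OF sequentially_bot] by metis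
      qed
    qed
    also have "\<dots> \<le> liminf (\<lambda>i. \<integral>\<^sup>+\<omega>. ennreal ((f n \<omega> - f (r i) \<omega>)\<^sup>2) \<partial>M)"
      by (rule nn_integral_liminf) simp
    also have "\<dots> \<le> liminf (\<lambda>i. ennreal e)"
    proof (rule Liminf_mono)
      have "\<forall>\<^sub>F i in sequentially. r i \<ge> N"
        using eventually_ge_at_top[of N]
        by eventually_elim (use r(1) le_trans strict_mono_imp_increasing in blast)
      then show "\<forall>\<^sub>F i in sequentially. (\<integral>\<^sup>+\<omega>. ennreal ((f n \<omega> - f (r i) \<omega>)\<^sup>2) \<partial>M) \<le> ennreal e"
      proof eventually_elim
        case (elim i)
        have "integrable M (\<lambda>\<omega>. (f n \<omega> - f (r i) \<omega>)\<^sup>2)"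
          using square_integrable_diff[OF sq sq] by (simp add: square_integrable_def)
        then show ?case
          using N \<open>n \<ge> N\<close> elim by (simp add: nn_integral_eq_integral ennreal_leI less_imp_le)
      qed
    qed
    finally show ?thesis by (simp add: Liminf_const)
  qed
  have sqd: "square_integrable M (\<lambda>\<omega>. f n \<omega> - g \<omega>)" 
    if N: "\<forall>m\<ge>N. \<forall>n\<ge>N. (\<integral>\<omega>. (f m \<omega> - f n \<omega>)\<^sup>2 \<partial>M) < e" and "n \<ge> N" for N n e
    unfolding square_integrable_def
    using fatou[OF that] by (auto simp: integrable_iff_bounded intro: le_less_trans)
  obtain N1 where N1: "\<forall>m\<ge>N1. \<forall>n\<ge>N1. (\<integral>\<omega>. (f m \<omega> - f n \<omega>)\<^sup>2 \<partial>M) < 1"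
    using cauchy[of 1] by auto
  have g: "square_integrable M g"
    \<comment> \<open>The limit is recovered as \<open>f N1 - (f N1 - g)\<close>, a difference of
      two square-integrable functions.\<close>
    using square_integrable_diff[OF sq[of N1] sqd[OF N1, of N1]] by simp
  have "(\<lambda>n. \<integral>\<omega>. (f n \<omega> - g \<omega>)\<^sup>2 \<partial>M) \<longlonglongrightarrow> 0"
  proof (rule LIMSEQ_I)
    fix e :: real assume "e > 0"
    then obtain N where N: "\<forall>m\<ge>N. \<forall>n\<ge>N. (\<integral>\<omega>. (f m \<omega> - f n \<omega>)\<^sup>2 \<partial>M) < e / 2"
      using cauchy[of "e / 2"] by auto
    have le: "(\<integral>\<omega>. (f n \<omega> - g \<omega>)\<^sup>2 \<partial>M) \<le> e / 2" if "n \<ge> N" for n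
    proof -
      have "integrable M (\<lambda>\<omega>. (f n \<omega> - g \<omega>)\<^sup>2)"
        using sqd[OF N that] by (simp add: square_integrable_def)
      then show ?thesis
        using fatou[OF N that] \<open>e > 0\<close> by (simp add: nn_integral_eq_integral)
    qed
    show "\<exists>N. \<forall>n\<ge>N. norm ((\<integral>\<omega>. (f n \<omega> - g \<omega>)\<^sup>2 \<partial>M) - 0) < e"
    proof (intro exI allI impI)
      fix n assume "N \<le> n"
      from le[OF this] \<open>e > 0\<close> show "norm ((\<integral>\<omega>. (f n \<omega> - g \<omega>)\<^sup>2 \<partial>M) - 0) < e"
        by simp
    qed
  qed
  with g show ?thesis by blast
qed

section \<open>Iterated Frechet derivatives\<close>

text \<open>Mirrors \<open>ms_derivatives_exist\<close>: the derivatives of order \<open>n\<close> need not be continuous.\<close>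

primrec differentiable_upto :: "nat \<Rightarrow> ('a::euclidean_space \<Rightarrow> real) \<Rightarrow> 'a set \<Rightarrow> bool" where
  "differentiable_upto 0 f S \<longleftrightarrow> True"
| "differentiable_upto (Suc n) f S \<longleftrightarrow>
     (\<exists>D. (\<forall>x\<in>S. (f has_derivative (\<lambda>u. \<Sum>i\<in>Basis. (u \<bullet> i) * D i x)) (at x)) \<and>
          (\<forall>i\<in>Basis. differentiable_upto n (D i) S))"

lemma differentiable_upto_SucI:
  assumes "\<And>x. x \<in> S \<Longrightarrow> (f has_derivative (\<lambda>u. \<Sum>i\<in>Basis. (u \<bullet> i) * D i x)) (at x)"
    and "\<And>i. i \<in> Basis \<Longrightarrow> differentiable_upto n (D i) S"
  shows "differentiable_upto (Suc n) f S"
  using assms unfolding differentiable_upto.simps(2) by blast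

lemma differentiable_upto_SucD: "differentiable_upto (Suc n) f S \<Longrightarrow> differentiable_upto n f S"
proof (induction n arbitrary: f)
  case (Suc n)
  obtain D where "\<forall>x\<in>S. (f has_derivative (\<lambda>u. \<Sum>i\<in>Basis. (u \<bullet> i) * D i x)) (at x)"
      "\<forall>i\<in>Basis. differentiable_upto (Suc n) (D i) S"
    using differentiable_upto.simps(2)[THEN iffD1, OF Suc.prems(1)] by blast
  note D = this[rule_format]
  show ?case by (rule differentiable_upto_SucI[where D = D, OF D(1) Suc.IH[OF D(2)]])
qed simp

lemma differentiable_upto_const: "differentiable_upto n (\<lambda>x. c) S"
  by (induction n arbitrary: c) (auto intro!: exI[of _ "\<lambda>_ _. 0"])

lemma differentiable_upto_add:
  "differentiable_upto n f S \<Longrightarrow> differentiable_upto n g S \<Longrightarrow> differentiable_upto n (\<lambda>x. f x + g x) S"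
proof (induction n arbitrary: f g)
  case (Suc n)
  obtain D where "\<forall>x\<in>S. (f has_derivative (\<lambda>u. \<Sum>i\<in>Basis. (u \<bullet> i) * D i x)) (at x)"
      "\<forall>i\<in>Basis. differentiable_upto n (D i) S"
    using differentiable_upto.simps(2)[THEN iffD1, OF Suc.prems(1)] by blast
  note D = this[rule_format]
  obtain E where "\<forall>x\<in>S. (g has_derivative (\<lambda>u. \<Sum>i\<in>Basis. (u \<bullet> i) * E i x)) (at x)"
      "\<forall>i\<in>Basis. differentiable_upto n (E i) S"
    using differentiable_upto.simps(2)[THEN iffD1, OF Suc.prems(2)] by blast
  note E = this[rule_format]
  have "((\<lambda>x. f x + g x) has_derivative (\<lambda>u. \<Sum>i\<in>Basis. (u \<bullet> i) * (D i x + E i x))) (at x)"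
    if "x \<in> S" for x
    using has_derivative_add[OF D(1)[OF that] E(1)[OF that]]
    by (simp add: distrib_left sum.distrib)
  then show ?case
    by (intro differentiable_upto_SucI[where D = "\<lambda>i x. D i x + E i x"] Suc.IH D(2) E(2))
qed simp

lemma differentiable_upto_mult:
  "differentiable_upto n f S \<Longrightarrow> differentiable_upto n g S \<Longrightarrow> differentiable_upto n (\<lambda>x. f x * g x) S"
proof (induction n arbitrary: f g)
  case (Suc n)
  obtain D where "\<forall>x\<in>S. (f has_derivative (\<lambda>u. \<Sum>i\<in>Basis. (u \<bullet> i) * D i x)) (at x)"
      "\<forall>i\<in>Basis. differentiable_upto n (D i) S"
    using differentiable_upto.simps(2)[THEN iffD1, OF Suc.prems(1)] by blast
  note D = this[rule_format]
  obtain E where "\<forall>x\<in>S. (g has_derivative (\<lambda>u. \<Sum>i\<in>Basis. (u \<bullet> i) * E i x)) (at x)"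
      "\<forall>i\<in>Basis. differentiable_upto n (E i) S"
    using differentiable_upto.simps(2)[THEN iffD1, OF Suc.prems(2)] by blast
  note E = this[rule_format]
  have "((\<lambda>x. f x * g x) has_derivative (\<lambda>u. \<Sum>i\<in>Basis. (u \<bullet> i) * (f x * E i x + D i x * g x))) (at x)"
    if "x \<in> S" for x
    using has_derivative_mult[OF D(1)[OF that] E(1)[OF that]]
    by (simp add: sum_distrib_left sum_distrib_right sum.distrib algebra_simps)
  \<comment> \<open>The product rule leaves \<open>f\<close> and \<open>g\<close> themselves as
    factors, so the induction hypothesis needs them at the lower order as well.\<close>
  moreover have "differentiable_upto n f S" "differentiable_upto n g S"
    using Suc.prems by (blast intro: differentiable_upto_SucD)+
  ultimately show ?case
    by (intro differentiable_upto_SucI[where D = "\<lambda>i x. f x * E i x + D i x * g x"]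
        differentiable_upto_add Suc.IH D(2) E(2))
qed simp

lemma differentiable_upto_minus:
  "differentiable_upto n f S \<Longrightarrow> differentiable_upto n (\<lambda>x. - f x) S"
  using differentiable_upto_mult[OF differentiable_upto_const[of n "-1"], of f] by simp

lemma differentiable_upto_reflect:
  "differentiable_upto n f S \<Longrightarrow> differentiable_upto n (\<lambda>x. f (- x)) (uminus ` S)"
proof (induction n arbitrary: f)
  case (Suc n)
  obtain D where "\<forall>x\<in>S. (f has_derivative (\<lambda>u. \<Sum>i\<in>Basis. (u \<bullet> i) * D i x)) (at x)"
      "\<forall>i\<in>Basis. differentiable_upto n (D i) S"
    using differentiable_upto.simps(2)[THEN iffD1, OF Suc.prems(1)] by blast
  note D = this[rule_format]
  have "((\<lambda>x. f (- x)) has_derivative (\<lambda>u. \<Sum>i\<in>Basis. (u \<bullet> i) * (- D i (- x)))) (at x)"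
    if "x \<in> uminus ` S" for x
  proof -
    have m: "((\<lambda>x::'a. - x) has_derivative (\<lambda>u. - u)) (at x)"
      by (intro derivative_eq_intros) auto
    have "- x \<in> S" using that by auto
    from has_derivative_compose[OF m D(1)[OF this]] show ?thesis
      by (simp add: inner_minus_left)
  qed
  then show ?case
    by (intro differentiable_upto_SucI[where D = "\<lambda>i x. - D i (- x)"]
        differentiable_upto_minus Suc.IH D(2))
qed simp

text \<open>The chain rule only sees values of the outer function on the range of \<open>f\<close>.
  One-sided derivatives at the ends of \<open>I\<close> are therefore enough, even at points where
  \<open>f\<close> attains an end value, and openness of \<open>S\<close> turns the result into a
  full derivative.\<close>

lemma differentiable_upto_compose:
  fixes \<phi> :: "nat \<Rightarrow> real \<Rightarrow> real"
  assumes "open S" "f ` S \<subseteq> I" "differentiable_upto n f S"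
    and "\<And>j x. j < n \<Longrightarrow> x \<in> I \<Longrightarrow> (\<phi> j has_field_derivative \<phi> (Suc j) x) (at x within I)"
  shows "differentiable_upto n (\<lambda>x. \<phi> 0 (f x)) S"
  using assms(3,4)
proof (induction n arbitrary: \<phi>)
  case (Suc n)
  obtain D where "\<forall>x\<in>S. (f has_derivative (\<lambda>u. \<Sum>i\<in>Basis. (u \<bullet> i) * D i x)) (at x)"
      "\<forall>i\<in>Basis. differentiable_upto n (D i) S"
    using differentiable_upto.simps(2)[THEN iffD1, OF Suc.prems(1)] by blast
  note D = this[rule_format]
  have "((\<lambda>x. \<phi> 0 (f x)) has_derivative (\<lambda>u. \<Sum>i\<in>Basis. (u \<bullet> i) * (\<phi> 1 (f x) * D i x))) (at x)"
    if "x \<in> S" for x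
  proof -
    have "(\<phi> 0 has_derivative (\<lambda>u. \<phi> 1 (f x) * u)) (at (f x) within f ` S)"
      using Suc.prems(2)[of 0 "f x"] assms(2) that
      by (auto simp: has_field_derivative_def intro: has_derivative_subset)
    from has_derivative_in_compose[OF has_derivative_at_withinI[OF D(1)[OF that]] this]
    show ?thesis
      using at_within_open[OF that assms(1)] by (simp add: sum_distrib_left algebra_simps)
  qed
  \<comment> \<open>The outer derivative is again a composition with the same \<open>f\<close>, so
    the induction hypothesis is used for the shifted family.\<close>
  moreover have "differentiable_upto n (\<lambda>x. \<phi> (Suc 0) (f x)) S"
    by (rule Suc.IH[of "\<lambda>j. \<phi> (Suc j)"])
       (simp_all add: differentiable_upto_SucD[OF Suc.prems(1)] Suc.prems(2) del: differentiable_upto.simps)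
  ultimately show ?case
    by (intro differentiable_upto_SucI[where D = "\<lambda>i x. \<phi> 1 (f x) * D i x"]
        differentiable_upto_mult D(2)) simp_all
qed simp

section \<open>Mean-square derivatives and the correlation\<close>

lemma open_lags: "open A \<Longrightarrow> open (lags (A :: 'a::euclidean_space set))"
proof -
  assume "open A"
  have "lags A = (\<Union>t\<in>A. (\<lambda>s. - t + s) ` A)"
    by (auto simp: lags_def image_iff)
  moreover have "open ((\<lambda>s. - t + s) ` A)" for t
    using open_translation[OF \<open>open A\<close>] .
  ultimately show ?thesis by auto
qed

lemma uminus_lags: "uminus ` lags A = lags A"
proof -
  have "- h \<in> lags A" if "h \<in> lags A" for h
  proof -
    from that obtain s t where "h = s - t" "s \<in> A" "t \<in> A" by (auto simp: lags_def)
    then have "- h = t - s" by simp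
    with \<open>s \<in> A\<close> \<open>t \<in> A\<close> show ?thesis unfolding lags_def by blast
  qed
  then show ?thesis by (force simp: image_iff)
qed

lemma lagsI: "s \<in> A \<Longrightarrow> t \<in> A \<Longrightarrow> s - t \<in> lags A"
  by (auto simp: lags_def)

section \<open>From mean-square derivatives to derivatives of cross moments\<close>

lemma ms_derivatives_exist_second_order: "ms_derivatives_exist m M A X \<Longrightarrow> second_order M A X"
  by (cases m) (auto simp: ms_has_derivative_def)

lemma ms_derivatives_exist_SucD:
  "ms_derivatives_exist (Suc m) M A X \<Longrightarrow> ms_derivatives_exist m M A X"
proof (induction m arbitrary: X)
  case 0
  then show ?case by (auto simp: ms_has_derivative_def)
next
  case (Suc m)
  then show ?case
    unfolding ms_derivatives_exist.simps(2)[of "Suc m"] ms_derivatives_exist.simps(2)[of m] by blast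
qed

lemma ms_derivatives_exist_mono:
  "ms_derivatives_exist m M A X \<Longrightarrow> k \<le> m \<Longrightarrow> ms_derivatives_exist k M A X"
  by (induction m)
     (auto simp: le_Suc_eq simp del: ms_derivatives_exist.simps(2) dest: ms_derivatives_exist_SucD)

text \<open>With \<open>t\<close> fixed, Cauchy-Schwarz against \<open>Z t\<close> turns the L2
  remainder of \<open>X\<close> at \<open>s\<close> into a scalar remainder of the same order; a
  translation by \<open>t\<close> then moves the derivative to the lag \<open>s - t\<close>.\<close>

lemma cross_moment_has_derivative:
  assumes "open A" "ms_has_derivative M A X D" "second_order M A Z"
    and c: "\<And>s t. s \<in> A \<Longrightarrow> t \<in> A \<Longrightarrow> (\<integral>\<omega>. X s \<omega> * Z t \<omega> \<partial>M) = c (s - t)"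
    and "s \<in> A" "t \<in> A"
  shows "(c has_derivative (\<lambda>u. \<Sum>i\<in>Basis. (u \<bullet> i) * (\<integral>\<omega>. D i s \<omega> * Z t \<omega> \<partial>M))) (at (s - t))"
proof -
  have X: "square_integrable M (X v)" "square_integrable M (Z v)" if "v \<in> A" for v
    using assms that by (auto simp: ms_has_derivative_def second_order_iff)
  have D: "square_integrable M (D i s)" if "i \<in> Basis" for i
    using assms that by (auto simp: ms_has_derivative_def second_order_iff)
  let ?L = "\<lambda>u. \<Sum>i\<in>Basis. (u \<bullet> i) * (\<integral>\<omega>. D i s \<omega> * Z t \<omega> \<partial>M)"
  let ?R = "\<lambda>v \<omega>. X v \<omega> - X s \<omega> - (\<Sum>i\<in>Basis. ((v - s) \<bullet> i) * D i s \<omega>)"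
  have R: "square_integrable M (?R v)" if "v \<in> A" for v
    using X D that \<open>s \<in> A\<close> by (intro square_integrable_intros) auto
  have "bounded_linear ?L"
    by (intro bounded_linear_sum bounded_linear_mult_const bounded_linear_inner_left)
  moreover have "((\<lambda>v. norm (c (v - t) - c (s - t) - ?L (v - s)) / norm (v - s)) \<longlongrightarrow> 0) (at s within A)"
  proof (rule Lim_null_comparison)
    let ?b = "\<lambda>v. sqrt ((\<integral>\<omega>. (?R v \<omega>)\<^sup>2 \<partial>M) / (norm (v - s))\<^sup>2) * sqrt (\<integral>\<omega>. (Z t \<omega>)\<^sup>2 \<partial>M)"
    show "\<forall>\<^sub>F v in at s within A. norm (norm (c (v - t) - c (s - t) - ?L (v - s)) / norm (v - s)) \<le> ?b v"
      unfolding eventually_at_filter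
    proof (intro always_eventually allI impI)
      fix v assume v: "v \<noteq> s" "v \<in> A"
      have "(\<integral>\<omega>. ?R v \<omega> * Z t \<omega> \<partial>M) = (\<integral>\<omega>. X v \<omega> * Z t \<omega> - X s \<omega> * Z t \<omega>
          - (\<Sum>i\<in>Basis. ((v - s) \<bullet> i) * (D i s \<omega> * Z t \<omega>)) \<partial>M)"
        by (simp add: left_diff_distrib sum_distrib_right mult.assoc)
      also have "\<dots> = c (v - t) - c (s - t) - ?L (v - s)"
        using X D v \<open>s \<in> A\<close> \<open>t \<in> A\<close>
        by (simp add: integrable_mult_square_integrable c)
      finally have eq: "(\<integral>\<omega>. ?R v \<omega> * Z t \<omega> \<partial>M) = c (v - t) - c (s - t) - ?L (v - s)" .
      show "norm (norm (c (v - t) - c (s - t) - ?L (v - s)) / norm (v - s)) \<le> ?b v"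
        using Cauchy_Schwarz_integral[OF R[OF v(2)] X(2)[OF \<open>t \<in> A\<close>]] v(1)
        unfolding eq by (simp add: real_sqrt_divide divide_right_mono)
    qed
    have "((\<lambda>v. (\<integral>\<omega>. (?R v \<omega>)\<^sup>2 \<partial>M) / (norm (v - s))\<^sup>2) \<longlongrightarrow> 0) (at s within A)"
      using assms(2) \<open>s \<in> A\<close> by (simp add: ms_has_derivative_def)
    from tendsto_mult_right[OF tendsto_real_sqrt[OF this], of "sqrt (\<integral>\<omega>. (Z t \<omega>)\<^sup>2 \<partial>M)"]
    show "(?b \<longlongrightarrow> 0) (at s within A)" by (simp add: mult.commute)
  qed
  ultimately have "((\<lambda>v. c (v - t)) has_derivative ?L) (at s)"
    using at_within_open[OF \<open>s \<in> A\<close> \<open>open A\<close>] by (simp add: has_derivative_iff_norm)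
  then have "((\<lambda>v. c (v - t)) has_derivative ?L) (at ((s - t) + t))" by simp
  from has_derivative_compose[where f = "\<lambda>h. h + t" and f' = "\<lambda>h. h", OF _ this]
  show ?thesis by (simp add: has_derivative_add_const)
qed

text \<open>Only the lag enters the derivative of \<open>c\<close>, so the pair \<open>D i\<close>, \<open>Z\<close> is again jointly stationary.\<close>

lemma cross_moment_derivative_stationary:
  assumes "open A" "ms_has_derivative M A X D" "second_order M A Z"
    and c: "\<And>s t. s \<in> A \<Longrightarrow> t \<in> A \<Longrightarrow> (\<integral>\<omega>. X s \<omega> * Z t \<omega> \<partial>M) = c (s - t)"
  obtains d where "\<And>h. h \<in> lags A \<Longrightarrow> (c has_derivative (\<lambda>u. \<Sum>i\<in>Basis. (u \<bullet> i) * d i h)) (at h)"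
    and "\<And>i s t. i \<in> Basis \<Longrightarrow> s \<in> A \<Longrightarrow> t \<in> A \<Longrightarrow> (\<integral>\<omega>. D i s \<omega> * Z t \<omega> \<partial>M) = d i (s - t)"
proof -
  define d where "d i h = frechet_derivative c (at h) i" for i h
  have eq: "(\<integral>\<omega>. D i s \<omega> * Z t \<omega> \<partial>M) = d i (s - t)" if "i \<in> Basis" "s \<in> A" "t \<in> A" for i s t
  proof -
    have "frechet_derivative c (at (s - t)) i
        = (\<Sum>j\<in>Basis. (i \<bullet> j) * (\<integral>\<omega>. D j s \<omega> * Z t \<omega> \<partial>M))"
      using frechet_derivative_at[OF cross_moment_has_derivative[OF assms that(2,3)]] by (rule fun_cong[OF sym])
    also have "\<dots> = (\<Sum>j\<in>Basis. if j = i then \<integral>\<omega>. D i s \<omega> * Z t \<omega> \<partial>M else 0)"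
      using that by (intro sum.cong) (auto simp: inner_Basis)
    finally show ?thesis using that by (simp add: d_def)
  qed
  have "(c has_derivative (\<lambda>u. \<Sum>i\<in>Basis. (u \<bullet> i) * d i h)) (at h)" if h: "h \<in> lags A" for h
  proof -
    from h obtain s t where "h = s - t" "s \<in> A" "t \<in> A" by (auto simp: lags_def)
    with cross_moment_has_derivative[OF assms this(2,3)] show ?thesis by (simp add: eq)
  qed
  with eq that show thesis by blast
qed

lemma cross_moment_differentiable_left:
  assumes "open A" "second_order M A Z"
  shows "ms_derivatives_exist m M A X \<Longrightarrow>
    (\<And>s t. s \<in> A \<Longrightarrow> t \<in> A \<Longrightarrow> (\<integral>\<omega>. X s \<omega> * Z t \<omega> \<partial>M) = c (s - t)) \<Longrightarrow>
    differentiable_upto m c (lags A)"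
proof (induction m arbitrary: X c)
  case (Suc m)
  then obtain D where D: "ms_has_derivative M A X D" "\<And>i. i \<in> Basis \<Longrightarrow> ms_derivatives_exist m M A (D i)"
    by auto
  obtain d where d: "\<And>h. h \<in> lags A \<Longrightarrow> (c has_derivative (\<lambda>u. \<Sum>i\<in>Basis. (u \<bullet> i) * d i h)) (at h)"
    "\<And>i s t. i \<in> Basis \<Longrightarrow> s \<in> A \<Longrightarrow> t \<in> A \<Longrightarrow> (\<integral>\<omega>. D i s \<omega> * Z t \<omega> \<partial>M) = d i (s - t)"
    using cross_moment_derivative_stationary[OF assms(1) D(1) assms(2) Suc.prems(2)] by blast
  show ?case
    unfolding add_Suc by (rule differentiable_upto_SucI[where D = d, OF d(1) Suc.IH[OF D(2) d(2)]])
qed simp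

text \<open>Derivatives falling on \<open>X\<close> and on \<open>Z\<close> add up. Once those of
  \<open>X\<close> are exhausted the two processes exchange roles, which reflects the lag. For
  \<open>X = Z\<close> this yields twice the mean-square order.\<close>

lemma cross_moment_differentiable:
  assumes "open A" "ms_derivatives_exist k M A Z"
  shows "ms_derivatives_exist m M A X \<Longrightarrow>
    (\<And>s t. s \<in> A \<Longrightarrow> t \<in> A \<Longrightarrow> (\<integral>\<omega>. X s \<omega> * Z t \<omega> \<partial>M) = c (s - t)) \<Longrightarrow>
    differentiable_upto (m + k) c (lags A)"
proof (induction m arbitrary: X c)
  case 0
  have "differentiable_upto k (\<lambda>h. c (- h)) (lags A)"
  proof (rule cross_moment_differentiable_left[OF assms(1) _ assms(2)])
    show "second_order M A X" using 0 by simp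
    show "(\<integral>\<omega>. Z s \<omega> * X t \<omega> \<partial>M) = c (- (s - t))" if "s \<in> A" "t \<in> A" for s t
      using 0(2)[OF that(2,1)] by (simp add: mult.commute)
  qed
  from differentiable_upto_reflect[OF this] show ?case by (simp add: uminus_lags)
next
  case (Suc m)
  then obtain D where D: "ms_has_derivative M A X D" "\<And>i. i \<in> Basis \<Longrightarrow> ms_derivatives_exist m M A (D i)"
    by auto
  obtain d where d: "\<And>h. h \<in> lags A \<Longrightarrow> (c has_derivative (\<lambda>u. \<Sum>i\<in>Basis. (u \<bullet> i) * d i h)) (at h)"
    "\<And>i s t. i \<in> Basis \<Longrightarrow> s \<in> A \<Longrightarrow> t \<in> A \<Longrightarrow> (\<integral>\<omega>. D i s \<omega> * Z t \<omega> \<partial>M) = d i (s - t)"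
    using cross_moment_derivative_stationary[OF assms(1) D(1)
      ms_derivatives_exist_second_order[OF assms(2)] Suc.prems(2)] by blast
  show ?case
    unfolding add_Suc by (rule differentiable_upto_SucI[where D = d, OF d(1) Suc.IH[OF D(2) d(2)]])
qed

section \<open>Taylor and second-difference estimates\<close>

lemma has_derivative_gradient_bound:
  fixes f :: "'a::euclidean_space \<Rightarrow> real"
  assumes "(f has_derivative (\<lambda>u. \<Sum>i\<in>Basis. (u \<bullet> i) * D i)) (at 0)" "0 < e"
  shows "\<forall>\<^sub>F y in nhds 0. \<bar>f y - f 0 - (\<Sum>i\<in>Basis. (y \<bullet> i) * D i)\<bar> \<le> e * norm y"
proof -
  have "\<exists>d>0. \<forall>y. norm (y - 0) < d \<longrightarrow>
      norm (f y - f 0 - (\<Sum>i\<in>Basis. ((y - 0) \<bullet> i) * D i)) \<le> e * norm (y - 0)"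
    using assms unfolding has_derivative_at_alt by blast
  then show ?thesis by (simp add: eventually_nhds_metric)
qed

text \<open>The gradient is controlled only by its linear approximation at 0, and the second
  derivatives may be discontinuous, so no remainder formula in second derivatives is at hand.
  Instead the mean value theorem is applied along the segment to \<open>u\<close>. The bound
  \<open>b\<close> at \<open>y = 0\<close> contains \<open>d i 0 = 0\<close>, hence there is no
  linear term.\<close>

lemma second_order_Taylor:
  fixes c :: "'a::euclidean_space \<Rightarrow> real" and e :: real
  assumes c: "\<And>x. norm x < r \<Longrightarrow> (c has_derivative (\<lambda>u. \<Sum>i\<in>Basis. (u \<bullet> i) * d i x)) (at x)"
    and b: "\<And>i y. i \<in> Basis \<Longrightarrow> norm y < r \<Longrightarrow> \<bar>d i y - (\<Sum>j\<in>Basis. (y \<bullet> j) * H i j)\<bar> \<le> e * norm y"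
    and u: "norm u < r" and "0 \<le> e"
  shows "\<bar>c u - c 0 - (\<Sum>i\<in>Basis. \<Sum>j\<in>Basis. (u \<bullet> i) * (u \<bullet> j) * H i j) / 2\<bar>
    \<le> DIM('a) * e * (norm u)\<^sup>2"
proof -
  let ?Q = "\<Sum>i\<in>Basis. \<Sum>j\<in>Basis. (u \<bullet> i) * (u \<bullet> j) * H i j"
  \<comment> \<open>Subtracting the quadratic makes the derivative of \<open>g\<close> exactly the
    error of the linear approximation to the gradient, tested against \<open>u\<close>.\<close>
  define g where "g \<tau> = c (\<tau> *\<^sub>R u) - \<tau>\<^sup>2 / 2 * ?Q" for \<tau> :: real
  define g' where "g' \<tau> = (\<Sum>i\<in>Basis. (u \<bullet> i) * d i (\<tau> *\<^sub>R u)) - \<tau> * ?Q" for \<tau> :: real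
  have small: "norm (\<tau> *\<^sub>R u) < r" "norm (\<tau> *\<^sub>R u) \<le> norm u" if "0 \<le> \<tau>" "\<tau> \<le> 1" for \<tau>
    using mult_left_le_one_le[of "norm u" \<tau>] that u by auto
  have deriv: "(g has_field_derivative g' \<tau>) (at \<tau>)" if "0 \<le> \<tau>" "\<tau> \<le> 1" for \<tau>
  proof -
    have s: "((\<lambda>\<tau>. \<tau> *\<^sub>R u) has_derivative (\<lambda>k. k *\<^sub>R u)) (at \<tau>)"
      by (auto intro!: derivative_eq_intros)
    have "((\<lambda>\<tau>. c (\<tau> *\<^sub>R u)) has_field_derivative (\<Sum>i\<in>Basis. (u \<bullet> i) * d i (\<tau> *\<^sub>R u))) (at \<tau>)"
    proof -
      have "((\<lambda>\<tau>. c (\<tau> *\<^sub>R u)) has_derivative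
          (\<lambda>k. \<Sum>i\<in>Basis. ((k *\<^sub>R u) \<bullet> i) * d i (\<tau> *\<^sub>R u))) (at \<tau>)"
        using has_derivative_compose[OF s c[OF small(1)[OF that]]] .
      moreover have "(\<lambda>k. \<Sum>i\<in>Basis. ((k *\<^sub>R u) \<bullet> i) * d i (\<tau> *\<^sub>R u))
          = (*) (\<Sum>i\<in>Basis. (u \<bullet> i) * d i (\<tau> *\<^sub>R u))"
        by (rule ext) (simp add: sum_distrib_left sum_distrib_right mult_ac)
      ultimately show ?thesis by (simp only: has_field_derivative_def)
    qed
    then show ?thesis
      unfolding g_def g'_def by (auto intro!: derivative_eq_intros)
  qed
  obtain z where z: "0 < z" "z < 1" "g 1 - g 0 = (1 - 0) * g' z"
    using MVT2[of 0 1 g g'] deriv by auto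
  have "g' z = (\<Sum>i\<in>Basis. (u \<bullet> i) * (d i (z *\<^sub>R u) - (\<Sum>j\<in>Basis. ((z *\<^sub>R u) \<bullet> j) * H i j)))"
    by (simp add: g'_def right_diff_distrib sum_subtractf sum_distrib_left mult_ac)
  also have "\<bar>\<dots>\<bar> \<le> (\<Sum>i\<in>(Basis::'a set). norm u * (e * norm u))"
  proof (intro order.trans[OF sum_abs] sum_mono)
    fix i :: 'a assume i: "i \<in> Basis"
    have "\<bar>d i (z *\<^sub>R u) - (\<Sum>j\<in>Basis. ((z *\<^sub>R u) \<bullet> j) * H i j)\<bar> \<le> e * norm (z *\<^sub>R u)"
      by (rule b[OF i small(1)]) (use z in auto)
    moreover    have "e * norm (z *\<^sub>R u) \<le> e * norm u"
      using small[of z] z \<open>0 \<le> e\<close> by (intro mult_left_mono) auto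
    ultimately show "\<bar>(u \<bullet> i) * (d i (z *\<^sub>R u) - (\<Sum>j\<in>Basis. ((z *\<^sub>R u) \<bullet> j) * H i j))\<bar>
        \<le> norm u * (e * norm u)"
      using Basis_le_norm[OF i, of u] \<open>0 \<le> e\<close> unfolding abs_mult by (intro mult_mono) auto
  qed
  finally show ?thesis
    using z(3) by (simp add: g_def power2_eq_square mult_ac)
qed

text \<open>The mean value theorem in the smaller increment \<open>h\<close> leaves an error of order \<open>e * k\<close>, which
  the division by \<open>k\<close> absorbs; this is why \<open>h \<le> k\<close> is needed.\<close>

lemma second_difference_limit:
  fixes c :: "real \<Rightarrow> real"
  assumes c: "\<And>x. \<bar>x\<bar> < r \<Longrightarrow> (c has_field_derivative d x) (at x)"
    and b: "\<And>x. \<bar>x\<bar> < r \<Longrightarrow> \<bar>d x - d 0 - x * H\<bar> \<le> e * \<bar>x\<bar>"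
    and hk: "0 < h" "h \<le> k" "k < r"
  shows "\<bar>(c (h - k) - c h - c (- k) + c 0) / (h * k) + H\<bar> \<le> e"
proof -
  have "((\<lambda>x. c (x - k) - c x) has_field_derivative (d (x - k) - d x)) (at x)"
    if "0 \<le> x" "x \<le> h" for x
  proof -
    have "((\<lambda>x. c (x - k)) has_field_derivative (d (x - k) * 1)) (at x)"
      by (rule DERIV_chain'[where f = "\<lambda>x. x - k"]) (use c that hk in \<open>auto intro!: derivative_eq_intros\<close>)
    then show ?thesis
      using c[of x] that hk by (auto intro!: derivative_eq_intros)
  qed
  then obtain z where z: "0 < z" "z < h"
    "(c (h - k) - c h) - (c (0 - k) - c 0) = (h - 0) * (d (z - k) - d z)"
    using MVT2[of 0 h "\<lambda>x. c (x - k) - c x" "\<lambda>x. d (x - k) - d x"] hk by auto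
  have "\<bar>(d (z - k) - d z) + k * H\<bar> \<le> e * \<bar>z - k\<bar> + e * \<bar>z\<bar>"
    using b[of "z - k"] b[of z] z hk by (simp add: algebra_simps abs_if split: if_splits)
  also have "\<dots> = e * k" using z hk by (simp add: algebra_simps)
  finally have "\<bar>(d (z - k) - d z) + k * H\<bar> / k \<le> e" using hk by (simp add: field_simps)
  moreover have "(c (h - k) - c h - c (- k) + c 0) / (h * k) + H = ((d (z - k) - d z) + k * H) / k"
  proof -
    have "c (h - k) - c h - c (- k) + c 0 = h * (d (z - k) - d z)" using z(3) by simp
    then show ?thesis using hk by (simp add: add_divide_distrib)
  qed
  ultimately show ?thesis using hk by (simp add: abs_divide)
qed

section \<open>Building mean-square derivatives from the autocovariance\<close>

lemma has_derivative_axis: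
  fixes f :: "'a::euclidean_space \<Rightarrow> real"
  assumes "(f has_derivative (\<lambda>u. \<Sum>j\<in>Basis. (u \<bullet> j) * D j)) (at (x + y *\<^sub>R i))" "i \<in> Basis"
  shows "((\<lambda>y. f (x + y *\<^sub>R i)) has_field_derivative D i) (at y)"
proof -
  have "((\<lambda>y. x + y *\<^sub>R i) has_derivative (\<lambda>k. k *\<^sub>R i)) (at y)"
    by (auto intro!: derivative_eq_intros)
  from has_derivative_compose[OF this assms(1)]
  have "((\<lambda>y. f (x + y *\<^sub>R i)) has_derivative (\<lambda>k. \<Sum>j\<in>Basis. k * (i \<bullet> j) * D j)) (at y)"
    by simp
  also have "(\<lambda>k. \<Sum>j\<in>Basis. k * (i \<bullet> j) * D j) = (\<lambda>k. D i * k)"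
  proof
    fix k
    have "(\<Sum>j\<in>Basis. k * (i \<bullet> j) * D j) = (\<Sum>j\<in>Basis. if j = i then D i * k else 0)"
      using assms(2) by (intro sum.cong) (auto simp: inner_Basis)
    then show "(\<Sum>j\<in>Basis. k * (i \<bullet> j) * D j) = D i * k" using assms(2) by simp
  qed
  finally show ?thesis by (simp add: has_field_derivative_def)
qed

text \<open>Along each axis the derivative at 0 equals its own negative. Autocovariances are even in
  the lag, so this removes the linear term from their expansion.\<close>

lemma even_gradient_zero:
  fixes c :: "'a::euclidean_space \<Rightarrow> real"
  assumes "open S" "0 \<in> S" "\<And>h. h \<in> S \<Longrightarrow> c (- h) = c h"
    and "(c has_derivative (\<lambda>u. \<Sum>j\<in>Basis. (u \<bullet> j) * d j)) (at 0)" "i \<in> Basis"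
  shows "d i = 0"
proof -
  have a: "((\<lambda>y. c (0 + y *\<^sub>R i)) has_field_derivative d i) (at 0)"
    using has_derivative_axis[where x = 0 and y = 0] assms by simp
  have "((\<lambda>y. c (0 + (- y) *\<^sub>R i)) has_field_derivative (d i * (- 1))) (at 0)"
    by (rule DERIV_chain'[where f = uminus and g = "\<lambda>y. c (0 + y *\<^sub>R i)"])
       (use a in \<open>auto intro!: derivative_eq_intros\<close>)
  moreover have ev: "\<forall>\<^sub>F y in nhds 0. c (0 + (- y) *\<^sub>R i) = c (0 + y *\<^sub>R i)"
  proof -
    have "open ((\<lambda>y. y *\<^sub>R i) -` S)"
      using assms(1) by (intro open_vimage continuous_intros)
    then show ?thesis
      by (rule eventually_mono[OF eventually_nhds_in_open]) (use assms(2,3) in auto)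
  qed
  ultimately have "((\<lambda>y. c (0 + y *\<^sub>R i)) has_field_derivative (d i * (- 1))) (at 0)"
    by (simp only: DERIV_cong_ev[OF refl ev refl])
  from DERIV_unique[OF a this] show ?thesis by simp
qed

text \<open>Inner products of difference quotients are second differences of \<open>c\<close> and
  tend to \<open>- H i\<close>, so the quotients are Cauchy in L2 and completeness supplies a limit.
  That limit is passed on only through its cross moments, from which every later moment can be
  computed.\<close>

lemma (in prob_space) axis_ms_derivative:
  assumes "open A" "second_order M A X"
    and c: "\<And>s t. s \<in> A \<Longrightarrow> t \<in> A \<Longrightarrow> (\<integral>\<omega>. X s \<omega> * X t \<omega> \<partial>M) = c (s - t)"
    and grad: "\<And>h. h \<in> lags A \<Longrightarrow> (c has_derivative (\<lambda>u. \<Sum>j\<in>Basis. (u \<bullet> j) * d j h)) (at h)"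
    and hess: "(d i has_derivative (\<lambda>u. \<Sum>j\<in>Basis. (u \<bullet> j) * H j)) (at 0)"
    and "s \<in> A" "i \<in> Basis"
  obtains D where "square_integrable M D"
    and "\<And>Z \<kappa> \<kappa>'. square_integrable M Z \<Longrightarrow> (\<And>v. v \<in> A \<Longrightarrow> (\<integral>\<omega>. X v \<omega> * Z \<omega> \<partial>M) = \<kappa> v) \<Longrightarrow>
      ((\<lambda>y. \<kappa> (s + y *\<^sub>R i)) has_field_derivative \<kappa>') (at 0) \<Longrightarrow> (\<integral>\<omega>. D \<omega> * Z \<omega> \<partial>M) = \<kappa>'"
proof -
  obtain r where r: "0 < r" "ball s r \<subseteq> A" using \<open>open A\<close> \<open>s \<in> A\<close> by (auto simp: open_contains_ball)
  have A: "s + x *\<^sub>R i \<in> A" if "\<bar>x\<bar> < r" for x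
    using r(2) that \<open>i \<in> Basis\<close> by (auto simp: dist_norm)
  have lag: "x *\<^sub>R i \<in> lags A" if "\<bar>x\<bar> < r" for x
    using lagsI[OF A[OF that] \<open>s \<in> A\<close>] by simp
  have X: "square_integrable M (X v)" if "v \<in> A" for v
    using assms that by (auto simp: second_order_iff)
  have XX: "integrable M (\<lambda>\<omega>. X v \<omega> * X w \<omega>)" if "v \<in> A" "w \<in> A" for v w
    by (rule integrable_mult_square_integrable[OF X X]) fact+
  define q where "q h \<omega> = (X (s + h *\<^sub>R i) \<omega> - X s \<omega>) / h" for h \<omega>
  have q: "square_integrable M (q h)" if "\<bar>h\<bar> < r" for h
    unfolding q_def using X A[OF that] \<open>s \<in> A\<close> by (intro square_integrable_intros) auto
  define B where "B h k = (\<integral>\<omega>. q h \<omega> * q k \<omega> \<partial>M)" for h k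
  have B: "B h k = (c ((h - k) *\<^sub>R i) - c (h *\<^sub>R i) - c ((- k) *\<^sub>R i) + c (0 *\<^sub>R i)) / (h * k)"
    if "\<bar>h\<bar> < r" "\<bar>k\<bar> < r" for h k
  proof -
    let ?a = "s + h *\<^sub>R i" and ?b = "s + k *\<^sub>R i"
    have "B h k = (\<integral>\<omega>. (X ?a \<omega> * X ?b \<omega> - X ?a \<omega> * X s \<omega> - X s \<omega> * X ?b \<omega> + X s \<omega> * X s \<omega>) / (h * k) \<partial>M)"
      unfolding B_def q_def by (intro Bochner_Integration.integral_cong refl) (simp add: algebra_simps)
    also have "\<dots> = (c (?a - ?b) - c (?a - s) - c (s - ?b) + c (s - s)) / (h * k)"
      using XX A[OF that(1)] A[OF that(2)] \<open>s \<in> A\<close> by (simp add: c)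
    finally show ?thesis by (simp add: scaleR_left_diff_distrib)
  qed
  have close: "\<exists>\<delta>>0. \<forall>h k. 0 < h \<and> h < \<delta> \<and> 0 < k \<and> k < \<delta> \<longrightarrow> \<bar>B h k + H i\<bar> \<le> e" if "0 < e" for e
  proof -
    obtain \<delta> where \<delta>: "0 < \<delta>"
      "\<And>y. norm y < \<delta> \<Longrightarrow> \<bar>d i y - d i 0 - (\<Sum>j\<in>Basis. (y \<bullet> j) * H j)\<bar> \<le> e * norm y"
      using has_derivative_gradient_bound[OF hess \<open>0 < e\<close>] by (auto simp: eventually_nhds_metric)
    let ?\<delta> = "min \<delta> r"
    have b: "\<bar>d i (x *\<^sub>R i) - d i (0 *\<^sub>R i) - x * H i\<bar> \<le> e * \<bar>x\<bar>" if "\<bar>x\<bar> < ?\<delta>" for x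
    proof -
      have "(\<Sum>j\<in>Basis. ((x *\<^sub>R i) \<bullet> j) * H j) = (\<Sum>j\<in>Basis. if j = i then x * H i else 0)"
        using \<open>i \<in> Basis\<close> by (intro sum.cong) (auto simp: inner_Basis)
      with \<delta>(2)[of "x *\<^sub>R i"] that \<open>i \<in> Basis\<close> show ?thesis by simp
    qed
    have c': "((\<lambda>x. c (x *\<^sub>R i)) has_field_derivative d i (x *\<^sub>R i)) (at x)" if "\<bar>x\<bar> < ?\<delta>" for x
      using has_derivative_axis[of c "\<lambda>j. d j (x *\<^sub>R i)" 0 x i] grad[OF lag, of x] \<open>i \<in> Basis\<close> that by simp
    have le: "\<bar>B h k + H i\<bar> \<le> e" if "0 < h" "h \<le> k" "k < ?\<delta>" for h k
      using second_difference_limit[OF c' b that] B[of h k] that by simp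
    \<comment> \<open>\<open>second_difference_limit\<close> treats \<open>h \<le> k\<close>;
      symmetry of the inner product covers the other order.\<close>
    have "B h k = B k h" for h k unfolding B_def by (simp add: mult.commute)
    then have "\<bar>B h k + H i\<bar> \<le> e" if "0 < h" "h < ?\<delta>" "0 < k" "k < ?\<delta>" for h k
      using le[of h k] le[of k h] that by (cases "h \<le> k") simp_all
    then show ?thesis using \<delta>(1) r(1) by (intro exI[of _ ?\<delta>]) auto
  qed
  \<comment> \<open>The shift by 2 keeps already the first increment strictly below the radius
    \<open>r\<close>.\<close>
  define h where "h n = r / real (n + 2)" for n
  have h: "0 < h n" "h n < r" "\<bar>h n\<bar> < r" for n
    using r(1) by (auto simp: h_def field_simps add_pos_nonneg)
  have h0: "h \<longlonglongrightarrow> 0"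
    unfolding h_def by (rule real_tendsto_divide_at_top[OF tendsto_const
        filterlim_compose[OF filterlim_real_sequentially filterlim_add_const_nat_at_top]])
  have "\<exists>g. square_integrable M g \<and> (\<lambda>n. \<integral>\<omega>. (q (h n) \<omega> - g \<omega>)\<^sup>2 \<partial>M) \<longlonglongrightarrow> 0"
  proof (rule square_integrable_complete)
    show "square_integrable M (q (h n))" for n using q h(3) .
    fix e :: real assume "e > 0"
    then obtain \<delta> where \<delta>: "0 < \<delta>" "\<And>h k. 0 < h \<Longrightarrow> h < \<delta> \<Longrightarrow> 0 < k \<Longrightarrow> k < \<delta> \<Longrightarrow> \<bar>B h k + H i\<bar> \<le> e / 5"
      using close[of "e / 5"] by auto
    obtain N where N: "\<And>n. n \<ge> N \<Longrightarrow> h n < \<delta>"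
      using order_tendstoD(2)[OF h0 \<delta>(1)] by (auto simp: eventually_sequentially)
    have "(\<integral>\<omega>. (q (h m) \<omega> - q (h n) \<omega>)\<^sup>2 \<partial>M) < e" if "m \<ge> N" "n \<ge> N" for m n
    proof -
      have "(\<integral>\<omega>. (q (h m) \<omega> - q (h n) \<omega>)\<^sup>2 \<partial>M) = (\<integral>\<omega>. q (h m) \<omega> * q (h m) \<omega> -
          2 * (q (h m) \<omega> * q (h n) \<omega>) + q (h n) \<omega> * q (h n) \<omega> \<partial>M)"
        by (simp add: power2_eq_square algebra_simps)
      also have "\<dots> = B (h m) (h m) - 2 * B (h m) (h n) + B (h n) (h n)"
        unfolding B_def using integrable_mult_square_integrable[OF q[OF h(3)] q[OF h(3)]] by simp
      \<comment> \<open>Three inner products, each within \<open>e / 5\<close> of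
        \<open>- H i\<close>, enter with weights 1, -2 and 1: the limits cancel and at most
        \<open>4 * (e / 5)\<close> remains, strictly below \<open>e\<close>.\<close>
      also have "\<dots> \<le> 4 * (e / 5)"
      proof -
        have "\<bar>B (h m) (h m) + H i\<bar> \<le> e / 5" "\<bar>B (h m) (h n) + H i\<bar> \<le> e / 5" "\<bar>B (h n) (h n) + H i\<bar> \<le> e / 5"
          using N that by (intro \<delta>(2) h(1); simp)+
        then show ?thesis unfolding abs_le_iff by linarith
      qed
      finally show ?thesis using \<open>e > 0\<close> by simp
    qed
    then show "\<exists>N. \<forall>m\<ge>N. \<forall>n\<ge>N. (\<integral>\<omega>. (q (h m) \<omega> - q (h n) \<omega>)\<^sup>2 \<partial>M) < e" by blast
  qed
  then obtain D where D: "square_integrable M D" "(\<lambda>n. \<integral>\<omega>. (q (h n) \<omega> - D \<omega>)\<^sup>2 \<partial>M) \<longlonglongrightarrow> 0"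
    by blast
  have "(\<integral>\<omega>. D \<omega> * Z \<omega> \<partial>M) = \<kappa>'"
    if Z: "square_integrable M Z" and \<kappa>: "\<And>v. v \<in> A \<Longrightarrow> (\<integral>\<omega>. X v \<omega> * Z \<omega> \<partial>M) = \<kappa> v"
      and \<kappa>': "((\<lambda>y. \<kappa> (s + y *\<^sub>R i)) has_field_derivative \<kappa>') (at 0)" for Z \<kappa> \<kappa>'
  proof (rule LIMSEQ_unique)
    show "(\<lambda>n. \<integral>\<omega>. q (h n) \<omega> * Z \<omega> \<partial>M) \<longlonglongrightarrow> (\<integral>\<omega>. D \<omega> * Z \<omega> \<partial>M)"
      using q[OF h(3)] D Z by (intro tendsto_integral_mult_square_integrable) auto
    have "(\<integral>\<omega>. q (h n) \<omega> * Z \<omega> \<partial>M) = (\<kappa> (s + (0 + h n) *\<^sub>R i) - \<kappa> (s + 0 *\<^sub>R i)) / h n" for n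
    proof -
      have "(\<integral>\<omega>. q (h n) \<omega> * Z \<omega> \<partial>M)
          = (\<integral>\<omega>. (X (s + h n *\<^sub>R i) \<omega> * Z \<omega> - X s \<omega> * Z \<omega>) / h n \<partial>M)"
        unfolding q_def by (simp add: algebra_simps)
      also have "\<dots> = (\<kappa> (s + h n *\<^sub>R i) - \<kappa> s) / h n"
        using integrable_mult_square_integrable[OF X Z] A[OF h(3)] \<open>s \<in> A\<close> by (simp add: \<kappa>)
      finally show ?thesis by simp
    qed
    moreover have "(\<lambda>n. (\<kappa> (s + (0 + h n) *\<^sub>R i) - \<kappa> (s + 0 *\<^sub>R i)) / h n) \<longlonglongrightarrow> \<kappa>'"
    proof (rule filterlim_compose[OF \<kappa>'[unfolded DERIV_def]])
      show "filterlim h (at 0) sequentially"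
        using h0 h(1) by (intro filterlim_atI) (auto simp: less_imp_neq[THEN not_sym])
    qed
    ultimately show "(\<lambda>n. \<integral>\<omega>. q (h n) \<omega> * Z \<omega> \<partial>M) \<longlonglongrightarrow> \<kappa>'" by simp
  qed
  with D(1) show thesis by (rule that)
qed

text \<open>Each mean-square derivative costs two derivatives of the autocovariance:
  \<open>D i\<close> has autocovariance \<open>- H i i\<close>, so the induction continues with
  \<open>D i\<close>. Axis limits alone do not give Frechet differentiability; the L2 remainder is
  expanded into moments and shown to be of smaller order than
  \<open>(norm u)\<^sup>2\<close>.\<close>

lemma (in prob_space) ms_derivatives_existI:
  fixes A :: "'i::euclidean_space set"
  assumes "open A"
  shows "second_order M A X \<Longrightarrow>
    (\<And>s t. s \<in> A \<Longrightarrow> t \<in> A \<Longrightarrow> (\<integral>\<omega>. X s \<omega> * X t \<omega> \<partial>M) = c (s - t)) \<Longrightarrow>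
    differentiable_upto (2 * m) c (lags A) \<Longrightarrow> ms_derivatives_exist m M A X"
proof (induction m arbitrary: X c)
  case (Suc m)
  note c = Suc.prems(2)
  have X: "square_integrable M (X v)" if "v \<in> A" for v
    using Suc.prems(1) that by (auto simp: second_order_iff)
  have "differentiable_upto (Suc (Suc (2 * m))) c (lags A)"
    using Suc.prems(3) by (simp only: mult_Suc_right add_2_eq_Suc)
  then obtain d where "\<forall>h\<in>lags A. (c has_derivative (\<lambda>u. \<Sum>j\<in>Basis. (u \<bullet> j) * d j h)) (at h)"
    "\<forall>i\<in>Basis. differentiable_upto (Suc (2 * m)) (d i) (lags A)"
    unfolding differentiable_upto.simps(2)[of "Suc (2 * m)"] by blast
  note grad = this[rule_format]
  define Q where "Q i H \<longleftrightarrow> (\<forall>h\<in>lags A. (d i has_derivative (\<lambda>u. \<Sum>j\<in>Basis. (u \<bullet> j) * H j h)) (at h)) \<and>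
      (\<forall>j\<in>Basis. differentiable_upto (2 * m) (H j) (lags A))" for i H
  define H where "H i = (SOME H. Q i H)" for i
  have "Q i (H i)" if "i \<in> Basis" for i
    unfolding H_def using grad(2)[OF that]
    unfolding differentiable_upto.simps(2)[of "2 * m"] Q_def[symmetric] by (rule someI_ex)
  then have hess: "\<And>i h. i \<in> Basis \<Longrightarrow> h \<in> lags A \<Longrightarrow>
        (d i has_derivative (\<lambda>u. \<Sum>j\<in>Basis. (u \<bullet> j) * H i j h)) (at h)"
      "\<And>i j. i \<in> Basis \<Longrightarrow> j \<in> Basis \<Longrightarrow> differentiable_upto (2 * m) (H i j) (lags A)"
    unfolding Q_def by blast+
  \<comment> \<open>All test variables are allowed because the property is applied first to
    \<open>X t\<close> and then to the derivative variables themselves.\<close>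
  define P where "P i s D \<longleftrightarrow> square_integrable M D \<and>
    (\<forall>Z \<kappa> \<kappa>'. square_integrable M Z \<longrightarrow> (\<forall>v\<in>A. (\<integral>\<omega>. X v \<omega> * Z \<omega> \<partial>M) = \<kappa> v) \<longrightarrow>
      ((\<lambda>y. \<kappa> (s + y *\<^sub>R i)) has_field_derivative \<kappa>') (at 0) \<longrightarrow> (\<integral>\<omega>. D \<omega> * Z \<omega> \<partial>M) = \<kappa>')" for i s D
  have "\<exists>D. P i s D" if "i \<in> Basis" "s \<in> A" for i s
  proof -
    have "0 \<in> lags A" using lagsI[OF that(2,2)] by simp
    show ?thesis
    proof (rule axis_ms_derivative[where d = d and c = c and i = i and H = "\<lambda>j. H i j 0" and s = s and X = X,
          OF \<open>open A\<close> Suc.prems(1) c grad(1) hess(1)[OF that(1) \<open>0 \<in> lags A\<close>] that(2,1)])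
      fix D assume 1: "square_integrable M D"
        and 2: "\<And>Z \<kappa> \<kappa>'. square_integrable M Z \<Longrightarrow> (\<And>v. v \<in> A \<Longrightarrow> (\<integral>\<omega>. X v \<omega> * Z \<omega> \<partial>M) = \<kappa> v) \<Longrightarrow>
          ((\<lambda>y. \<kappa> (s + y *\<^sub>R i)) has_field_derivative \<kappa>') (at 0) \<Longrightarrow> (\<integral>\<omega>. D \<omega> * Z \<omega> \<partial>M) = \<kappa>'"
      have "P i s D"
        unfolding P_def
      proof (intro conjI allI impI 1)
        fix Z \<kappa> \<kappa>'
        assume "square_integrable M Z" "\<forall>v\<in>A. (\<integral>\<omega>. X v \<omega> * Z \<omega> \<partial>M) = \<kappa> v"
          "((\<lambda>y. \<kappa> (s + y *\<^sub>R i)) has_field_derivative \<kappa>') (at 0)"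
        then show "(\<integral>\<omega>. D \<omega> * Z \<omega> \<partial>M) = \<kappa>'" by (intro 2[of Z \<kappa> \<kappa>']) auto
      qed
      then show ?thesis by blast
    qed
  qed
  define D where "D i s = (SOME D. P i s D)" for i s
  have PD: "P i s (D i s)" if "i \<in> Basis" "s \<in> A" for i s
    unfolding D_def using \<open>\<And>s i. i \<in> Basis \<Longrightarrow> s \<in> A \<Longrightarrow> \<exists>D. P i s D\<close>[OF that] by (rule someI_ex)
  have D: "square_integrable M (D i s)"
    and D_eq: "\<lbrakk>square_integrable M Z; \<forall>v\<in>A. (\<integral>\<omega>. X v \<omega> * Z \<omega> \<partial>M) = \<kappa> v;
      ((\<lambda>y. \<kappa> (s + y *\<^sub>R i)) has_field_derivative \<kappa>') (at 0)\<rbrakk> \<Longrightarrow> (\<integral>\<omega>. D i s \<omega> * Z \<omega> \<partial>M) = \<kappa>'"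
    if "i \<in> Basis" "s \<in> A" for i s Z \<kappa> \<kappa>'
    using PD[OF that] unfolding P_def by blast+
  have DX: "(\<integral>\<omega>. D i s \<omega> * X t \<omega> \<partial>M) = d i (s - t)" if "i \<in> Basis" "s \<in> A" "t \<in> A" for i s t
  proof (rule D_eq[OF that(1,2) X[OF that(3)], of "\<lambda>v. c (v - t)"])
    show "\<forall>v\<in>A. (\<integral>\<omega>. X v \<omega> * X t \<omega> \<partial>M) = c (v - t)" using c that by blast
    show "((\<lambda>y. c (s + y *\<^sub>R i - t)) has_field_derivative d i (s - t)) (at 0)"
      using has_derivative_axis[of c "\<lambda>j. d j (s - t)" "s - t" 0 i] grad(1)[OF lagsI[OF that(2,3)]] that(1)
      by (simp add: algebra_simps)
  qed
  \<comment> \<open>Here the test variable is \<open>D i s\<close>, whose cross moments with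
    \<open>X\<close> are known from \<open>DX\<close>. The point being moved enters
    \<open>d i (s - v)\<close> negatively, which produces the sign of the autocovariance.\<close>
  have DD: "(\<integral>\<omega>. D j t \<omega> * D i s \<omega> \<partial>M) = - H i j (s - t)"
    if "i \<in> Basis" "j \<in> Basis" "s \<in> A" "t \<in> A" for i j s t
  proof (rule D_eq[OF that(2,4) D[OF that(1,3)], of "\<lambda>v. d i (s - v)"])
    show "\<forall>v\<in>A. (\<integral>\<omega>. X v \<omega> * D i s \<omega> \<partial>M) = d i (s - v)"
      using DX[OF that(1,3)] by (simp add: mult.commute)
    have a: "((\<lambda>y. d i (s - t + y *\<^sub>R j)) has_field_derivative H i j (s - t)) (at (- 0))"
      using has_derivative_axis[of "d i" "\<lambda>j. H i j (s - t)" "s - t" 0 j]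
        hess(1)[OF that(1) lagsI[OF that(3,4)]] that(2) by simp
    have "((\<lambda>y. d i (s - t + (- y) *\<^sub>R j)) has_field_derivative H i j (s - t) * (- 1)) (at 0)"
      by (rule DERIV_chain'[where f = uminus and g = "\<lambda>y. d i (s - t + y *\<^sub>R j)", OF _ a])
         (auto intro!: derivative_eq_intros)
    then show "((\<lambda>y. d i (s - (t + y *\<^sub>R j))) has_field_derivative - H i j (s - t)) (at 0)"
      by (simp add: algebra_simps)
  qed
  have "ms_derivatives_exist m M A (D i)" if "i \<in> Basis" for i
  proof (rule Suc.IH)
    show "second_order M A (D i)" using D that by (simp add: second_order_iff)
    show "(\<integral>\<omega>. D i s \<omega> * D i t \<omega> \<partial>M) = - H i i (s - t)" if "s \<in> A" "t \<in> A" for s t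
      using DD[OF \<open>i \<in> Basis\<close> \<open>i \<in> Basis\<close> that] by (simp add: mult.commute)
    show "differentiable_upto (2 * m) (\<lambda>h. - H i i h) (lags A)"
      by (intro differentiable_upto_minus hess(2) that)
  qed
  moreover have "ms_has_derivative M A X D"
    unfolding ms_has_derivative_def
  proof (intro conjI ballI)
    show "second_order M A X" "\<And>i. i \<in> Basis \<Longrightarrow> second_order M A (D i)"
      using Suc.prems(1) D by (simp_all add: second_order_iff)
    fix s assume s: "s \<in> A"
    let ?R = "\<lambda>t \<omega>. X t \<omega> - X s \<omega> - (\<Sum>i\<in>Basis. ((t - s) \<bullet> i) * D i s \<omega>)"
    let ?Q = "\<lambda>u. \<Sum>i\<in>Basis. \<Sum>j\<in>Basis. (u \<bullet> i) * (u \<bullet> j) * H i j 0"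
    have zero: "0 \<in> lags A" using lagsI[OF s s] by simp
    have even: "c (- h) = c h" if "h \<in> lags A" for h
    proof -
      from that obtain a b where ab: "h = a - b" "a \<in> A" "b \<in> A" by (auto simp: lags_def)
      with c[OF ab(2,3)] c[OF ab(3,2)] show ?thesis by (simp add: mult.commute)
    qed
    have d0: "d i 0 = 0" if "i \<in> Basis" for i
      using even_gradient_zero[OF open_lags[OF \<open>open A\<close>] zero even grad(1)[OF zero] that] .
    \<comment> \<open>Every moment in the expanded square is a value of \<open>c\<close>,
      \<open>d\<close> or \<open>H\<close>; the mixed term with \<open>X s\<close> disappears
      because \<open>d i 0 = 0\<close>.\<close>
    have R: "(\<integral>\<omega>. (?R t \<omega>)\<^sup>2 \<partial>M) = 2 * c 0 - 2 * c (t - s)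
        - 2 * (\<Sum>i\<in>Basis. ((t - s) \<bullet> i) * d i (- (t - s))) - ?Q (t - s)" if t: "t \<in> A" for t
    proof -
      let ?S = "\<lambda>\<omega>. \<Sum>i\<in>Basis. ((t - s) \<bullet> i) * D i s \<omega>"
      have S: "square_integrable M ?S" using D s by (intro square_integrable_intros) auto
      note int = integrable_mult_square_integrable
      have SX: "(\<integral>\<omega>. ?S \<omega> * X v \<omega> \<partial>M) = (\<Sum>i\<in>Basis. ((t - s) \<bullet> i) * d i (s - v))" if "v \<in> A" for v
        using int[OF D[OF _ s] X[OF that]] DX[OF _ s that]
        by (simp add: sum_distrib_right mult.assoc)
      have "(\<integral>\<omega>. (?R t \<omega>)\<^sup>2 \<partial>M) = (\<integral>\<omega>. X t \<omega> * X t \<omega> - 2 * (X t \<omega> * X s \<omega>) + X s \<omega> * X s \<omega>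
          - 2 * (?S \<omega> * X t \<omega> - ?S \<omega> * X s \<omega>) + ?S \<omega> * ?S \<omega> \<partial>M)"
        by (intro Bochner_Integration.integral_cong refl) (simp add: power2_eq_square algebra_simps)
      also have "\<dots> = c (t - t) - 2 * c (t - s) + c (s - s)
          - 2 * ((\<integral>\<omega>. ?S \<omega> * X t \<omega> \<partial>M) - (\<integral>\<omega>. ?S \<omega> * X s \<omega> \<partial>M)) + (\<integral>\<omega>. ?S \<omega> * ?S \<omega> \<partial>M)"
        using int[OF X[OF t] X[OF t]] int[OF X[OF t] X[OF s]] int[OF X[OF s] X[OF s]]
          int[OF S X[OF t]] int[OF S X[OF s]] int[OF S S] s t
        by (simp del: sum_distrib_left sum_distrib_right add: c)
      also have "(\<integral>\<omega>. ?S \<omega> * ?S \<omega> \<partial>M) = - ?Q (t - s)"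
      proof -
        have "(\<integral>\<omega>. ?S \<omega> * ?S \<omega> \<partial>M) = (\<integral>\<omega>. (\<Sum>i\<in>Basis. \<Sum>j\<in>Basis.
            ((t - s) \<bullet> i) * ((t - s) \<bullet> j) * (D j s \<omega> * D i s \<omega>)) \<partial>M)"
          by (simp add: sum_product mult_ac)
        also have "\<dots> = (\<Sum>i\<in>Basis. \<Sum>j\<in>Basis. ((t - s) \<bullet> i) * ((t - s) \<bullet> j) * (- H i j 0))"
          using int[OF D[OF _ s] D[OF _ s]] DD[OF _ _ s s] by simp
        finally show ?thesis by (simp add: sum_negf)
      qed
      finally show ?thesis using d0 by (simp add: SX[OF t] SX[OF s])
    qed
    show "((\<lambda>t. (\<integral>\<omega>. (?R t \<omega>)\<^sup>2 \<partial>M) / (norm (t - s))\<^sup>2) \<longlongrightarrow> 0) (at s within A)"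
      unfolding Lim_within
    proof (intro allI impI)
      fix e :: real assume "e > 0"
      \<comment> \<open>With this choice two Taylor errors, each at most
        \<open>DIM('i) * e' * (norm u)\<^sup>2\<close> and each entering with factor 2, add up to
        \<open>e / 2 * (norm u)\<^sup>2\<close>; the values of \<open>c\<close>, \<open>d\<close>
        and \<open>H\<close> themselves cancel.\<close>
      define e' where "e' = e / (8 * DIM('i))"
      have "e' > 0" using \<open>e > 0\<close> by (simp add: e'_def)
      have "\<forall>\<^sub>F y in nhds 0. y \<in> lags A \<and> (\<forall>i\<in>Basis. \<bar>d i y - d i 0 - (\<Sum>j\<in>Basis. (y \<bullet> j) * H i j 0)\<bar> \<le> e' * norm y)"
        by (intro eventually_conj eventually_ball_finite ballI
            eventually_nhds_in_open open_lags \<open>open A\<close> zero finite_Basis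
            has_derivative_gradient_bound[OF hess(1)] \<open>e' > 0\<close>)
      then obtain r where r: "0 < r" "\<And>y. norm y < r \<Longrightarrow> y \<in> lags A"
        "\<And>i y. i \<in> Basis \<Longrightarrow> norm y < r \<Longrightarrow> \<bar>d i y - (\<Sum>j\<in>Basis. (y \<bullet> j) * H i j 0)\<bar> \<le> e' * norm y"
        using d0 by (auto simp: eventually_nhds_metric)
      have "dist ((\<integral>\<omega>. (?R t \<omega>)\<^sup>2 \<partial>M) / (norm (t - s))\<^sup>2) 0 < e"
        if t: "t \<in> A" "0 < dist t s" "dist t s < r" for t
      proof -
        define u where "u = t - s"
        have u: "0 < norm u" "norm u < r" using t by (auto simp: u_def dist_norm)
        have 1: "\<bar>c u - c 0 - ?Q u / 2\<bar> \<le> DIM('i) * e' * (norm u)\<^sup>2"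
          by (rule second_order_Taylor[where H = "\<lambda>i j. H i j 0" and r = r and d = d])
             (use grad(1) r u \<open>e' > 0\<close> in auto)
        have "\<bar>(\<Sum>i\<in>Basis. (u \<bullet> i) * d i (- u)) + ?Q u\<bar>
            = \<bar>\<Sum>i\<in>Basis. (u \<bullet> i) * (d i (- u) - (\<Sum>j\<in>Basis. ((- u) \<bullet> j) * H i j 0))\<bar>"
          by (simp add: sum.distrib sum_distrib_left algebra_simps sum_negf)
        also have "\<dots> \<le> (\<Sum>i\<in>(Basis::'i set). norm u * (e' * norm u))"
        proof (intro order.trans[OF sum_abs] sum_mono)
          fix i :: 'i assume i: "i \<in> Basis"
          have "\<bar>d i (- u) - (\<Sum>j\<in>Basis. ((- u) \<bullet> j) * H i j 0)\<bar> \<le> e' * norm (- u)"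
            using u by (intro r(3) i) simp
          then show "\<bar>(u \<bullet> i) * (d i (- u) - (\<Sum>j\<in>Basis. ((- u) \<bullet> j) * H i j 0))\<bar> \<le> norm u * (e' * norm u)"
            using Basis_le_norm[OF i, of u] \<open>e' > 0\<close> unfolding abs_mult norm_minus_cancel
            by (intro mult_mono) auto
        qed
        finally have 2: "\<bar>(\<Sum>i\<in>Basis. (u \<bullet> i) * d i (- u)) + ?Q u\<bar> \<le> DIM('i) * e' * (norm u)\<^sup>2"
          by (simp add: power2_eq_square mult_ac)
        have "(\<integral>\<omega>. (?R t \<omega>)\<^sup>2 \<partial>M) \<le> 4 * (DIM('i) * e' * (norm u)\<^sup>2)"
          using 1 2 R[OF t(1)] unfolding u_def[symmetric] abs_le_iff by linarith
        also have "\<dots> = e / 2 * (norm u)\<^sup>2" by (simp add: e'_def)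
        finally have "(\<integral>\<omega>. (?R t \<omega>)\<^sup>2 \<partial>M) / (norm u)\<^sup>2 \<le> e / 2"
          using u by (simp add: field_simps)
        also have "e / 2 < e" using \<open>e > 0\<close> by simp
        finally have "(\<integral>\<omega>. (?R t \<omega>)\<^sup>2 \<partial>M) / (norm u)\<^sup>2 < e" .
        moreover have "0 \<le> (\<integral>\<omega>. (?R t \<omega>)\<^sup>2 \<partial>M) / (norm u)\<^sup>2" by simp
        ultimately show ?thesis by (simp add: u_def)
      qed
      then show "\<exists>r>0. \<forall>t\<in>A. 0 < dist t s \<and> dist t s < r \<longrightarrow>
          dist ((\<integral>\<omega>. (?R t \<omega>)\<^sup>2 \<partial>M) / (norm (t - s))\<^sup>2) 0 < e"
        using r(1) by blast
    qed
  qed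
  ultimately show ?case by auto
qed simp

section \<open>The hypergeometric factor\<close>

text \<open>The coefficients of \<open>\<^sub>2F\<^sub>1(1/2, 1/2; a; x)\<close>.\<close>

definition hyp_coeff :: "real \<Rightarrow> nat \<Rightarrow> real" where
  "hyp_coeff a k = (pochhammer (1 / 2) k)\<^sup>2 / (pochhammer a k * fact k)"

definition hyp_sum :: "real \<Rightarrow> real \<Rightarrow> real" where
  "hyp_sum a x = (\<Sum>k. hyp_coeff a k * x ^ k)"

lemma hyp_coeff_pos: "0 < a \<Longrightarrow> 0 < hyp_coeff a k"
  unfolding hyp_coeff_def
  by (intro divide_pos_pos mult_pos_pos zero_less_power pochhammer_pos fact_gt_zero) auto

lemma hyp_coeff_0 [simp]: "hyp_coeff a 0 = 1"
  by (simp add: hyp_coeff_def)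

lemma hyp_coeff_Suc:
  "0 < a \<Longrightarrow> hyp_coeff a (Suc k) = hyp_coeff a k * ((1 / 2 + real k)\<^sup>2 / ((a + real k) * (real k + 1)))"
  by (simp add: hyp_coeff_def pochhammer_Suc power_mult_distrib mult_ac)

text \<open>Consecutive terms have ratio \<open>1 + (a - n)/k\<close> up to smaller order, so the
  ratio test is inconclusive and Raabe's test decides. The weight \<open>(2k + 1)^n\<close>
  majorises the factors produced by differentiating \<open>r^(2k+1)\<close> up to \<open>n\<close>
  times.\<close>

lemma summable_hyp_coeff_power:
  assumes "real n + 1 < a"
  shows "summable (\<lambda>k. real (2 * k + 1) ^ n * hyp_coeff a k)"
proof (rule raabes_test_convergence)
  have a: "0 < a" using assms by linarith
  show "\<forall>\<^sub>F k in sequentially. 0 < real (2 * k + 1) ^ n * hyp_coeff a k"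
    by (intro always_eventually allI mult_pos_pos hyp_coeff_pos a) simp
  have eq: "real (2 * k + 1) ^ n * hyp_coeff a k / (real (2 * Suc k + 1) ^ n * hyp_coeff a (Suc k))
      = ((2 * real k + 1) / (2 * real k + 3)) ^ n * ((a + real k) * (real k + 1) / (real k + 1/2)\<^sup>2)" for k
  proof -
    have "hyp_coeff a k \<noteq> 0" using hyp_coeff_pos[OF a, of k] by simp
    then have "hyp_coeff a k / hyp_coeff a (Suc k) = (a + real k) * (real k + 1) / (real k + 1/2)\<^sup>2"
      using a by (simp add: hyp_coeff_Suc add.commute)
    moreover have "real (2 * k + 1) ^ n / real (2 * Suc k + 1) ^ n = ((2 * real k + 1) / (2 * real k + 3)) ^ n"
      by (simp add: power_divide add.commute)
    ultimately show ?thesis by (metis times_divide_times_eq)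
  qed
  have "(\<lambda>k. real k * (((2 * real k + 1) / (2 * real k + 3)) ^ n
      * ((a + real k) * (real k + 1) / (real k + 1/2)\<^sup>2) - 1)) \<longlonglongrightarrow> a - n"
    by real_asymp
  then have "(\<lambda>k. ereal (real k * (real (2 * k + 1) ^ n * hyp_coeff a k /
      (real (2 * Suc k + 1) ^ n * hyp_coeff a (Suc k)) - 1))) \<longlonglongrightarrow> ereal (a - n)"
    unfolding eq by (rule tendsto_ereal)
  from lim_imp_Liminf[OF sequentially_bot this]
  show "1 < liminf (\<lambda>k. ereal (real k * (real (2 * k + 1) ^ n * hyp_coeff a k /
      (real (2 * Suc k + 1) ^ n * hyp_coeff a (Suc k)) - 1)))"
    using assms by simp
qed

lemma summable_hyp_coeff: "1 < a \<Longrightarrow> summable (hyp_coeff a)"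
  using summable_hyp_coeff_power[of 0 a] by simp

lemma summable_hyp_sum:
  assumes "1 < a" "0 \<le> x" "x \<le> 1"
  shows "summable (\<lambda>k. hyp_coeff a k * x ^ k)"
proof (rule summable_comparison_test')
  show "summable (hyp_coeff a)" using assms(1) by (rule summable_hyp_coeff)
  show "norm (hyp_coeff a k * x ^ k) \<le> hyp_coeff a k" if "k \<ge> 0" for k
    using assms hyp_coeff_pos[of a k] by (simp add: abs_mult mult_left_le power_le_one)
qed

lemma hyp_sum_mono:
  assumes "1 < a" "0 \<le> x" "x \<le> y" "y \<le> 1"
  shows "hyp_sum a x \<le> hyp_sum a y"
  unfolding hyp_sum_def
proof (rule suminf_le)
  show "hyp_coeff a k * x ^ k \<le> hyp_coeff a k * y ^ k" for k
    using assms hyp_coeff_pos[of a k] by (intro mult_left_mono power_mono) auto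
qed (use assms summable_hyp_sum in auto)

lemma hyp_sum_0 [simp]: "hyp_sum a 0 = 1"
  unfolding hyp_sum_def by (subst powser_zero) simp

lemma hyp_sum_bounds:
  assumes "1 < a" "\<bar>r\<bar> \<le> 1"
  shows "1 \<le> hyp_sum a (r\<^sup>2)" "hyp_sum a (r\<^sup>2) \<le> hyp_sum a 1" "1 \<le> hyp_sum a 1"
  using hyp_sum_mono[of a 0 "r\<^sup>2"] hyp_sum_mono[of a "r\<^sup>2" 1] hyp_sum_mono[of a 0 1] assms
  by (simp_all add: abs_square_le_1)

text \<open>The factor \<open>a\<close> cancels the first factor of
  \<open>pochhammer a (Suc k)\<close>, and what is left decreases in \<open>a\<close>. The reference
  value 5/2 is a fixed number above 1, so its coefficients are summable and the tail of
  \<open>hyp_sum a 1\<close> is at most a constant over \<open>a\<close>.\<close>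

lemma hyp_coeff_le:
  assumes "5 / 2 \<le> a"
  shows "a * hyp_coeff a (Suc k) \<le> 5 / 2 * hyp_coeff (5 / 2) (Suc k)"
proof (induction k)
  case 0
  then show ?case using assms by (simp add: hyp_coeff_Suc)
next
  case (Suc k)
  have a: "0 < a" using assms by linarith
  let ?q = "\<lambda>a. (1 / 2 + real (Suc k))\<^sup>2 / ((a + real (Suc k)) * (real (Suc k) + 1))"
  have "a * hyp_coeff a (Suc (Suc k)) = (a * hyp_coeff a (Suc k)) * ?q a"
    unfolding hyp_coeff_Suc[OF a, of "Suc k"] by simp
  also have "\<dots> \<le> (5 / 2 * hyp_coeff (5 / 2) (Suc k)) * ?q (5 / 2)"
    using a assms hyp_coeff_pos[of "5 / 2" "Suc k"]
    by (intro mult_mono Suc.IH divide_left_mono mult_right_mono) auto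
  also have "\<dots> = 5 / 2 * hyp_coeff (5 / 2) (Suc (Suc k))"
    using hyp_coeff_Suc[of "5 / 2" "Suc k"] by simp
  finally show ?case .
qed

lemma hyp_sum_1_tendsto: "((\<lambda>a. hyp_sum a 1) \<longlongrightarrow> 1) at_top"
proof (rule tendsto_sandwich)
  let ?C = "\<Sum>k. 5 / 2 * hyp_coeff (5 / 2) (Suc k)"
  have s: "summable (\<lambda>k. 5 / 2 * hyp_coeff (5 / 2) (Suc k))"
    using summable_hyp_coeff[of "5 / 2"] by (intro summable_mult) (simp add: summable_Suc_iff)
  show "\<forall>\<^sub>F a in at_top. 1 \<le> hyp_sum a 1"
    using eventually_gt_at_top[of 1] by eventually_elim (use hyp_sum_bounds[of _ 1] in simp)
  show "\<forall>\<^sub>F a in at_top. hyp_sum a 1 \<le> 1 + ?C / a"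
    using eventually_ge_at_top[of "5 / 2"]
  proof eventually_elim
    case (elim a)
    have sa: "summable (hyp_coeff a)" using elim by (intro summable_hyp_coeff) simp
    have 1: "hyp_sum a 1 = 1 + (\<Sum>k. hyp_coeff a (Suc k))"
      using suminf_split_head[OF sa] by (simp add: hyp_sum_def)
    have "a * (\<Sum>k. hyp_coeff a (Suc k)) = (\<Sum>k. a * hyp_coeff a (Suc k))"
      using sa by (intro suminf_mult[symmetric]) (simp add: summable_Suc_iff)
    also have "\<dots> \<le> ?C"
      using sa by (intro suminf_le hyp_coeff_le elim s summable_mult) (simp add: summable_Suc_iff)
    finally show ?case using elim unfolding 1 by (simp add: field_simps)
  qed
  have "((\<lambda>a. 1 + C / a) \<longlongrightarrow> 1) at_top" for C :: real by real_asymp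
  then show "((\<lambda>a. 1 + ?C / a) \<longlongrightarrow> 1) at_top" .
qed simp

text \<open>For \<open>j > N\<close> the factor with \<open>i = N\<close> is zero; otherwise every
  factor lies between 0 and \<open>N\<close>.\<close>

lemma falling_product_le:
  "\<bar>\<Prod>i<j. real N - real i\<bar> \<le> real N ^ j"
proof (cases "j \<le> N")
  case True
  have "\<bar>\<Prod>i<j. real N - real i\<bar> = (\<Prod>i<j. \<bar>real N - real i\<bar>)" by (simp add: abs_prod)
  also have "\<dots> \<le> (\<Prod>i<j. real N)" using True by (intro prod_mono) auto
  finally show ?thesis by simp
next
  case False
  then have "(\<Prod>i<j. real N - real i) = 0" by (intro prod_zero) auto
  then show ?thesis by (simp only: abs_zero zero_le_power of_nat_0_le_iff)
qed

text \<open>The majorant from \<open>summable_hyp_coeff_power\<close> dominates every term of order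
  at most \<open>n\<close> on the whole closed interval, so termwise differentiation reaches the end
  points. They cannot be left out, since \<open>\<rho> 0 = 1\<close>.\<close>

lemma hyp_sum_odd_derivatives:
  assumes "real n + 1 < a"
  obtains \<phi> where "\<And>r. \<bar>r\<bar> \<le> 1 \<Longrightarrow> \<phi> 0 r = r * hyp_sum a (r\<^sup>2)"
    and "\<And>j r. j < n \<Longrightarrow> r \<in> {-1..1} \<Longrightarrow> (\<phi> j has_field_derivative \<phi> (Suc j) r) (at r within {-1..1})"
proof -
  have a: "1 < a" using assms by linarith
  \<comment> \<open>\<open>f j k\<close> is the \<open>j\<close>-th derivative of the
    \<open>k\<close>-th term. The falling factorial is real and vanishes for
    \<open>j > 2k + 1\<close>, precisely where truncated subtraction would make the exponent
    wrong.\<close>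
  define f where "f j k r = hyp_coeff a k * (\<Prod>i<j. real (2 * k + 1) - real i) * r ^ (2 * k + 1 - j)"
    for j k :: nat and r :: real
  define \<phi> where "\<phi> j r = (\<Sum>k. f j k r)" for j r
  have bound: "norm (f j k r) \<le> real (2 * k + 1) ^ n * hyp_coeff a k"
    if "j \<le> n" "r \<in> {-1..1}" for j k r
  proof -
    have "\<bar>\<Prod>i<j. real (2 * k + 1) - real i\<bar> \<le> real (2 * k + 1) ^ j" by (rule falling_product_le)
    also have "\<dots> \<le> real (2 * k + 1) ^ n" using that by (intro power_increasing) auto
    finally have "\<bar>\<Prod>i<j. real (2 * k + 1) - real i\<bar> * \<bar>r\<bar> ^ (2 * k + 1 - j) \<le> real (2 * k + 1) ^ n * 1"
      using that by (intro mult_mono power_le_one) auto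
    from mult_left_mono[OF this, of "hyp_coeff a k"] show ?thesis
      using a hyp_coeff_pos[of a k] by (simp add: f_def abs_mult power_abs mult_ac)
  qed
  have sum: "summable (\<lambda>k. f j k r)" if "j \<le> n" "r \<in> {-1..1}" for j r
    by (rule summable_comparison_test'[OF summable_hyp_coeff_power[OF assms], of 0]) (rule bound[OF that])
  have f': "(f j k has_field_derivative f (Suc j) k r) (at r within S)" for j k r S
  proof -
    have "((\<lambda>r. r ^ (2 * k + 1 - j)) has_field_derivative
        real (2 * k + 1 - j) * r ^ (2 * k + 1 - Suc j)) (at r within S)"
      using DERIV_pow[of "2 * k + 1 - j" r S] by simp
    from DERIV_cmult[OF this, of "hyp_coeff a k * (\<Prod>i<j. real (2 * k + 1) - real i)"]
    have D: "(f j k has_field_derivative hyp_coeff a k * (\<Prod>i<j. real (2 * k + 1) - real i) *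
        (real (2 * k + 1 - j) * r ^ (2 * k + 1 - Suc j))) (at r within S)"
      by (simp add: f_def[abs_def])
    show ?thesis
    proof (cases "j \<le> 2 * k + 1")
      case True
      then have "real (2 * k + 1 - j) = real (2 * k + 1) - real j" by (simp add: of_nat_diff)
      then show ?thesis using D by (simp add: f_def mult_ac)
    next
      case False
      then have z: "(\<Prod>i<j. real (2 * k + 1) - real i) = 0"
        by (intro prod_zero bexI[of _ "2 * k + 1"]) auto
      show ?thesis
        using D by (simp only: f_def[of "Suc j"] prod.lessThan_Suc z mult_zero_left mult_zero_right)
    qed
  qed
  have "(\<phi> j has_field_derivative \<phi> (Suc j) r) (at r within {-1..1})"
    if j: "j < n" and r: "r \<in> {-1..1}" for j r
  proof -
    \<comment> \<open>Uniform convergence is established for the differentiated series; for the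
      series itself convergence at one point is supplied.\<close>
    have "uniform_limit {-1..1} (\<lambda>N r. \<Sum>k<N. f (Suc j) k r) (\<phi> (Suc j)) sequentially"
      unfolding \<phi>_def
      by (rule Weierstrass_m_test[OF bound summable_hyp_coeff_power[OF assms]]) (use j in auto)
    from has_field_derivative_series[OF convex_real_interval(5) f' this r sum[OF less_imp_le[OF j] r]]
    obtain g where g: "\<forall>x\<in>{-1..1}. (\<lambda>k. f j k x) sums g x \<and>
        (g has_field_derivative \<phi> (Suc j) x) (at x within {-1..1})" by blast
    have "\<phi> j x = g x" if "x \<in> {-1..1}" for x
      using g that unfolding \<phi>_def by (auto simp: sums_iff)
    then show ?thesis
      using g r by (subst has_field_derivative_cong_eventually[where g = g])
        (auto simp: eventually_at_filter)
  qed
  moreover have "\<phi> 0 r = r * hyp_sum a (r\<^sup>2)" if "\<bar>r\<bar> \<le> 1" for r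
  proof -
    have "\<phi> 0 r = (\<Sum>k. r * (hyp_coeff a k * (r\<^sup>2) ^ k))"
    proof -
      have "f 0 k r = r * (hyp_coeff a k * (r\<^sup>2) ^ k)" for k
        unfolding f_def by (simp flip: power_mult)
      then show ?thesis by (simp only: \<phi>_def)
    qed
    also have "\<dots> = r * hyp_sum a (r\<^sup>2)"
      unfolding hyp_sum_def
      by (intro suminf_mult summable_hyp_sum a) (use that in \<open>auto simp: abs_square_le_1\<close>)
    finally show ?thesis .
  qed
  ultimately show thesis using that by blast
qed

section \<open>From Laplace transforms to negative moments\<close>

text \<open>Normalised, this is the Gamma density of shape \<open>s\<close> and rate
  \<open>l\<close>. With \<open>s = 1/2\<close> it serves a second purpose, writing
  \<open>l^(-1/2)\<close> as a mixture of exponentials in \<open>l\<close>.\<close>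

definition gamma_kernel :: "real \<Rightarrow> real \<Rightarrow> real \<Rightarrow> real" where
  "gamma_kernel s l x = indicator {0<..} x * x powr (s - 1) * exp (- l * x)"

lemma gamma_kernel_nonneg [simp]: "0 \<le> gamma_kernel s l x"
  by (simp add: gamma_kernel_def)

lemma measurable_gamma_kernel [measurable (raw)]:
  assumes [measurable]: "f \<in> borel_measurable M" "g \<in> borel_measurable M"
  shows "(\<lambda>x. gamma_kernel s (f x) (g x)) \<in> borel_measurable M"
  unfolding gamma_kernel_def by measurable

lemma nn_integral_gamma_kernel:
  assumes "0 < s" "0 < l"
  shows "(\<integral>\<^sup>+x. ennreal (gamma_kernel s l x) \<partial>lborel) = ennreal (Gamma s * l powr (- s))"
proof -
  have "ennreal (Gamma s) = (\<integral>\<^sup>+x. ennreal (indicator {0..} x * x powr (s - 1) / exp x) \<partial>lborel)"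
    by (rule Gamma_conv_nn_integral_real[OF assms(1)])
  also have "\<dots> = ennreal \<bar>l\<bar> * (\<integral>\<^sup>+x. ennreal (indicator {0..} (0 + l * x) * (0 + l * x) powr (s - 1) / exp (0 + l * x)) \<partial>lborel)"
    using assms by (intro nn_integral_real_affine) auto
  also have "(\<lambda>x. ennreal (indicator {0..} (0 + l * x) * (0 + l * x) powr (s - 1) / exp (0 + l * x)))
      = (\<lambda>x. ennreal (l powr (s - 1)) * ennreal (gamma_kernel s l x))"
    using assms
    by (intro ext) (auto simp: gamma_kernel_def indicator_def powr_mult exp_minus field_simps
        zero_le_mult_iff simp flip: ennreal_mult)
  also have "(\<integral>\<^sup>+x. ennreal (l powr (s - 1)) * ennreal (gamma_kernel s l x) \<partial>lborel)
      = ennreal (l powr (s - 1)) * (\<integral>\<^sup>+x. ennreal (gamma_kernel s l x) \<partial>lborel)"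
    by (rule nn_integral_cmult) simp
  finally have "ennreal (Gamma s) = ennreal (l powr s) * (\<integral>\<^sup>+x. ennreal (gamma_kernel s l x) \<partial>lborel)"
    using assms by (simp add: powr_diff flip: ennreal_mult mult.assoc)
  then have "ennreal (l powr (- s)) * ennreal (Gamma s)
      = (ennreal (l powr (- s)) * ennreal (l powr s)) * (\<integral>\<^sup>+x. ennreal (gamma_kernel s l x) \<partial>lborel)"
    by (simp add: mult.assoc)
  also have "ennreal (l powr (- s)) * ennreal (l powr s) = 1"
    using assms by (simp add: powr_minus flip: ennreal_mult)
  finally show ?thesis using assms by (simp add: ennreal_mult Gamma_real_pos less_imp_le mult.commute)
qed

lemma negative_binomial_sums:
  fixes a x :: real
  assumes "0 \<le> x" "x < 1"
  shows "(\<lambda>k. pochhammer a k / fact k * x ^ k) sums (1 - x) powr (- a)"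
proof -
  have "(- a gchoose k) * (- x) ^ k = pochhammer a k / fact k * x ^ k" for k
  proof -
    have "(- a gchoose k) * (- x) ^ k = ((-1) ^ k * (-1) ^ k) * (pochhammer a k / fact k * x ^ k)"
      by (simp add: gbinomial_pochhammer power_minus[of x])
    also have "(-1) ^ k * (-1) ^ k = (1::real)" by (simp flip: power_mult_distrib)
    finally show ?thesis by simp
  qed
  then show ?thesis using gen_binomial_real[of "- x" "- a"] assms by simp
qed

text \<open>The share of one variable in the \<open>k\<close>-th term of the expanded joint
  transform: \<open>(\<theta>/a)^k\<close> times the Laplace transform of the Gamma law with shape
  \<open>a + k\<close> and rate \<open>a\<close>.\<close>

definition laplace_factor :: "real \<Rightarrow> nat \<Rightarrow> real \<Rightarrow> real" where
  "laplace_factor a k \<theta> = (\<theta> / a) ^ k * (1 + \<theta> / a) powr (- (a + real k))"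

lemma measurable_laplace_factor [measurable]: "laplace_factor a k \<in> borel_measurable borel"
  unfolding laplace_factor_def by measurable

lemma laplace_factor_nonneg: "0 < a \<Longrightarrow> 0 \<le> \<theta> \<Longrightarrow> 0 \<le> laplace_factor a k \<theta>"
  by (simp add: laplace_factor_def)

text \<open>The joint Laplace transform of two Gamma variables whose squared underlying correlation is
  \<open>q\<close>, for every \<open>q \<le> 1\<close>.\<close>

definition gamma_laplace :: "real \<Rightarrow> real \<Rightarrow> real \<Rightarrow> real \<Rightarrow> real" where
  "gamma_laplace a q \<theta> \<eta> = ((1 + \<theta> / a) * (1 + \<eta> / a) - q * (\<theta> / a) * (\<eta> / a)) powr (- a)"

text \<open>With \<open>u = 1 + \<theta>/a\<close> and \<open>v = 1 + \<eta>/a\<close>, factoring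
  out \<open>u v\<close> leaves \<open>1 - x\<close>, where \<open>x = q (u-1)/u (v-1)/v\<close> is
  below 1 even for \<open>q = 1\<close>. The binomial series therefore covers perfectly correlated
  pairs, for which no joint density exists.\<close>

lemma gamma_laplace_suminf:
  assumes "0 < a" "0 \<le> q" "q \<le> 1" "0 < \<theta>" "0 < \<eta>"
  shows "(\<Sum>k. ennreal (pochhammer a k / fact k * q ^ k * laplace_factor a k \<theta> * laplace_factor a k \<eta>))
    = ennreal (gamma_laplace a q \<theta> \<eta>)"
proof (rule suminf_ennreal_eq)
  define u v where "u = 1 + \<theta> / a" and "v = 1 + \<eta> / a"
  have u: "1 < u" "\<theta> / a = u - 1" and v: "1 < v" "\<eta> / a = v - 1"
    using assms by (auto simp: u_def v_def)
  define y where "y = (u - 1) / u * ((v - 1) / v)"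
  define x where "x = q * y"
  have "y < 1 * 1"
    unfolding y_def using u v by (intro mult_strict_mono) auto
  moreover have "0 \<le> y" using u v by (simp add: y_def)
  ultimately have "x < 1" "0 \<le> x"
    using assms mult_left_le_one_le[of y q] by (auto simp: x_def)
  have "0 < u" "0 < v" using u v by simp_all
  then have fac: "laplace_factor a k \<theta> = ((u - 1) / u) ^ k * u powr (- a)"
    "laplace_factor a k \<eta> = ((v - 1) / v) ^ k * v powr (- a)" for k
    unfolding laplace_factor_def u_def[symmetric] v_def[symmetric]
    by (simp_all add: u v powr_diff powr_realpow power_divide powr_minus field_simps powr_add)
  show "0 \<le> pochhammer a k / fact k * q ^ k * laplace_factor a k \<theta> * laplace_factor a k \<eta>" for k
    using assms by (intro mult_nonneg_nonneg laplace_factor_nonneg divide_nonneg_nonneg) (auto simp: pochhammer_nonneg)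
  have "(\<lambda>k. (u powr (- a) * v powr (- a)) * (pochhammer a k / fact k * x ^ k)) sums
      ((u powr (- a) * v powr (- a)) * (1 - x) powr (- a))"
    by (intro sums_mult negative_binomial_sums) fact+
  also have "(u powr (- a) * v powr (- a)) * (1 - x) powr (- a) = (u * v * (1 - x)) powr (- a)"
    using u v \<open>x < 1\<close> by (simp add: powr_mult)
  also have "u * v * (1 - x) = u * v - q * (u - 1) * (v - 1)"
    using u v by (simp add: x_def y_def field_simps)
  also have "(\<lambda>k. (u powr (- a) * v powr (- a)) * (pochhammer a k / fact k * x ^ k))
      = (\<lambda>k. pochhammer a k / fact k * q ^ k * laplace_factor a k \<theta> * laplace_factor a k \<eta>)"
    by (intro ext) (simp add: fac x_def y_def power_mult_distrib power_divide mult_ac)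
  finally show "(\<lambda>k. pochhammer a k / fact k * q ^ k * laplace_factor a k \<theta> * laplace_factor a k \<eta>)
      sums gamma_laplace a q \<theta> \<eta>"
    by (simp add: gamma_laplace_def u(2) v(2))
qed

text \<open>A Beta integral: the power of \<open>a + \<theta>\<close> is written as a Gamma integral
  over \<open>x\<close>, and after exchanging the order the \<open>\<theta>\<close> integral gives
  \<open>Gamma (k + 1/2) * x^(-(k + 1/2))\<close>. What remains is a Gamma integral of shape
  \<open>a - 1/2\<close>.\<close>

lemma nn_integral_laplace_factor:
  assumes "1 / 2 < a"
  shows "(\<integral>\<^sup>+\<theta>. ennreal (indicator {0<..} \<theta> * \<theta> powr (- 1 / 2) * laplace_factor a k \<theta>) \<partial>lborel)
    = ennreal (sqrt a * Gamma (k + 1 / 2) * Gamma (a - 1 / 2) / Gamma (a + k))"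
proof -
  define s where "s = a + real k"
  \<comment> \<open>Chosen so that \<open>c * Gamma s * \<theta>^k * (a + \<theta>)^(-s)\<close> is
    \<open>laplace_factor a k \<theta>\<close>.\<close>
  define c where "c = a powr a / Gamma s"
  have pos: "0 < a" "0 < s" "0 < Gamma s" "0 \<le> c"
    using assms by (auto simp: s_def c_def Gamma_real_pos intro!: divide_nonneg_nonneg less_imp_le)
  let ?f = "\<lambda>\<theta> x. ennreal (gamma_kernel (k + 1 / 2) x \<theta> * gamma_kernel s a x)"
  have "(\<integral>\<^sup>+\<theta>. ennreal (indicator {0<..} \<theta> * \<theta> powr (- 1 / 2) * laplace_factor a k \<theta>) \<partial>lborel)
      = (\<integral>\<^sup>+\<theta>. ennreal c * (\<integral>\<^sup>+x. ?f \<theta> x \<partial>lborel) \<partial>lborel)"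
  proof (rule nn_integral_cong)
    fix \<theta> :: real
    show "ennreal (indicator {0<..} \<theta> * \<theta> powr (- 1 / 2) * laplace_factor a k \<theta>)
        = ennreal c * (\<integral>\<^sup>+x. ?f \<theta> x \<partial>lborel)"
    proof (cases "0 < \<theta>")
      case True
      have "(\<integral>\<^sup>+x. ?f \<theta> x \<partial>lborel)
          = (\<integral>\<^sup>+x. ennreal (\<theta> powr (k - 1 / 2)) * ennreal (gamma_kernel s (a + \<theta>) x) \<partial>lborel)"
      proof (intro nn_integral_cong)
        fix x
        have "exp (- (a + \<theta>) * x) = exp (- x * \<theta>) * exp (- a * x)"
          by (simp add: algebra_simps flip: exp_add)
        then have "gamma_kernel (k + 1 / 2) x \<theta> * gamma_kernel s a x
            = \<theta> powr (k - 1 / 2) * gamma_kernel s (a + \<theta>) x"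
          using True by (simp add: gamma_kernel_def mult_ac)
        then show "?f \<theta> x = ennreal (\<theta> powr (k - 1 / 2)) * ennreal (gamma_kernel s (a + \<theta>) x)"
          by (simp flip: ennreal_mult)
      qed
      also have "\<dots> = ennreal (\<theta> powr (k - 1 / 2)) * ennreal (Gamma s * (a + \<theta>) powr (- s))"
        using pos True by (subst nn_integral_cmult) (auto simp: nn_integral_gamma_kernel)
      also have "ennreal c * \<dots> = ennreal (c * (\<theta> powr (k - 1 / 2) * (Gamma s * (a + \<theta>) powr (- s))))"
        using pos by (simp flip: ennreal_mult)
      also have "c * (\<theta> powr (k - 1 / 2) * (Gamma s * (a + \<theta>) powr (- s)))
          = indicator {0<..} \<theta> * \<theta> powr (- 1 / 2) * laplace_factor a k \<theta>"
      proof -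
        have "a + \<theta> = a * (1 + \<theta> / a)" using pos by (simp add: field_simps)
        then have "(a + \<theta>) powr (- s) = a powr (- s) * (1 + \<theta> / a) powr (- s)"
          using pos True by (simp add: powr_mult)
        moreover have "\<theta> powr (k - 1 / 2) = \<theta> powr (- 1 / 2) * \<theta> ^ k"
        proof -
          have "real k - 1 / 2 = - 1 / 2 + real k" by simp
          then show ?thesis using True by (simp only: powr_add powr_realpow)
        qed
        moreover have "a powr a * a powr (- s) = 1 / a ^ k"
          using pos by (simp add: s_def powr_realpow powr_minus_divide flip: powr_add)
        moreover have "Gamma s \<noteq> 0" using pos(3) by linarith
        ultimately show ?thesis
          using True pos(1,2) by (simp add: c_def laplace_factor_def s_def[symmetric] power_divide field_simps)
      qed
      finally show ?thesis ..
    qed (simp add: gamma_kernel_def)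
  qed
  also have "\<dots> = ennreal c * (\<integral>\<^sup>+\<theta>. \<integral>\<^sup>+x. ?f \<theta> x \<partial>lborel \<partial>lborel)"
    by (rule nn_integral_cmult) measurable
  also have "(\<integral>\<^sup>+\<theta>. \<integral>\<^sup>+x. ?f \<theta> x \<partial>lborel \<partial>lborel) = (\<integral>\<^sup>+x. \<integral>\<^sup>+\<theta>. ?f \<theta> x \<partial>lborel \<partial>lborel)"
    by (rule lborel_pair.Fubini') measurable
  also have "\<dots> = (\<integral>\<^sup>+x. ennreal (Gamma (k + 1 / 2)) * ennreal (gamma_kernel (a - 1 / 2) a x) \<partial>lborel)"
  proof (rule nn_integral_cong)
    fix x :: real
    show "(\<integral>\<^sup>+\<theta>. ?f \<theta> x \<partial>lborel) = ennreal (Gamma (k + 1 / 2)) * ennreal (gamma_kernel (a - 1 / 2) a x)"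
    proof (cases "0 < x")
      case True
      have "(\<integral>\<^sup>+\<theta>. ?f \<theta> x \<partial>lborel)
          = (\<integral>\<^sup>+\<theta>. ennreal (gamma_kernel (k + 1 / 2) x \<theta>) * ennreal (gamma_kernel s a x) \<partial>lborel)"
        by (simp add: ennreal_mult)
      also have "\<dots> = ennreal (Gamma (k + 1 / 2) * x powr (- (k + 1 / 2))) * ennreal (gamma_kernel s a x)"
        using True by (subst nn_integral_multc) (auto simp: nn_integral_gamma_kernel)
      also have "\<dots> = ennreal (Gamma (k + 1 / 2) * (x powr (- (k + 1 / 2)) * gamma_kernel s a x))"
        by (simp add: Gamma_real_pos less_imp_le mult.assoc flip: ennreal_mult)
      also have "x powr (- (k + 1 / 2)) * gamma_kernel s a x = gamma_kernel (a - 1 / 2) a x"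
        using True by (simp add: gamma_kernel_def s_def flip: powr_add mult.assoc)
      finally show ?thesis by (simp add: Gamma_real_pos less_imp_le ennreal_mult)
    qed (simp add: gamma_kernel_def)
  qed
  also have "\<dots> = ennreal (Gamma (k + 1 / 2)) * ennreal (Gamma (a - 1 / 2) * a powr (- (a - 1 / 2)))"
    using assms by (subst nn_integral_cmult) (auto simp: nn_integral_gamma_kernel)
  also have "ennreal c * \<dots> = ennreal (c * (Gamma (k + 1 / 2) * (Gamma (a - 1 / 2) * a powr (- (a - 1 / 2)))))"
    using assms pos by (simp add: Gamma_real_pos less_imp_le flip: ennreal_mult)
  also have "c * (Gamma (k + 1 / 2) * (Gamma (a - 1 / 2) * a powr (- (a - 1 / 2))))
      = (a powr a * a powr (- (a - 1 / 2))) * Gamma (k + 1 / 2) * Gamma (a - 1 / 2) / Gamma s"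
    by (simp add: c_def)
  also have "a powr a * a powr (- (a - 1 / 2)) = sqrt a"
    using pos by (simp add: powr_half_sqrt flip: powr_add)
  finally show ?thesis by (simp add: s_def)
qed

text \<open>This is \<open>(E W\<^sup>-\<^sup>1\<^sup>/\<^sup>2)\<^sup>2\<close> for \<open>W\<close> with the \<open>\<Gamma>(a, a)\<close> distribution.\<close>

definition t_const :: "real \<Rightarrow> real" where
  "t_const a = a * (Gamma (a - 1 / 2) / Gamma a)\<^sup>2"

lemma t_const_pos: "1 / 2 < a \<Longrightarrow> 0 < t_const a"
  unfolding t_const_def
  by (intro mult_pos_pos zero_less_power divide_pos_pos Gamma_real_pos) auto

text \<open>This is where \<open>2F1(1/2, 1/2; a)\<close> arises: the two one-variable integrals
  contribute \<open>Gamma (k + 1/2)\<close> and \<open>1 / Gamma (a + k)\<close> squared, and the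
  binomial coefficient cancels one of the two resulting factors
  \<open>pochhammer a k\<close>.\<close>

lemma hyp_coeff_Gamma:
  assumes "1 / 2 < a"
  shows "pochhammer a k / fact k * (sqrt a * Gamma (k + 1 / 2) * Gamma (a - 1 / 2) / Gamma (a + k))\<^sup>2
    = pi * t_const a * hyp_coeff a k"
proof -
  have nz: "a \<notin> \<int>\<^sub>\<le>\<^sub>0" "(1 / 2 :: real) \<notin> \<int>\<^sub>\<le>\<^sub>0"
    using assms by (auto elim!: nonpos_Ints_cases)
  have Ga: "0 < Gamma a" using assms by (auto intro!: Gamma_real_pos)
  have G: "Gamma (real k + 1 / 2) = pochhammer (1 / 2) k * sqrt pi" "Gamma (a + k) = pochhammer a k * Gamma a"
    using pochhammer_Gamma[OF nz(1), of k] pochhammer_Gamma[OF nz(2), of k] Gamma_one_half_real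
      Ga by (simp_all add: field_simps)
  have "0 < pochhammer a k" using assms by (auto intro!: pochhammer_pos)
  moreover have "Gamma a \<noteq> 0" using Ga by linarith
  ultimately show ?thesis
    using assms unfolding G t_const_def hyp_coeff_def
    by (simp add: power_mult_distrib power_divide power2_eq_square field_simps)
qed

text \<open>Each inverse square root becomes a Gamma integral of shape 1/2; the two constants
  \<open>sqrt pi\<close> multiply to the \<open>pi\<close> carried through the proof. Integrating
  over \<open>M\<close> first leaves the joint transform. All integrands are nonnegative, so
  integrals and sums are exchanged before anything is known to be finite.\<close>

lemma (in sigma_finite_measure) nn_integral_inverse_sqrt_product:
  assumes [measurable]: "U \<in> borel_measurable M" "V \<in> borel_measurable M"
    and pos: "AE \<omega> in M. 0 < U \<omega>" "AE \<omega> in M. 0 < V \<omega>"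
    and a: "1 / 2 < a" and q: "0 \<le> q" "q \<le> 1"
    and laplace: "\<And>\<theta> \<eta>. 0 < \<theta> \<Longrightarrow> 0 < \<eta> \<Longrightarrow>
      (\<integral>\<^sup>+\<omega>. ennreal (exp (- (\<theta> * U \<omega> + \<eta> * V \<omega>))) \<partial>M) = ennreal (gamma_laplace a q \<theta> \<eta>)"
  shows "(\<integral>\<^sup>+\<omega>. ennreal (U \<omega> powr (- 1 / 2) * V \<omega> powr (- 1 / 2)) \<partial>M)
    = (\<Sum>k. ennreal (t_const a * (hyp_coeff a k * q ^ k)))"
proof -
  interpret P': pair_sigma_finite lborel M ..
  let ?h = "\<lambda>\<theta>. indicator {0<..} \<theta> * \<theta> powr (- 1 / 2) :: real"
  let ?g = "gamma_kernel (1 / 2)"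
  have g: "?g l \<theta> = ?h \<theta> * exp (- (\<theta> * l))" for l \<theta>
    by (simp add: gamma_kernel_def mult.commute)
  have "ennreal pi * (\<integral>\<^sup>+\<omega>. ennreal (U \<omega> powr (- 1 / 2) * V \<omega> powr (- 1 / 2)) \<partial>M)
      = (\<integral>\<^sup>+\<omega>. ennreal pi * ennreal (U \<omega> powr (- 1 / 2) * V \<omega> powr (- 1 / 2)) \<partial>M)"
    by (rule nn_integral_cmult[symmetric]) measurable
  also have "\<dots> = (\<integral>\<^sup>+\<omega>. \<integral>\<^sup>+\<theta>. \<integral>\<^sup>+\<eta>. ennreal (?g (U \<omega>) \<theta> * ?g (V \<omega>) \<eta>) \<partial>lborel \<partial>lborel \<partial>M)"
  proof (rule nn_integral_cong_AE)
    show "AE \<omega> in M. ennreal pi * ennreal (U \<omega> powr (- 1 / 2) * V \<omega> powr (- 1 / 2))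
        = (\<integral>\<^sup>+\<theta>. \<integral>\<^sup>+\<eta>. ennreal (?g (U \<omega>) \<theta> * ?g (V \<omega>) \<eta>) \<partial>lborel \<partial>lborel)"
      using pos
    proof eventually_elim
      case (elim \<omega>)
      have "(\<integral>\<^sup>+\<theta>. \<integral>\<^sup>+\<eta>. ennreal (?g (U \<omega>) \<theta> * ?g (V \<omega>) \<eta>) \<partial>lborel \<partial>lborel)
          = (\<integral>\<^sup>+\<theta>. ennreal (?g (U \<omega>) \<theta>) \<partial>lborel) * (\<integral>\<^sup>+\<eta>. ennreal (?g (V \<omega>) \<eta>) \<partial>lborel)"
        by (simp add: ennreal_mult nn_integral_cmult nn_integral_multc)
      also have "\<dots> = ennreal (sqrt pi * U \<omega> powr (- 1 / 2)) * ennreal (sqrt pi * V \<omega> powr (- 1 / 2))"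
        using elim by (simp add: nn_integral_gamma_kernel Gamma_one_half_real)
      also have "\<dots> = ennreal ((sqrt pi * sqrt pi) * (U \<omega> powr (- 1 / 2) * V \<omega> powr (- 1 / 2)))"
        by (simp only: mult_ac flip: ennreal_mult) (simp add: mult_ac flip: ennreal_mult)
      finally show ?case by (simp add: ennreal_mult)
    qed
  qed
  also have "\<dots> = (\<integral>\<^sup>+\<theta>. \<integral>\<^sup>+\<omega>. \<integral>\<^sup>+\<eta>. ennreal (?g (U \<omega>) \<theta> * ?g (V \<omega>) \<eta>) \<partial>lborel \<partial>M \<partial>lborel)"
    by (rule P'.Fubini') measurable
  also have "\<dots> = (\<integral>\<^sup>+\<theta>. \<integral>\<^sup>+\<eta>. \<integral>\<^sup>+\<omega>. ennreal (?g (U \<omega>) \<theta> * ?g (V \<omega>) \<eta>) \<partial>M \<partial>lborel \<partial>lborel)"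
    by (intro nn_integral_cong P'.Fubini') measurable
  also have "\<dots> = (\<integral>\<^sup>+\<theta>. \<integral>\<^sup>+\<eta>. (\<Sum>k. ennreal (pochhammer a k / fact k * q ^ k)
      * (ennreal (?h \<theta> * laplace_factor a k \<theta>) * ennreal (?h \<eta> * laplace_factor a k \<eta>))) \<partial>lborel \<partial>lborel)"
  proof (intro nn_integral_cong)
    fix \<theta> \<eta> :: real
    show "(\<integral>\<^sup>+\<omega>. ennreal (?g (U \<omega>) \<theta> * ?g (V \<omega>) \<eta>) \<partial>M) = (\<Sum>k. ennreal (pochhammer a k / fact k * q ^ k)
      * (ennreal (?h \<theta> * laplace_factor a k \<theta>) * ennreal (?h \<eta> * laplace_factor a k \<eta>)))"
    proof (cases "0 < \<theta> \<and> 0 < \<eta>")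
      case True
      have "(\<integral>\<^sup>+\<omega>. ennreal (?g (U \<omega>) \<theta> * ?g (V \<omega>) \<eta>) \<partial>M)
          = (\<integral>\<^sup>+\<omega>. ennreal (?h \<theta> * ?h \<eta>) * ennreal (exp (- (\<theta> * U \<omega> + \<eta> * V \<omega>))) \<partial>M)"
      proof (intro nn_integral_cong)
        fix \<omega>
        have "?g (U \<omega>) \<theta> * ?g (V \<omega>) \<eta> = (?h \<theta> * ?h \<eta>) * exp (- (\<theta> * U \<omega> + \<eta> * V \<omega>))"
          unfolding g minus_add_distrib exp_add by (simp only: mult_ac)
        then show "ennreal (?g (U \<omega>) \<theta> * ?g (V \<omega>) \<eta>)
            = ennreal (?h \<theta> * ?h \<eta>) * ennreal (exp (- (\<theta> * U \<omega> + \<eta> * V \<omega>)))"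
          by (simp only: ennreal_mult'' exp_ge_zero)
      qed
      also have "\<dots> = ennreal (?h \<theta> * ?h \<eta>) * (\<integral>\<^sup>+\<omega>. ennreal (exp (- (\<theta> * U \<omega> + \<eta> * V \<omega>))) \<partial>M)"
        by (rule nn_integral_cmult) measurable
      also have "(\<integral>\<^sup>+\<omega>. ennreal (exp (- (\<theta> * U \<omega> + \<eta> * V \<omega>))) \<partial>M) = ennreal (gamma_laplace a q \<theta> \<eta>)"
        using True by (intro laplace) auto
      also have "ennreal (gamma_laplace a q \<theta> \<eta>) = (\<Sum>k. ennreal
          (pochhammer a k / fact k * q ^ k * laplace_factor a k \<theta> * laplace_factor a k \<eta>))"
        using True a q by (intro gamma_laplace_suminf[symmetric]) auto
      also have "ennreal (?h \<theta> * ?h \<eta>) * \<dots> = (\<Sum>k. ennreal (?h \<theta> * ?h \<eta>) * ennreal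
          (pochhammer a k / fact k * q ^ k * laplace_factor a k \<theta> * laplace_factor a k \<eta>))"
        by simp
      also have "\<dots> = (\<Sum>k. ennreal (pochhammer a k / fact k * q ^ k)
          * (ennreal (?h \<theta> * laplace_factor a k \<theta>) * ennreal (?h \<eta> * laplace_factor a k \<eta>)))"
      proof (intro arg_cong[where f = suminf] ext)
        fix k
        have nn: "0 \<le> pochhammer a k / fact k * q ^ k" "0 \<le> laplace_factor a k \<theta>" "0 \<le> laplace_factor a k \<eta>"
          using True a q by (auto intro!: mult_nonneg_nonneg divide_nonneg_nonneg pochhammer_nonneg laplace_factor_nonneg)
        show "ennreal (?h \<theta> * ?h \<eta>) * ennreal
          (pochhammer a k / fact k * q ^ k * laplace_factor a k \<theta> * laplace_factor a k \<eta>)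
          = ennreal (pochhammer a k / fact k * q ^ k)
          * (ennreal (?h \<theta> * laplace_factor a k \<theta>) * ennreal (?h \<eta> * laplace_factor a k \<eta>))"
        proof -
          have "(?h \<theta> * ?h \<eta>) * (pochhammer a k / fact k * q ^ k * laplace_factor a k \<theta> * laplace_factor a k \<eta>)
              = (pochhammer a k / fact k * q ^ k) * ((?h \<theta> * laplace_factor a k \<theta>) * (?h \<eta> * laplace_factor a k \<eta>))"
            by (simp only: mult_ac)
          moreover have "0 \<le> ?h \<theta>" "0 \<le> ?h \<eta>" by auto
          ultimately show ?thesis
            using nn by (metis ennreal_mult mult_nonneg_nonneg)
        qed
      qed
      finally show ?thesis .
    qed (auto simp: gamma_kernel_def)
  qed
  also have "\<dots> = (\<Sum>k. ennreal (pochhammer a k / fact k * q ^ k) *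
      ((\<integral>\<^sup>+\<theta>. ennreal (?h \<theta> * laplace_factor a k \<theta>) \<partial>lborel) * (\<integral>\<^sup>+\<eta>. ennreal (?h \<eta> * laplace_factor a k \<eta>) \<partial>lborel)))"
    by (simp add: nn_integral_suminf nn_integral_cmult nn_integral_multc)
  also have "\<dots> = (\<Sum>k. ennreal pi * ennreal (t_const a * (hyp_coeff a k * q ^ k)))"
  proof (intro arg_cong[where f = suminf] ext)
    fix k :: nat
    let ?J = "sqrt a * Gamma (k + 1 / 2) * Gamma (a - 1 / 2) / Gamma (a + k)"
    have J: "0 \<le> ?J" "0 \<le> pochhammer a k / fact k * q ^ k"
      using a q by (auto intro!: mult_nonneg_nonneg divide_nonneg_nonneg pochhammer_nonneg Gamma_real_nonneg)
    have "ennreal (pochhammer a k / fact k * q ^ k) * (ennreal ?J * ennreal ?J)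
        = ennreal ((pochhammer a k / fact k * ?J\<^sup>2) * q ^ k)"
      using J unfolding power2_eq_square by (simp only: ennreal_mult[symmetric] mult_nonneg_nonneg mult_ac)
    also have "\<dots> = ennreal pi * ennreal (t_const a * (hyp_coeff a k * q ^ k))"
      unfolding hyp_coeff_Gamma[OF a] using a q t_const_pos[OF a] hyp_coeff_pos[of a k]
      by (simp add: mult_ac flip: ennreal_mult)
    finally show "ennreal (pochhammer a k / fact k * q ^ k) *
      ((\<integral>\<^sup>+\<theta>. ennreal (?h \<theta> * laplace_factor a k \<theta>) \<partial>lborel) * (\<integral>\<^sup>+\<eta>. ennreal (?h \<eta> * laplace_factor a k \<eta>) \<partial>lborel))
      = ennreal pi * ennreal (t_const a * (hyp_coeff a k * q ^ k))"
      unfolding nn_integral_laplace_factor[OF a] .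
  qed
  also have "\<dots> = ennreal pi * (\<Sum>k. ennreal (t_const a * (hyp_coeff a k * q ^ k)))"
    by simp
  finally show ?thesis
    by (simp add: ennreal_mult_cancel_left)
qed

section \<open>Laplace transforms of the mixing processes\<close>

lemma (in prob_space) gaussian_variable_iexp:
  assumes "gaussian_variable M V" "expectation V = 0"
  shows "(CLINT \<omega>|M. iexp (V \<omega>)) = exp (- (\<integral>\<omega>. (V \<omega>)\<^sup>2 \<partial>M) / 2)"
proof -
  have [measurable]: "V \<in> borel_measurable M" using assms by (simp add: gaussian_variable_def)
  consider \<mu> \<sigma> where "0 < \<sigma>" "distributed M lborel V (normal_density \<mu> \<sigma>)" | \<mu> where "AE \<omega> in M. V \<omega> = \<mu>"
    using assms(1) by (auto simp: gaussian_variable_def)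
  then show ?thesis
  proof cases
    case 1
    then have \<mu>: "\<mu> = 0" using normal_distributed_expectation[OF 1] assms(2) by simp
    have var: "(\<integral>\<omega>. (V \<omega>)\<^sup>2 \<partial>M) = \<sigma>\<^sup>2" using normal_distributed_variance[OF 1] assms(2) by simp
    have D: "distributed M lborel (\<lambda>\<omega>. V \<omega> / \<sigma>) std_normal_density"
      using 1 normal_standard_normal_convert[of \<sigma> V \<mu>] \<mu> by simp
    have "(CLINT \<omega>|M. iexp (V \<omega>)) = (CLINT \<omega>|M. iexp (\<sigma> * (V \<omega> / \<sigma>)))" using 1 by simp
    also have "\<dots> = (CLINT x|distr M lborel (\<lambda>\<omega>. V \<omega> / \<sigma>). iexp (\<sigma> * x))"
      by (subst integral_distr) (auto simp: measurable_lborel1)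
    also have "distr M lborel (\<lambda>\<omega>. V \<omega> / \<sigma>) = std_normal_distribution"
      using D by (simp add: distributed_def)
    also have "(CLINT x|std_normal_distribution. iexp (\<sigma> * x)) = exp (- \<sigma>\<^sup>2 / 2)"
      using char_std_normal_distribution by (simp add: char_def fun_eq_iff)
    finally show ?thesis by (simp add: var)
  next
    case 2
    \<comment> \<open>A degenerate Gaussian variable with mean 0 is almost surely 0, and the formula
      persists with variance 0.\<close>
    have "expectation V = (\<integral>\<omega>. \<mu> \<partial>M)" using 2 by (intro integral_cong_AE) auto
    then have \<mu>: "\<mu> = 0" using assms(2) by (simp add: prob_space)
    have "(\<integral>\<omega>. (V \<omega>)\<^sup>2 \<partial>M) = (\<integral>\<omega>. 0 \<partial>M)" using 2 \<mu> by (intro integral_cong_AE) auto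
    moreover have "(CLINT \<omega>|M. iexp (V \<omega>)) = (CLINT \<omega>|M. 1)" using 2 \<mu> by (intro integral_cong_AE) auto
    ultimately show ?thesis by (simp add: prob_space)
  qed
qed

text \<open>Completing the square turns the integrand into a multiple of the normal density with
  mean \<open>- b / (1 + p)\<close> and variance \<open>1 / (1 + p)\<close>.\<close>

lemma std_normal_gaussian_integral:
  assumes "0 \<le> p"
  shows "(\<integral>\<zeta>. exp (- (p * \<zeta>\<^sup>2 + 2 * b * \<zeta>) / 2) \<partial>std_normal_distribution)
    = (1 + p) powr (- 1 / 2) * exp (b\<^sup>2 / (2 * (1 + p)))"
proof -
  define \<sigma> where "\<sigma> = 1 / sqrt (1 + p)"
  define \<mu> where "\<mu> = - b / (1 + p)"
  have \<sigma>: "0 < \<sigma>" "\<sigma>\<^sup>2 = 1 / (1 + p)" using assms by (simp_all add: \<sigma>_def power_divide)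
  have "(\<integral>\<zeta>. exp (- (p * \<zeta>\<^sup>2 + 2 * b * \<zeta>) / 2) \<partial>std_normal_distribution)
      = (\<integral>\<zeta>. std_normal_density \<zeta> * exp (- (p * \<zeta>\<^sup>2 + 2 * b * \<zeta>) / 2) \<partial>lborel)"
    by (subst integral_real_density) auto
  also have "\<dots> = (\<integral>\<zeta>. \<sigma> * exp (b\<^sup>2 / (2 * (1 + p))) * normal_density \<mu> \<sigma> \<zeta> \<partial>lborel)"
  proof (rule Bochner_Integration.integral_cong[OF refl])
    fix \<zeta> :: real
    have "- \<zeta>\<^sup>2 / 2 + - (p * \<zeta>\<^sup>2 + 2 * b * \<zeta>) / 2 = b\<^sup>2 / (2 * (1 + p)) + - (\<zeta> - \<mu>)\<^sup>2 / (2 * \<sigma>\<^sup>2)"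
    proof -
      have "1 + p \<noteq> 0" using assms by simp
      then have "\<zeta> - \<mu> = ((1 + p) * \<zeta> + b) / (1 + p)" by (simp add: \<mu>_def field_simps)
      then have "- (\<zeta> - \<mu>)\<^sup>2 / (2 * \<sigma>\<^sup>2) = - ((1 + p) * \<zeta> + b)\<^sup>2 / (2 * (1 + p))"
        using \<open>1 + p \<noteq> 0\<close> unfolding \<sigma>(2) by (simp add: power2_eq_square)
      moreover have "((1 + p) * \<zeta> + b)\<^sup>2 = (1 + p) * (\<zeta>\<^sup>2 + (p * \<zeta>\<^sup>2 + 2 * b * \<zeta>)) + b\<^sup>2"
        by (simp add: power2_eq_square algebra_simps)
      moreover have "- (P * c + b\<^sup>2) / (2 * P) = - c / 2 - b\<^sup>2 / (2 * P)" if "P \<noteq> 0" for P c :: real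
        using that by (simp add: field_simps)
      note this[OF \<open>1 + p \<noteq> 0\<close>, of "\<zeta>\<^sup>2 + (p * \<zeta>\<^sup>2 + 2 * b * \<zeta>)"]
      ultimately have E: "- (\<zeta> - \<mu>)\<^sup>2 / (2 * \<sigma>\<^sup>2)
          = - (\<zeta>\<^sup>2 + (p * \<zeta>\<^sup>2 + 2 * b * \<zeta>)) / 2 - b\<^sup>2 / (2 * (1 + p))"
        by (simp only:)
      show ?thesis unfolding E by (simp add: add_divide_distrib diff_divide_distrib)
    qed
    then have E1: "exp (- \<zeta>\<^sup>2 / 2) * exp (- (p * \<zeta>\<^sup>2 + 2 * b * \<zeta>) / 2)
        = exp (b\<^sup>2 / (2 * (1 + p))) * exp (- (\<zeta> - \<mu>)\<^sup>2 / (2 * \<sigma>\<^sup>2))"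
      by (simp only: flip: exp_add)
    have E2: "\<sigma> * (1 / sqrt (2 * pi * \<sigma>\<^sup>2)) = 1 / sqrt (2 * pi)"
      using \<sigma>(1) by (simp add: real_sqrt_mult)
    have "std_normal_density \<zeta> * exp (- (p * \<zeta>\<^sup>2 + 2 * b * \<zeta>) / 2)
        = 1 / sqrt (2 * pi) * (exp (- \<zeta>\<^sup>2 / 2) * exp (- (p * \<zeta>\<^sup>2 + 2 * b * \<zeta>) / 2))"
      by (simp only: std_normal_density_def mult.assoc)
    also have "\<dots> = \<sigma> * (1 / sqrt (2 * pi * \<sigma>\<^sup>2)) * (exp (b\<^sup>2 / (2 * (1 + p))) * exp (- (\<zeta> - \<mu>)\<^sup>2 / (2 * \<sigma>\<^sup>2)))"
      by (simp only: E1 E2)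
    also have "\<dots> = \<sigma> * exp (b\<^sup>2 / (2 * (1 + p))) * normal_density \<mu> \<sigma> \<zeta>"
      by (simp only: normal_density_def mult_ac)
    finally show "std_normal_density \<zeta> * exp (- (p * \<zeta>\<^sup>2 + 2 * b * \<zeta>) / 2)
        = \<sigma> * exp (b\<^sup>2 / (2 * (1 + p))) * normal_density \<mu> \<sigma> \<zeta>" .
  qed
  also have "\<dots> = \<sigma> * exp (b\<^sup>2 / (2 * (1 + p)))"
    using integral_normal_density[OF \<sigma>(1)] by simp
  also have "\<sigma> = (1 + p) powr (- 1 / 2)"
    using assms by (simp add: \<sigma>_def powr_minus_divide powr_half_sqrt)
  finally show ?thesis .
qed

text \<open>Writing \<open>exp (-x\<^sup>2/2)\<close> as a characteristic function reduces the claim to linear combinations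
  of \<open>X\<close> and \<open>Z\<close>, whose laws are the only thing known about the pair.\<close>

lemma (in prob_space) gaussian_pair_quadratic_exp:
  assumes lin: "\<And>x z. gaussian_variable M (\<lambda>\<omega>. x * X \<omega> + z * Z \<omega>)"
    and sq: "square_integrable M X" "square_integrable M Z"
    and mean: "expectation X = 0" "expectation Z = 0"
    and mom: "(\<integral>\<omega>. X \<omega> * X \<omega> \<partial>M) = 1" "(\<integral>\<omega>. Z \<omega> * Z \<omega> \<partial>M) = 1" "(\<integral>\<omega>. X \<omega> * Z \<omega> \<partial>M) = r"
    and r: "\<bar>r\<bar> \<le> 1"
  shows "(\<integral>\<omega>. exp (- ((x * X \<omega>)\<^sup>2 + (z * Z \<omega>)\<^sup>2) / 2) \<partial>M)
    = ((1 + x\<^sup>2) * (1 + z\<^sup>2) - r\<^sup>2 * x\<^sup>2 * z\<^sup>2) powr (- 1 / 2)"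
proof -
  have [measurable]: "X \<in> borel_measurable M" "Z \<in> borel_measurable M"
    using sq by (auto simp: square_integrable_def)
  let ?N = "std_normal_distribution"
  interpret N: real_distribution ?N by (rule real_dist_normal_dist)
  interpret MN: pair_prob_space ?N M ..
  have int: "integrable M X" "integrable M Z"
    using sq by (auto simp: square_integrable_def intro!: square_integrable_imp_integrable)
  have char: "(CLINT \<xi>|?N. iexp (t * \<xi>)) = complex_of_real (exp (- t\<^sup>2 / 2))" for t
    using char_std_normal_distribution by (simp add: char_def fun_eq_iff)
  have prod: "(CLINT \<xi>|?N. CLINT \<zeta>|?N. iexp (s * \<xi> + t * \<zeta>))
      = complex_of_real (exp (- s\<^sup>2 / 2)) * complex_of_real (exp (- t\<^sup>2 / 2))" for s t
  proof -
    have "iexp (s * \<xi> + t * \<zeta>) = iexp (s * \<xi>) * iexp (t * \<zeta>)" for \<xi> \<zeta>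
      by (simp add: exp_add distrib_left)
    then show ?thesis by (simp only: integral_mult_right_zero integral_mult_left_zero char)
  qed
  have inner: "(CLINT \<omega>|M. iexp (x * X \<omega> * \<xi> + z * Z \<omega> * \<zeta>))
      = complex_of_real (exp (- (z\<^sup>2 * \<zeta>\<^sup>2 + 2 * (x * z * r * \<xi>) * \<zeta>) / 2) * exp (- x\<^sup>2 * \<xi>\<^sup>2 / 2))" for \<xi> \<zeta>
  proof -
    let ?V = "\<lambda>\<omega>. (x * \<xi>) * X \<omega> + (z * \<zeta>) * Z \<omega>"
    have "expectation ?V = 0" using int mean by simp
    from gaussian_variable_iexp[OF lin this]
    have "(CLINT \<omega>|M. iexp (?V \<omega>)) = exp (- (\<integral>\<omega>. (?V \<omega>)\<^sup>2 \<partial>M) / 2)" .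
    also have "(\<integral>\<omega>. (?V \<omega>)\<^sup>2 \<partial>M) = (\<integral>\<omega>. (x * \<xi>)\<^sup>2 * (X \<omega> * X \<omega>) + (z * \<zeta>)\<^sup>2 * (Z \<omega> * Z \<omega>)
        + 2 * (x * \<xi>) * (z * \<zeta>) * (X \<omega> * Z \<omega>) \<partial>M)"
      by (intro Bochner_Integration.integral_cong refl) (simp add: power2_eq_square algebra_simps)
    also have "\<dots> = (x * \<xi>)\<^sup>2 + (z * \<zeta>)\<^sup>2 + 2 * (x * \<xi>) * (z * \<zeta>) * r"
      using integrable_mult_square_integrable[OF sq(1) sq(1)] integrable_mult_square_integrable[OF sq(2) sq(2)]
        integrable_mult_square_integrable[OF sq(1) sq(2)] by (simp add: mom)
    also have "exp (- ((x * \<xi>)\<^sup>2 + (z * \<zeta>)\<^sup>2 + 2 * (x * \<xi>) * (z * \<zeta>) * r) / 2)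
        = exp (- (z\<^sup>2 * \<zeta>\<^sup>2 + 2 * (x * z * r * \<xi>) * \<zeta>) / 2) * exp (- x\<^sup>2 * \<xi>\<^sup>2 / 2)"
    proof -
      have "- ((x * \<xi>)\<^sup>2 + (z * \<zeta>)\<^sup>2 + 2 * (x * \<xi>) * (z * \<zeta>) * r) / 2
          = - (z\<^sup>2 * \<zeta>\<^sup>2 + 2 * (x * z * r * \<xi>) * \<zeta>) / 2 + - x\<^sup>2 * \<xi>\<^sup>2 / 2"
        by (simp add: power2_eq_square field_simps)
      then show ?thesis by (simp only: exp_add)
    qed
    finally show ?thesis by (simp only: mult_ac)
  qed
  have "complex_of_real (\<integral>\<omega>. exp (- ((x * X \<omega>)\<^sup>2 + (z * Z \<omega>)\<^sup>2) / 2) \<partial>M)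
      = (CLINT \<omega>|M. complex_of_real (exp (- (x * X \<omega>)\<^sup>2 / 2)) * complex_of_real (exp (- (z * Z \<omega>)\<^sup>2 / 2)))"
    unfolding integral_complex_of_real[symmetric]
    by (intro Bochner_Integration.integral_cong refl)
       (simp add: add_divide_distrib diff_divide_distrib flip: exp_add of_real_mult)
  \<comment> \<open>Each of the two squares receives its own auxiliary standard normal variable. The
    integrands have modulus at most 1, so Fubini applies on the probability spaces.\<close>
  also have "\<dots> = (CLINT \<omega>|M. CLINT \<xi>|?N. CLINT \<zeta>|?N. iexp (x * X \<omega> * \<xi> + z * Z \<omega> * \<zeta>))"
    by (simp only: prod)
  also have "\<dots> = (CLINT \<xi>|?N. CLINT \<omega>|M. CLINT \<zeta>|?N. iexp (x * X \<omega> * \<xi> + z * Z \<omega> * \<zeta>))"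
  proof (rule MN.Fubini_integral, rule MN.P.integrable_const_bound[where B = 1])
    show "AE p in ?N \<Otimes>\<^sub>M M. norm (case p of (\<xi>, \<omega>) \<Rightarrow> CLINT \<zeta>|?N. iexp (x * X \<omega> * \<xi> + z * Z \<omega> * \<zeta>)) \<le> 1"
    proof (intro AE_I2, clarify)
      fix \<xi> \<omega>
      have "norm (CLINT \<zeta>|?N. iexp (x * X \<omega> * \<xi> + z * Z \<omega> * \<zeta>)) \<le> (\<integral>\<zeta>. norm (iexp (x * X \<omega> * \<xi> + z * Z \<omega> * \<zeta>)) \<partial>?N)"
        by (rule integral_norm_bound)
      then show "norm (CLINT \<zeta>|?N. iexp (x * X \<omega> * \<xi> + z * Z \<omega> * \<zeta>)) \<le> 1"
        using N.prob_space by simp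
    qed
  qed measurable
  also have "\<dots> = (CLINT \<xi>|?N. CLINT \<zeta>|?N. CLINT \<omega>|M. iexp (x * X \<omega> * \<xi> + z * Z \<omega> * \<zeta>))"
    by (intro Bochner_Integration.integral_cong refl MN.Fubini_integral
        MN.P.integrable_const_bound[where B = 1]) auto
  also have "\<dots> = complex_of_real (\<integral>\<xi>. (\<integral>\<zeta>. exp (- (z\<^sup>2 * \<zeta>\<^sup>2 + 2 * (x * z * r * \<xi>) * \<zeta>) / 2) \<partial>?N) * exp (- x\<^sup>2 * \<xi>\<^sup>2 / 2) \<partial>?N)"
    unfolding inner by (simp del: of_real_mult)
  also have "(\<integral>\<xi>. (\<integral>\<zeta>. exp (- (z\<^sup>2 * \<zeta>\<^sup>2 + 2 * (x * z * r * \<xi>) * \<zeta>) / 2) \<partial>?N) * exp (- x\<^sup>2 * \<xi>\<^sup>2 / 2) \<partial>?N)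
      = ((1 + x\<^sup>2) * (1 + z\<^sup>2) - r\<^sup>2 * x\<^sup>2 * z\<^sup>2) powr (- 1 / 2)"
  proof -
    \<comment> \<open>\<open>p\<close> is the coefficient of the square in \<open>\<xi>\<close> left
      over after integrating out \<open>\<zeta>\<close>; it is nonnegative because
      \<open>r\<^sup>2 \<le> 1\<close>.\<close>
    define p where "p = x\<^sup>2 - (x * z * r)\<^sup>2 / (1 + z\<^sup>2)"
    have z1: "0 < 1 + z\<^sup>2" by (simp add: add_pos_nonneg)
    have "z\<^sup>2 * r\<^sup>2 \<le> (1 + z\<^sup>2) * 1"
      using r by (intro mult_mono) (auto simp: abs_square_le_1)
    then have "x\<^sup>2 * (z\<^sup>2 * r\<^sup>2) \<le> x\<^sup>2 * (1 + z\<^sup>2)" by (intro mult_left_mono) auto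
    then have p: "0 \<le> p" using z1 by (simp add: p_def power_mult_distrib field_simps)
    have "(\<integral>\<xi>. (\<integral>\<zeta>. exp (- (z\<^sup>2 * \<zeta>\<^sup>2 + 2 * (x * z * r * \<xi>) * \<zeta>) / 2) \<partial>?N) * exp (- x\<^sup>2 * \<xi>\<^sup>2 / 2) \<partial>?N)
        = (\<integral>\<xi>. (1 + z\<^sup>2) powr (- 1 / 2) * exp (- (p * \<xi>\<^sup>2 + 2 * 0 * \<xi>) / 2) \<partial>?N)"
    proof (rule Bochner_Integration.integral_cong[OF refl])
      fix \<xi>
      have "(x * z * r * \<xi>)\<^sup>2 / (2 * (1 + z\<^sup>2)) + - x\<^sup>2 * \<xi>\<^sup>2 / 2 = - (p * \<xi>\<^sup>2 + 2 * 0 * \<xi>) / 2"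
        using z1 by (simp add: p_def power_mult_distrib field_simps)
      then have "exp ((x * z * r * \<xi>)\<^sup>2 / (2 * (1 + z\<^sup>2))) * exp (- x\<^sup>2 * \<xi>\<^sup>2 / 2) = exp (- (p * \<xi>\<^sup>2 + 2 * 0 * \<xi>) / 2)"
        by (simp only: flip: exp_add)
      then show "(\<integral>\<zeta>. exp (- (z\<^sup>2 * \<zeta>\<^sup>2 + 2 * (x * z * r * \<xi>) * \<zeta>) / 2) \<partial>?N) * exp (- x\<^sup>2 * \<xi>\<^sup>2 / 2)
          = (1 + z\<^sup>2) powr (- 1 / 2) * exp (- (p * \<xi>\<^sup>2 + 2 * 0 * \<xi>) / 2)"
        unfolding std_normal_gaussian_integral[OF zero_le_power2] by (simp only: mult.assoc)
    qed
    also have "\<dots> = (1 + z\<^sup>2) powr (- 1 / 2) * (1 + p) powr (- 1 / 2)"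
      using std_normal_gaussian_integral[OF p, of 0] by simp
    also have "\<dots> = ((1 + z\<^sup>2) * (1 + p)) powr (- 1 / 2)"
      using p z1 by (simp add: powr_mult)
    also have "(1 + z\<^sup>2) * (1 + p) = (1 + x\<^sup>2) * (1 + z\<^sup>2) - r\<^sup>2 * x\<^sup>2 * z\<^sup>2"
      using z1 by (simp add: p_def power_mult_distrib field_simps)
    finally show ?thesis .
  qed
  finally show ?thesis by (simp only: of_real_eq_iff)
qed

lemma (in prob_space) standard_gaussian_process_moments:
  assumes "standard_gaussian_process M A \<rho> G" "s \<in> A" "t \<in> A"
  shows "square_integrable M (G s)" "expectation (G s) = 0"
    and "(\<integral>\<omega>. G s \<omega> * G t \<omega> \<partial>M) = \<rho> (s - t)" "\<rho> 0 = 1" "\<bar>\<rho> (s - t)\<bar> \<le> 1"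
proof -
  have ws: "weakly_stationary M A G"
    and one: "\<forall>s\<in>A. expectation (G s) = 0 \<and> covariance M (G s) (G s) = 1"
    and corr: "\<forall>s\<in>A. \<forall>t\<in>A. correlation M (G s) (G t) = \<rho> (s - t)"
    using assms(1) unfolding standard_gaussian_process_def by blast+
  have so: "\<forall>s\<in>A. square_integrable M (G s)"
    using ws unfolding weakly_stationary_def second_order_iff by blast
  show sq: "square_integrable M (G s)" and mean: "expectation (G s) = 0"
    using so one assms(2) by blast+
  have sq': "square_integrable M (G t)" and mean': "expectation (G t) = 0"
    using so one assms(3) by blast+
  have cov: "covariance M (G s) (G s) = 1" "covariance M (G t) (G t) = 1"
    using one assms(2,3) by blast+
  have corr: "correlation M (G s) (G t) = \<rho> (s - t)" "correlation M (G s) (G s) = \<rho> (s - s)"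
    using corr assms(2,3) by blast+
  show eq: "(\<integral>\<omega>. G s \<omega> * G t \<omega> \<partial>M) = \<rho> (s - t)"
    using corr(1) unfolding correlation_def cov
    by (simp add: covariance_def mean mean')
  show "\<rho> 0 = 1"
    using corr(2) unfolding correlation_def cov by simp
  have "(\<integral>\<omega>. (G s \<omega>)\<^sup>2 \<partial>M) = 1" "(\<integral>\<omega>. (G t \<omega>)\<^sup>2 \<partial>M) = 1"
    using cov mean mean' by (simp_all add: covariance_def power2_eq_square)
  with Cauchy_Schwarz_integral[OF sq sq'] show "\<bar>\<rho> (s - t)\<bar> \<le> 1" by (simp add: eq)
qed

text \<open>The linear combinations in \<open>gaussian_process\<close> range over a set of points,
  so for \<open>s = t\<close> the two coefficients have to be merged into one.\<close>

lemma gaussian_process_pair: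
  assumes "gaussian_process M A G" "s \<in> A" "t \<in> A"
  shows "gaussian_variable M (\<lambda>\<omega>. x * G s \<omega> + y * G t \<omega>)"
proof (cases "s = t")
  case True
  from assms(1)[unfolded gaussian_process_def, rule_format, of "{s}" "\<lambda>_. x + y"]
  show ?thesis using True assms by (simp add: distrib_right)
next
  case False
  from assms(1)[unfolded gaussian_process_def, rule_format, of "{s, t}" "\<lambda>u. if u = s then x else y"]
  show ?thesis using False assms by simp
qed

text \<open>The scaling is that of one summand of the chi-square mixing process: for
  \<open>a = n/2\<close> the exponent is
  \<open>- (\<theta> G(s)^2 + \<eta> G(t)^2) / n\<close>.\<close>

lemma (in prob_space) standard_gaussian_process_laplace:
  assumes "standard_gaussian_process M A \<rho> G" "s \<in> A" "t \<in> A" "0 < a" "0 \<le> \<theta>" "0 \<le> \<eta>"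
  shows "(\<integral>\<^sup>+\<omega>. ennreal (exp (- (\<theta> / a * (G s \<omega>)\<^sup>2 + \<eta> / a * (G t \<omega>)\<^sup>2) / 2)) \<partial>M)
    = ennreal (((1 + \<theta> / a) * (1 + \<eta> / a) - (\<rho> (s - t))\<^sup>2 * (\<theta> / a) * (\<eta> / a)) powr (- 1 / 2))"
proof -
  note m = standard_gaussian_process_moments[OF assms(1)]
  have [measurable]: "G s \<in> borel_measurable M" "G t \<in> borel_measurable M"
    using m(1)[OF assms(2,3)] m(1)[OF assms(3,2)] by (auto simp: square_integrable_def)
  have "(\<integral>\<omega>. exp (- ((sqrt (\<theta> / a) * G s \<omega>)\<^sup>2 + (sqrt (\<eta> / a) * G t \<omega>)\<^sup>2) / 2) \<partial>M)
      = ((1 + (sqrt (\<theta> / a))\<^sup>2) * (1 + (sqrt (\<eta> / a))\<^sup>2)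
        - (\<rho> (s - t))\<^sup>2 * (sqrt (\<theta> / a))\<^sup>2 * (sqrt (\<eta> / a))\<^sup>2) powr (- 1 / 2)"
  proof (rule gaussian_pair_quadratic_exp)
    show "gaussian_variable M (\<lambda>\<omega>. x * G s \<omega> + z * G t \<omega>)" for x z
      using assms(1-3) unfolding standard_gaussian_process_def by (intro gaussian_process_pair) blast+
    show "(\<integral>\<omega>. G s \<omega> * G s \<omega> \<partial>M) = 1" "(\<integral>\<omega>. G t \<omega> * G t \<omega> \<partial>M) = 1"
      using m(3,4)[OF assms(2,2)] m(3)[OF assms(3,3)] by simp_all
  qed (use m[OF assms(2,3)] m[OF assms(3,2)] in simp_all)
  then have "(\<integral>\<omega>. exp (- (\<theta> / a * (G s \<omega>)\<^sup>2 + \<eta> / a * (G t \<omega>)\<^sup>2) / 2) \<partial>M)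
      = ((1 + \<theta> / a) * (1 + \<eta> / a) - (\<rho> (s - t))\<^sup>2 * (\<theta> / a) * (\<eta> / a)) powr (- 1 / 2)"
    using assms(4-) by (simp add: power_mult_distrib)
  moreover have "integrable M (\<lambda>\<omega>. exp (- (\<theta> / a * (G s \<omega>)\<^sup>2 + \<eta> / a * (G t \<omega>)\<^sup>2) / 2))"
  proof (intro integrable_const_bound[where B = 1] AE_I2)
    fix \<omega>
    have "0 \<le> \<theta> / a * (G s \<omega>)\<^sup>2 + \<eta> / a * (G t \<omega>)\<^sup>2"
      using assms(4-) by (intro add_nonneg_nonneg mult_nonneg_nonneg) auto
    then show "norm (exp (- (\<theta> / a * (G s \<omega>)\<^sup>2 + \<eta> / a * (G t \<omega>)\<^sup>2) / 2)) \<le> 1"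
      by simp
  qed measurable
  ultimately show ?thesis
    by (simp add: nn_integral_eq_integral)
qed

lemma (in prob_space) indep_var_cong:
  assumes "indep_var S X T Y"
    and "\<And>\<omega>. \<omega> \<in> space M \<Longrightarrow> X \<omega> = X' \<omega>" "\<And>\<omega>. \<omega> \<in> space M \<Longrightarrow> Y \<omega> = Y' \<omega>"
  shows "indep_var S X' T Y'"
proof -
  have "distr M S X' = distr M S X" "distr M T Y' = distr M T Y"
    "distr M (S \<Otimes>\<^sub>M T) (\<lambda>x. (X' x, Y' x)) = distr M (S \<Otimes>\<^sub>M T) (\<lambda>x. (X x, Y x))"
    using assms(2,3) by (auto intro!: distr_cong)
  moreover have "X' \<in> measurable M S \<longleftrightarrow> X \<in> measurable M S" "Y' \<in> measurable M T \<longleftrightarrow> Y \<in> measurable M T"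
    using assms(2,3) by (auto intro!: measurable_cong)
  ultimately show ?thesis using assms(1) by (simp add: indep_var_distribution_eq)
qed

text \<open>What the integer and the non-integer mixing process have in common, and all that the
  second-order theory of the \<open>t\<close> process uses.\<close>

definition mixing_pair ::
  "'w measure \<Rightarrow> real \<Rightarrow> real \<Rightarrow> ('w \<Rightarrow> real \<times> real) \<Rightarrow> ('w \<Rightarrow> real) \<Rightarrow> ('w \<Rightarrow> real) \<Rightarrow> bool" where
  "mixing_pair M a q X U V \<longleftrightarrow>
     U \<in> borel_measurable M \<and> V \<in> borel_measurable M \<and>
     (AE \<omega> in M. 0 < U \<omega>) \<and> (AE \<omega> in M. 0 < V \<omega>) \<and>
     prob_space.indep_var M (borel \<Otimes>\<^sub>M borel) X (borel \<Otimes>\<^sub>M borel) (\<lambda>\<omega>. (U \<omega>, V \<omega>)) \<and>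
     (\<forall>\<theta> \<eta>. 0 < \<theta> \<longrightarrow> 0 < \<eta> \<longrightarrow>
       (\<integral>\<^sup>+\<omega>. ennreal (exp (- (\<theta> * U \<omega> + \<eta> * V \<omega>))) \<partial>M) = ennreal (gamma_laplace a q \<theta> \<eta>))"

section \<open>Mixing by sums of squared Gaussian copies\<close>

lemma gamma_laplace_1: "gamma_laplace a (1\<^sup>2) \<theta> \<eta> = (1 + (\<theta> + \<eta>) / a) powr (- a)"
  by (simp add: gamma_laplace_def algebra_simps add_divide_distrib)

text \<open>The integrand is 1 wherever \<open>U\<close> vanishes, so the transform bounds the mass
  of that set for every \<open>\<theta>\<close>. Positivity of the chi-square process follows
  without computing its density.\<close>

lemma (in prob_space) AE_pos_if_laplace_vanishes:
  assumes [measurable]: "U \<in> borel_measurable M" and nonneg: "AE \<omega> in M. 0 \<le> U \<omega>"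
    and le: "\<And>\<theta>. 0 < \<theta> \<Longrightarrow> (\<integral>\<^sup>+\<omega>. ennreal (exp (- (\<theta> * U \<omega>))) \<partial>M) \<le> ennreal (L \<theta>)"
    and lim: "(L \<longlongrightarrow> 0) at_top"
  shows "AE \<omega> in M. 0 < U \<omega>"
proof -
  have le0: "emeasure M {\<omega> \<in> space M. U \<omega> = 0} \<le> ennreal (L \<theta>)" if "0 < \<theta>" for \<theta>
  proof -
    have "emeasure M {\<omega> \<in> space M. U \<omega> = 0} = (\<integral>\<^sup>+\<omega>. indicator {\<omega> \<in> space M. U \<omega> = 0} \<omega> \<partial>M)" by simp
    also have "\<dots> \<le> (\<integral>\<^sup>+\<omega>. ennreal (exp (- (\<theta> * U \<omega>))) \<partial>M)"
      by (intro nn_integral_mono) (auto simp: indicator_def)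
    finally show ?thesis using le[OF that] by (rule order.trans)
  qed
  have ev: "\<forall>\<^sub>F \<theta> in at_top. emeasure M {\<omega> \<in> space M. U \<omega> = 0} \<le> ennreal (L \<theta>)"
    using eventually_gt_at_top[of 0] by (rule eventually_mono) (rule le0)
  have "((\<lambda>\<theta>. ennreal (L \<theta>)) \<longlongrightarrow> ennreal 0) at_top" using lim by (intro tendsto_intros)
  from tendsto_lowerbound[OF this ev] have "emeasure M {\<omega> \<in> space M. U \<omega> = 0} = 0" by simp
  then have "AE \<omega> in M. U \<omega> \<noteq> 0" by (intro AE_I[where N = "{\<omega> \<in> space M. U \<omega> = 0}"]) auto
  with nonneg show ?thesis by eventually_elim auto
qed

text \<open>The exponential factorises over \<open>n\<close> independent copies with equal laws.
  Each contributes the power \<open>- 1/2\<close> of the same base, and together they give the power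
  \<open>- n/2\<close>.\<close>

lemma (in prob_space) chi_square_mixing_pair:
  assumes G: "standard_gaussian_process M A \<rho> G" and W: "chi_square_mixing M A n G W" and n: "0 < n"
    and s: "s \<in> A" and t: "t \<in> A"
  shows "mixing_pair M (real n / 2) ((\<rho> (s - t))\<^sup>2) (\<lambda>\<omega>. (G s \<omega>, G t \<omega>)) (W s) (W t)"
proof -
  obtain H where H0: "H 0 = G"
    and ind: "indep_vars (\<lambda>_. path_space A) (\<lambda>i. path A (H i)) {0..n}"
    and dist: "\<And>i. i \<in> {1..n} \<Longrightarrow> distr M (path_space A) (path A (H i)) = distr M (path_space A) (path A G)"
    and Weq: "\<And>s \<omega>. s \<in> A \<Longrightarrow> \<omega> \<in> space M \<Longrightarrow> W s \<omega> = 1 / real n * (\<Sum>i=1..n. (H i s \<omega>)\<^sup>2)"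
    using W unfolding chi_square_mixing_def by blast
  have path: "path A (H i) \<in> measurable M (path_space A)" if "i \<in> {0..n}" for i
    using ind that by (auto simp: indep_vars_def)
  have pathG: "path A G \<in> measurable M (path_space A)" using path[of 0] H0 by simp
  have comp[measurable]: "(\<lambda>p. p u) \<in> borel_measurable (path_space A)" if "u \<in> A" for u
    using that by (rule measurable_component_singleton)
  have Hm: "H i u \<in> borel_measurable M" if "i \<in> {0..n}" "u \<in> A" for i u
    using measurable_compose[OF path[OF that(1)] comp[OF that(2)]] that(2) by (simp add: path_def)
  have Wm: "W u \<in> borel_measurable M" if "u \<in> A" for u
  proof (subst measurable_cong[OF Weq[OF that]])
    show "(\<lambda>\<omega>. 1 / real n * (\<Sum>i=1..n. (H i u \<omega>)\<^sup>2)) \<in> borel_measurable M"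
      using Hm[OF _ that] by (intro borel_measurable_times borel_measurable_sum borel_measurable_power) auto
  qed
  have laplace: "(\<integral>\<^sup>+\<omega>. ennreal (exp (- (\<theta> * W u \<omega> + \<eta> * W v \<omega>))) \<partial>M)
      = ennreal (gamma_laplace (real n / 2) ((\<rho> (u - v))\<^sup>2) \<theta> \<eta>)"
    if "0 < \<theta>" "0 < \<eta>" and [measurable]: "u \<in> A" "v \<in> A" for \<theta> \<eta> u v
  proof -
    define a where "a = real n / 2"
    have a: "0 < a" using n by (simp add: a_def)
    define b where "b = (1 + \<theta> / a) * (1 + \<eta> / a) - (\<rho> (u - v))\<^sup>2 * (\<theta> / a) * (\<eta> / a)"
    define f where "f p = exp (- (\<theta> / a * (p u)\<^sup>2 + \<eta> / a * (p v)\<^sup>2) / 2)" for p :: "'b \<Rightarrow> real"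
    have f[measurable]: "f \<in> borel_measurable (path_space A)" unfolding f_def by measurable
    have "(\<integral>\<^sup>+\<omega>. ennreal (exp (- (\<theta> * W u \<omega> + \<eta> * W v \<omega>))) \<partial>M)
        = (\<integral>\<^sup>+\<omega>. (\<Prod>i\<in>{1..n}. ennreal (f (path A (H i) \<omega>))) \<partial>M)"
    proof (rule nn_integral_cong)
      fix \<omega> assume \<omega>: "\<omega> \<in> space M"
      have "- (\<theta> * W u \<omega> + \<eta> * W v \<omega>)
          = (\<Sum>i=1..n. - (\<theta> / a * (H i u \<omega>)\<^sup>2 + \<eta> / a * (H i v \<omega>)\<^sup>2) / 2)"
        using n that(3,4) \<omega>
        by (simp add: Weq a_def sum_distrib_left sum.distrib sum_negf sum_divide_distrib add_divide_distrib
            diff_divide_distrib sum_subtractf)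
      then have "exp (- (\<theta> * W u \<omega> + \<eta> * W v \<omega>)) = (\<Prod>i\<in>{1..n}. f (path A (H i) \<omega>))"
        using that(3,4) by (simp add: f_def path_def exp_sum)
      then show "ennreal (exp (- (\<theta> * W u \<omega> + \<eta> * W v \<omega>))) = (\<Prod>i\<in>{1..n}. ennreal (f (path A (H i) \<omega>)))"
        by (simp add: prod_ennreal f_def)
    qed
    also have "\<dots> = (\<Prod>i\<in>{1..n}. \<integral>\<^sup>+\<omega>. ennreal (f (path A (H i) \<omega>)) \<partial>M)"
    proof (rule indep_vars_nn_integral)
      have "indep_vars (\<lambda>_. path_space A) (\<lambda>i. path A (H i)) {1..n}"
        using ind by (rule indep_vars_subset) auto
      from indep_vars_compose2[OF this, of "\<lambda>_ p. ennreal (f p)" "\<lambda>_. borel"]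
      show "indep_vars (\<lambda>_. borel) (\<lambda>i \<omega>. ennreal (f (path A (H i) \<omega>))) {1..n}" by simp
    qed auto
    also have "\<dots> = (\<Prod>i\<in>{1..n}. ennreal (b powr (- 1 / 2)))"
    proof (rule prod.cong[OF refl])
      fix i assume i: "i \<in> {1..n}"
      have "(\<integral>\<^sup>+\<omega>. ennreal (f (path A (H i) \<omega>)) \<partial>M) = (\<integral>\<^sup>+p. ennreal (f p) \<partial>distr M (path_space A) (path A (H i)))"
        using path[of i] i by (subst nn_integral_distr) auto
      also have "\<dots> = (\<integral>\<^sup>+\<omega>. ennreal (f (path A G \<omega>)) \<partial>M)"
        using pathG unfolding dist[OF i] by (subst nn_integral_distr) auto
      also have "\<dots> = ennreal (b powr (- 1 / 2))"
        using standard_gaussian_process_laplace[OF G that(3,4) a, of \<theta> \<eta>] that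
        by (simp add: f_def path_def b_def)
      finally show "(\<integral>\<^sup>+\<omega>. ennreal (f (path A (H i) \<omega>)) \<partial>M) = ennreal (b powr (- 1 / 2))" .
    qed
    also have "\<dots> = ennreal ((b powr (- 1 / 2)) ^ n)" by (simp add: ennreal_power)
    \<comment> \<open>At base 0 both sides are 0, since \<open>powr\<close> has the value 0 there
      and \<open>n\<close> is positive.\<close>
    also have "(b powr (- 1 / 2)) ^ n = b powr (- a)"
      using n by (cases "b = 0") (simp_all add: powr_power a_def)
    finally show ?thesis by (simp add: gamma_laplace_def b_def a_def)
  qed
  have pos: "AE \<omega> in M. 0 < W u \<omega>" if "u \<in> A" for u
  proof (rule AE_pos_if_laplace_vanishes[OF Wm[OF that]])
    show "AE \<omega> in M. 0 \<le> W u \<omega>"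
      using that by (intro AE_I2) (auto simp: Weq intro!: divide_nonneg_nonneg sum_nonneg)
    show "(\<integral>\<^sup>+\<omega>. ennreal (exp (- (\<theta> * W u \<omega>))) \<partial>M) \<le> ennreal ((1 + \<theta> / (real n / 2)) powr (- (real n / 2)))"
      if \<theta>: "0 < \<theta>" for \<theta>
    proof -
      \<comment> \<open>The transform of a single variable is the joint one at the pair
        \<open>u\<close>, \<open>u\<close> with its argument split into halves; the squared
        correlation there is 1.\<close>
      have "\<rho> (u - u) = 1"
        using standard_gaussian_process_moments(4)[OF G \<open>u \<in> A\<close> \<open>u \<in> A\<close>] by simp
      moreover have "\<theta> / 2 * w + \<theta> / 2 * w = \<theta> * w" for w by simp
      ultimately show ?thesis
        using laplace[of "\<theta> / 2" "\<theta> / 2" u u] \<open>u \<in> A\<close> \<theta> by (simp only: gamma_laplace_1) simp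
    qed
    show "((\<lambda>\<theta>. (1 + \<theta> / (real n / 2)) powr (- (real n / 2))) \<longlongrightarrow> 0) at_top"
      using n by real_asymp
  qed
  have indep: "indep_var (borel \<Otimes>\<^sub>M borel) (\<lambda>\<omega>. (G s \<omega>, G t \<omega>)) (borel \<Otimes>\<^sub>M borel) (\<lambda>\<omega>. (W s \<omega>, W t \<omega>))"
  proof -
    \<comment> \<open>The index set is split into the parent at 0 and the copies at
      \<open>1..n\<close>; the mixing variables are functions of the second block.\<close>
    let ?P = "\<lambda>I. PiM I (\<lambda>_. path_space A)"
    have 1: "indep_var (?P {0}) (\<lambda>\<omega>. restrict (\<lambda>i. path A (H i) \<omega>) {0}) (?P {1..n}) (\<lambda>\<omega>. restrict (\<lambda>i. path A (H i) \<omega>) {1..n})"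
      using ind by (rule indep_var_restrict) auto
    have c: "(\<lambda>p. p i u) \<in> borel_measurable (?P I)" if "i \<in> I" "u \<in> A" for i u and I :: "nat set"
      using measurable_compose[OF measurable_component_singleton[OF that(1)] comp[OF that(2)]] by simp
    let ?w = "\<lambda>u p. 1 / real n * (\<Sum>i=1..n. (p i u)\<^sup>2) :: real"
    have m1: "(\<lambda>p. (p 0 s, p 0 t)) \<in> measurable (?P {0}) (borel \<Otimes>\<^sub>M borel)"
      using c[of 0 "{0}"] s t by (intro measurable_Pair) auto
    have m2: "(\<lambda>p. (?w s p, ?w t p)) \<in> measurable (?P {1..n}) (borel \<Otimes>\<^sub>M borel)"
      using c[of _ "{1..n}"] s t
      by (intro measurable_Pair borel_measurable_times borel_measurable_sum borel_measurable_power) auto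
    show ?thesis
      by (rule indep_var_cong[OF indep_var_compose[OF 1 m1 m2]])
         (use s t in \<open>auto simp: path_def H0 Weq\<close>)
  qed
  show ?thesis
    unfolding mixing_pair_def using Wm pos s t indep laplace by blast
qed

section \<open>Mixing processes specified by bivariate Gamma laws\<close>

lemma gamma_density_eq_kernel: "gamma_density a l x = l powr a / Gamma a * gamma_kernel a l x"
  by (simp add: gamma_density_def gamma_kernel_def)

text \<open>Exponential tilting of a Gamma density only shifts its rate from \<open>l\<close> to
  \<open>l + \<theta>\<close>.\<close>

lemma nn_integral_gamma_density_exp:
  assumes "0 < b" "0 < l" "0 \<le> \<theta>"
  shows "(\<integral>\<^sup>+x. ennreal (l powr b / Gamma b * gamma_kernel b l x) * ennreal (exp (- (\<theta> * x))) \<partial>lborel)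
    = ennreal ((1 + \<theta> / l) powr (- b))"
proof -
  have pos: "0 \<le> l powr b / Gamma b" "Gamma b \<noteq> 0"
    using assms Gamma_real_pos[OF assms(1), THEN less_imp_neq, THEN not_sym]
    by (auto intro!: divide_nonneg_nonneg)
  have "(\<integral>\<^sup>+x. ennreal (l powr b / Gamma b * gamma_kernel b l x) * ennreal (exp (- (\<theta> * x))) \<partial>lborel)
      = (\<integral>\<^sup>+x. ennreal (l powr b / Gamma b) * ennreal (gamma_kernel b (l + \<theta>) x) \<partial>lborel)"
  proof (rule nn_integral_cong)
    fix x
    have "exp (- (l + \<theta>) * x) = exp (- l * x) * exp (- (\<theta> * x))"
      by (simp add: algebra_simps flip: exp_add)
    then have "l powr b / Gamma b * gamma_kernel b l x * exp (- (\<theta> * x))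
        = l powr b / Gamma b * gamma_kernel b (l + \<theta>) x"
      by (simp add: gamma_kernel_def mult_ac)
    then show "ennreal (l powr b / Gamma b * gamma_kernel b l x) * ennreal (exp (- (\<theta> * x)))
        = ennreal (l powr b / Gamma b) * ennreal (gamma_kernel b (l + \<theta>) x)"
      by (metis ennreal_mult'' exp_ge_zero gamma_kernel_nonneg)
  qed
  also have "\<dots> = ennreal (l powr b / Gamma b) * ennreal (Gamma b * (l + \<theta>) powr (- b))"
    using assms by (subst nn_integral_cmult) (auto simp: nn_integral_gamma_kernel)
  also have "\<dots> = ennreal (l powr b / Gamma b * (Gamma b * (l + \<theta>) powr (- b)))"
    using pos assms by (simp flip: ennreal_mult)
  also have "l powr b / Gamma b * (Gamma b * (l + \<theta>) powr (- b)) = l powr b * (l + \<theta>) powr (- b)"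
    using pos by simp
  also have "l + \<theta> = l * (1 + \<theta> / l)" using assms by (simp add: field_simps)
  also have "l powr b * (l * (1 + \<theta> / l)) powr (- b) = (1 + \<theta> / l) powr (- b)"
    using assms by (simp add: powr_mult powr_minus)
  finally show ?thesis .
qed

lemma pochhammer_ge_1:
  fixes a :: real
  assumes "1 \<le> a"
  shows "1 \<le> pochhammer a k"
proof (induction k)
  case (Suc k)
  have "1 * 1 \<le> pochhammer a k * (a + real k)"
    using Suc assms by (intro mult_mono) auto
  then show ?case by (simp add: pochhammer_Suc)
qed simp

lemma hypergeom_0F1_sums:
  assumes "1 \<le> a" "0 \<le> x"
  shows "(\<lambda>k. x ^ k / (fact k * pochhammer a k)) sums hypergeom_0F1 a x"
  unfolding hypergeom_0F1_def
proof (rule summable_sums, rule summable_comparison_test')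
  show "summable (\<lambda>k. x ^ k / fact k)"
    using summable_exp[of x] by (simp add: field_simps)
  show "norm (x ^ k / (fact k * pochhammer a k)) \<le> x ^ k / fact k" if "k \<ge> 0" for k
  proof -
    have p: "1 \<le> pochhammer a k" using assms(1) by (rule pochhammer_ge_1)
    then have "fact k * 1 \<le> (fact k * pochhammer a k :: real)" by (intro mult_left_mono) auto
    then have "x ^ k / (fact k * pochhammer a k) \<le> x ^ k / fact k"
      using assms p by (intro divide_left_mono mult_pos_pos) auto
    then show ?thesis using assms p by simp
  qed
qed

text \<open>The bivariate Gamma law is a negative binomial mixture of products of Gamma laws.\<close>

lemma bivariate_gamma_density_suminf:
  fixes \<nu> r :: real
  assumes \<nu>: "2 < \<nu>" and r: "\<bar>r\<bar> < 1"
  defines "a \<equiv> \<nu> / 2" and "l \<equiv> \<nu> / 2 / (1 - r\<^sup>2)"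
  defines "\<gamma> \<equiv> \<lambda>k x. l powr (a + real k) / Gamma (a + real k) * gamma_kernel (a + real k) l x"
  shows "(\<Sum>k. ennreal (pochhammer a k / fact k * (1 - r\<^sup>2) powr a * (r\<^sup>2) ^ k) * (ennreal (\<gamma> k x) * ennreal (\<gamma> k y)))
    = ennreal (bivariate_gamma_density \<nu> r (x, y))"
proof (cases "0 < x \<and> 0 < y")
  case True
  have a: "1 < a" using \<nu> by (simp add: a_def)
  have r2: "0 < 1 - r\<^sup>2" using r by (simp add: abs_square_less_1)
  have l: "0 < l" "l = a / (1 - r\<^sup>2)" using \<nu> r2 by (simp_all add: l_def a_def)
  define C where "C = 2 powr (- \<nu>) * \<nu> powr \<nu> * (x * y) powr (\<nu> / 2 - 1)
    / ((Gamma (\<nu> / 2))\<^sup>2 * (1 - r\<^sup>2) powr (\<nu> / 2)) * exp (- (\<nu> * (x + y) / (2 * (1 - r\<^sup>2))))"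
  define z where "z = \<nu>\<^sup>2 * r\<^sup>2 * x * y / (4 * (1 - r\<^sup>2)\<^sup>2)"
  \<comment> \<open>Absorbing the powers of \<open>1 - r\<^sup>2\<close> into the rate
    \<open>l\<close> lets \<open>z^k\<close> split between \<open>x\<close> and \<open>y\<close>,
    which raises both Gamma shapes from \<open>a\<close> to \<open>a + k\<close>.\<close>
  have z: "z = r\<^sup>2 * (l * x) * (l * y)"
    using r2 unfolding z_def l_def by (simp add: power2_eq_square field_simps)
  have "0 \<le> z" using True l(1) unfolding z by (intro mult_nonneg_nonneg) auto
  have Ga: "0 < Gamma a" using a by (intro Gamma_real_pos) simp
  have C: "C = (l powr a)\<^sup>2 * (1 - r\<^sup>2) powr a / (Gamma a)\<^sup>2
      * (x powr (a - 1) * y powr (a - 1)) * (exp (- l * x) * exp (- l * y))"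
  proof -
    have "2 powr (- \<nu>) * \<nu> powr \<nu> = (a powr a)\<^sup>2"
    proof -
      have "2 powr (- \<nu>) * \<nu> powr \<nu> = a powr \<nu>"
        using \<nu> by (simp add: a_def powr_divide powr_minus_divide)
      also have "\<dots> = a powr (a + a)" by (simp add: a_def)
      finally show ?thesis by (simp only: powr_add power2_eq_square)
    qed
    moreover have "(a powr a)\<^sup>2 / (1 - r\<^sup>2) powr a = (l powr a)\<^sup>2 * (1 - r\<^sup>2) powr a"
      using r2 a unfolding l(2) by (simp add: powr_divide power2_eq_square field_simps)
    moreover have "exp (- (\<nu> * (x + y) / (2 * (1 - r\<^sup>2)))) = exp (- l * x) * exp (- l * y)"
      using r2 by (simp add: l_def algebra_simps add_divide_distrib flip: exp_add)
    moreover have "(x * y) powr (\<nu> / 2 - 1) = x powr (a - 1) * y powr (a - 1)"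
      using True by (simp add: a_def powr_mult)
    ultimately show ?thesis
      unfolding C_def a_def[symmetric] using Ga r2 by (simp add: field_simps)
  qed
  have term_eq: "C * (z ^ k / (fact k * pochhammer a k))
      = pochhammer a k / fact k * (1 - r\<^sup>2) powr a * (r\<^sup>2) ^ k * (\<gamma> k x * \<gamma> k y)" for k
  proof -
    have pk: "0 < pochhammer a k" using a by (intro pochhammer_pos) simp
    have "a \<notin> \<int>\<^sub>\<le>\<^sub>0" using a by (auto elim!: nonpos_Ints_cases)
    then have Gk: "Gamma (a + real k) = pochhammer a k * Gamma a"
      using pochhammer_Gamma[of a k] Ga by (simp add: field_simps)
    have lk: "l powr (a + real k) = l powr a * l ^ k" using l by (simp add: powr_add powr_realpow)
    have ker: "gamma_kernel (a + real k) l w = w powr (a - 1) * w ^ k * exp (- l * w)" if "0 < w" for w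
    proof -
      have "a + real k - 1 = (a - 1) + real k" by simp
      then show ?thesis using that by (simp only: gamma_kernel_def powr_add powr_realpow) simp
    qed
    show ?thesis
      unfolding \<gamma>_def C z Gk lk ker[OF conjunct1[OF True]] ker[OF conjunct2[OF True]]
      using pk Ga by (simp add: power_mult_distrib power2_eq_square field_simps)
  qed
  have "(\<lambda>k. C * (z ^ k / (fact k * pochhammer a k))) sums (C * hypergeom_0F1 a z)"
    using a \<open>0 \<le> z\<close> by (intro sums_mult hypergeom_0F1_sums) auto
  then have "(\<lambda>k. pochhammer a k / fact k * (1 - r\<^sup>2) powr a * (r\<^sup>2) ^ k * (\<gamma> k x * \<gamma> k y))
      sums bivariate_gamma_density \<nu> r (x, y)"
    using True unfolding term_eq by (simp add: bivariate_gamma_density_def C_def z_def a_def)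
  moreover have nn: "0 \<le> \<gamma> k w" "0 \<le> pochhammer a k / fact k * (1 - r\<^sup>2) powr a * (r\<^sup>2) ^ k" for k w
    using a unfolding \<gamma>_def by (auto intro!: mult_nonneg_nonneg divide_nonneg_nonneg pochhammer_nonneg)
  ultimately have "(\<Sum>k. ennreal (pochhammer a k / fact k * (1 - r\<^sup>2) powr a * (r\<^sup>2) ^ k * (\<gamma> k x * \<gamma> k y)))
      = ennreal (bivariate_gamma_density \<nu> r (x, y))"
    by (intro suminf_ennreal_eq mult_nonneg_nonneg[OF nn(2) mult_nonneg_nonneg[OF nn(1) nn(1)]])
  then show ?thesis
    using nn by (simp only: ennreal_mult mult_nonneg_nonneg)
qed (auto simp: bivariate_gamma_density_def \<gamma>_def gamma_kernel_def)

text \<open>In the mixture each term has a product transform, and the weights sum it by the negative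
  binomial series once more. The rate \<open>l\<close> of the components exceeds \<open>a\<close>
  unless \<open>r = 0\<close>; rewriting in terms of \<open>a\<close> recovers the same transform as
  in the integer case.\<close>

lemma nn_integral_bivariate_gamma_density_exp:
  assumes \<nu>: "2 < \<nu>" and r: "\<bar>r\<bar> < 1" and "0 < \<theta>" "0 < \<eta>"
  shows "(\<integral>\<^sup>+x. \<integral>\<^sup>+y. ennreal (bivariate_gamma_density \<nu> r (x, y)) * ennreal (exp (- (\<theta> * x + \<eta> * y))) \<partial>lborel \<partial>lborel)
    = ennreal (gamma_laplace (\<nu> / 2) (r\<^sup>2) \<theta> \<eta>)"
proof -
  define a where "a = \<nu> / 2"
  define l where "l = \<nu> / 2 / (1 - r\<^sup>2)"
  define \<gamma> where "\<gamma> k x = l powr (a + real k) / Gamma (a + real k) * gamma_kernel (a + real k) l x" for k x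
  define c where "c k = pochhammer a k / fact k * (1 - r\<^sup>2) powr a * (r\<^sup>2) ^ k" for k
  define u v where "u = 1 + \<theta> / l" and "v = 1 + \<eta> / l"
  have a: "1 < a" using \<nu> by (simp add: a_def)
  have r2: "0 < 1 - r\<^sup>2" using r by (simp add: abs_square_less_1)
  have l: "0 < l" "l = a / (1 - r\<^sup>2)" using \<nu> r2 by (simp_all add: l_def a_def)
  have uv: "1 < u" "1 < v" using assms(3,4) l(1) by (simp_all add: u_def v_def)
  have [measurable]: "(\<lambda>x. \<gamma> k x) \<in> borel_measurable borel" for k unfolding \<gamma>_def by measurable
  have "(\<integral>\<^sup>+x. \<integral>\<^sup>+y. ennreal (bivariate_gamma_density \<nu> r (x, y)) * ennreal (exp (- (\<theta> * x + \<eta> * y))) \<partial>lborel \<partial>lborel)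
      = (\<integral>\<^sup>+x. \<integral>\<^sup>+y. (\<Sum>k. ennreal (c k) * ((ennreal (\<gamma> k x) * ennreal (exp (- (\<theta> * x))))
          * (ennreal (\<gamma> k y) * ennreal (exp (- (\<eta> * y)))))) \<partial>lborel \<partial>lborel)"
  proof (intro nn_integral_cong)
    fix x y
    have e: "ennreal (exp (- (\<theta> * x + \<eta> * y))) = ennreal (exp (- (\<theta> * x))) * ennreal (exp (- (\<eta> * y)))"
      unfolding minus_add_distrib exp_add by (simp add: ennreal_mult)
    have "ennreal (bivariate_gamma_density \<nu> r (x, y)) * ennreal (exp (- (\<theta> * x + \<eta> * y)))
        = (\<Sum>k. ennreal (c k) * (ennreal (\<gamma> k x) * ennreal (\<gamma> k y)) * ennreal (exp (- (\<theta> * x + \<eta> * y))))"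
      using bivariate_gamma_density_suminf[OF \<nu> r, of x y]
      unfolding c_def \<gamma>_def a_def l_def by simp
    then show "ennreal (bivariate_gamma_density \<nu> r (x, y)) * ennreal (exp (- (\<theta> * x + \<eta> * y)))
        = (\<Sum>k. ennreal (c k) * ((ennreal (\<gamma> k x) * ennreal (exp (- (\<theta> * x))))
          * (ennreal (\<gamma> k y) * ennreal (exp (- (\<eta> * y))))))"
      unfolding e by (simp only: mult_ac)
  qed
  also have "\<dots> = (\<Sum>k. ennreal (c k) * ((\<integral>\<^sup>+x. ennreal (\<gamma> k x) * ennreal (exp (- (\<theta> * x))) \<partial>lborel)
          * (\<integral>\<^sup>+y. ennreal (\<gamma> k y) * ennreal (exp (- (\<eta> * y))) \<partial>lborel)))"
    by (simp add: nn_integral_suminf nn_integral_cmult nn_integral_multc)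
  also have "\<dots> = (\<Sum>k. ennreal (c k * (u powr (- (a + real k)) * v powr (- (a + real k)))))"
  proof (intro arg_cong[where f = suminf] ext)
    fix k :: nat
    have "(\<integral>\<^sup>+x. ennreal (\<gamma> k x) * ennreal (exp (- (\<theta> * x))) \<partial>lborel) = ennreal (u powr (- (a + real k)))"
      "(\<integral>\<^sup>+y. ennreal (\<gamma> k y) * ennreal (exp (- (\<eta> * y))) \<partial>lborel) = ennreal (v powr (- (a + real k)))"
      using a l(1) assms(3,4) unfolding \<gamma>_def u_def v_def by (intro nn_integral_gamma_density_exp; simp)+
    moreover have "0 \<le> c k"
      using a unfolding c_def by (auto intro!: mult_nonneg_nonneg divide_nonneg_nonneg pochhammer_nonneg)
    ultimately show "ennreal (c k) * ((\<integral>\<^sup>+x. ennreal (\<gamma> k x) * ennreal (exp (- (\<theta> * x))) \<partial>lborel)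
          * (\<integral>\<^sup>+y. ennreal (\<gamma> k y) * ennreal (exp (- (\<eta> * y))) \<partial>lborel))
        = ennreal (c k * (u powr (- (a + real k)) * v powr (- (a + real k))))"
      by (simp add: ennreal_mult)
  qed
  also have "\<dots> = ennreal (gamma_laplace a (r\<^sup>2) \<theta> \<eta>)"
  proof (rule suminf_ennreal_eq)
    show "0 \<le> c k * (u powr (- (a + real k)) * v powr (- (a + real k)))" for k
      using a unfolding c_def by (auto intro!: mult_nonneg_nonneg divide_nonneg_nonneg pochhammer_nonneg)
    define x where "x = r\<^sup>2 / (u * v)"
    have "1 * 1 < u * v" using uv by (intro mult_strict_mono) auto
    then have x: "0 \<le> x" "x < 1" using r2 by (auto simp: x_def divide_less_eq)
    have "(\<lambda>k. ((1 - r\<^sup>2) powr a * (u powr (- a) * v powr (- a))) * (pochhammer a k / fact k * x ^ k)) sums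
        (((1 - r\<^sup>2) powr a * (u powr (- a) * v powr (- a))) * (1 - x) powr (- a))"
      by (intro sums_mult negative_binomial_sums x)
    also have "(\<lambda>k. ((1 - r\<^sup>2) powr a * (u powr (- a) * v powr (- a))) * (pochhammer a k / fact k * x ^ k))
        = (\<lambda>k. c k * (u powr (- (a + real k)) * v powr (- (a + real k))))"
    proof
      fix k
      have p: "w powr (- (a + real k)) = w powr (- a) / w ^ k" if "1 < w" for w
        using that by (simp add: powr_diff powr_realpow)
      show "((1 - r\<^sup>2) powr a * (u powr (- a) * v powr (- a))) * (pochhammer a k / fact k * x ^ k)
          = c k * (u powr (- (a + real k)) * v powr (- (a + real k)))"
        unfolding p[OF uv(1)] p[OF uv(2)] c_def x_def by (simp add: power_divide power_mult_distrib)
    qed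
    also have "((1 - r\<^sup>2) powr a * (u powr (- a) * v powr (- a))) * (1 - x) powr (- a)
        = (u * v * (1 - x) / (1 - r\<^sup>2)) powr (- a)"
    proof -
      have "(u * v * (1 - x) / (1 - r\<^sup>2)) powr (- a)
          = u powr (- a) * v powr (- a) * (1 - x) powr (- a) / (1 - r\<^sup>2) powr (- a)"
        using uv x r2 by (simp only: powr_mult powr_divide mult_nonneg_nonneg less_imp_le
            diff_ge_0_iff_ge)
      also have "\<dots> = u powr (- a) * v powr (- a) * (1 - x) powr (- a) * (1 - r\<^sup>2) powr a"
        by (simp add: powr_minus_divide)
      finally show ?thesis by (simp only: mult_ac)
    qed
    also have "u * v * (1 - x) = u * v - r\<^sup>2" using uv by (simp add: x_def right_diff_distrib)
    also have "(u * v - r\<^sup>2) / (1 - r\<^sup>2) = (1 + \<theta> / a) * (1 + \<eta> / a) - r\<^sup>2 * (\<theta> / a) * (\<eta> / a)"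
    proof -
      \<comment> \<open>In the variables \<open>T = \<theta>/a\<close> and
        \<open>E = \<eta>/a\<close> one has \<open>u = 1 + (1-q) T\<close> and
        \<open>v = 1 + (1-q) E\<close>; \<open>u v - q\<close> then contains the factor
        \<open>1 - q\<close>.\<close>
      have key: "((1 + (1 - q) * T) * (1 + (1 - q) * E) - q) / (1 - q) = (1 + T) * (1 + E) - q * T * E"
        if "1 - q \<noteq> 0" for q T E :: real
      proof -
        have "(1 + (1 - q) * T) * (1 + (1 - q) * E) - q = (1 - q) * ((1 + T) * (1 + E) - q * T * E)"
          by (simp add: algebra_simps)
        then show ?thesis using that by simp
      qed
      have "u = 1 + (1 - r\<^sup>2) * (\<theta> / a)" "v = 1 + (1 - r\<^sup>2) * (\<eta> / a)"
        using a by (simp_all add: u_def v_def l(2))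
      then show ?thesis using key[of "r\<^sup>2" "\<theta> / a" "\<eta> / a"] r2 by simp
    qed
    finally show "(\<lambda>k. c k * (u powr (- (a + real k)) * v powr (- (a + real k)))) sums gamma_laplace a (r\<^sup>2) \<theta> \<eta>"
      by (simp only: gamma_laplace_def)
  qed
  finally show ?thesis by (simp only: a_def)
qed

text \<open>The bivariate density handles \<open>|\<rho>| < 1\<close>. For
  \<open>|\<rho>| = 1\<close> the two variables agree almost surely, and the one-dimensional Gamma
  law is evaluated at \<open>\<theta> + \<eta>\<close>.\<close>

lemma (in prob_space) gamma_law_mixing_pair:
  assumes G: "standard_gaussian_process M A \<rho> G" and W: "gamma_law_mixing M A \<rho> \<nu> G W" and \<nu>: "2 < \<nu>"
    and s: "s \<in> A" and t: "t \<in> A"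
  shows "mixing_pair M (\<nu> / 2) ((\<rho> (s - t))\<^sup>2) (\<lambda>\<omega>. (G s \<omega>, G t \<omega>)) (W s) (W t)"
proof -
  have ind: "indep_var (path_space A) (path A G) (path_space A) (path A W)"
    and pos: "\<And>u. u \<in> A \<Longrightarrow> AE \<omega> in M. 0 < W u \<omega>"
    and dens: "\<And>u. u \<in> A \<Longrightarrow> distributed M lborel (W u) (gamma_density (\<nu> / 2) (\<nu> / 2))"
    and dens2: "\<bar>\<rho> (s - t)\<bar> < 1 \<Longrightarrow> distributed M (lborel \<Otimes>\<^sub>M lborel) (\<lambda>\<omega>. (W s \<omega>, W t \<omega>))
      (bivariate_gamma_density \<nu> (\<rho> (s - t)))"
    and eq: "\<bar>\<rho> (s - t)\<bar> = 1 \<Longrightarrow> AE \<omega> in M. W s \<omega> = W t \<omega>"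
    using W s t unfolding gamma_law_mixing_def by blast+
  have Wm: "W u \<in> borel_measurable M" if "u \<in> A" for u
    using dens[OF that] by (simp add: distributed_def measurable_lborel1)
  have comp: "(\<lambda>p. p u) \<in> borel_measurable (path_space A)" if "u \<in> A" for u
    using that by (rule measurable_component_singleton)
  have m: "(\<lambda>p. (p s, p t)) \<in> measurable (path_space A) (borel \<Otimes>\<^sub>M borel)"
    using comp[OF s] comp[OF t] by (rule measurable_Pair)
  have indep: "indep_var (borel \<Otimes>\<^sub>M borel) (\<lambda>\<omega>. (G s \<omega>, G t \<omega>)) (borel \<Otimes>\<^sub>M borel) (\<lambda>\<omega>. (W s \<omega>, W t \<omega>))"
    by (rule indep_var_cong[OF indep_var_compose[OF ind m m]]) (use s t in \<open>auto simp: path_def\<close>)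
  have laplace: "(\<integral>\<^sup>+\<omega>. ennreal (exp (- (\<theta> * W s \<omega> + \<eta> * W t \<omega>))) \<partial>M)
      = ennreal (gamma_laplace (\<nu> / 2) ((\<rho> (s - t))\<^sup>2) \<theta> \<eta>)" if "0 < \<theta>" "0 < \<eta>" for \<theta> \<eta>
  proof (cases "\<bar>\<rho> (s - t)\<bar> < 1")
    case True
    let ?g = "\<lambda>p :: real \<times> real. ennreal (exp (- (\<theta> * fst p + \<eta> * snd p)))"
    have meas: "(\<lambda>p. ennreal (bivariate_gamma_density \<nu> (\<rho> (s - t)) p)) \<in> borel_measurable (lborel \<Otimes>\<^sub>M lborel)"
      using dens2[OF True] by (simp add: distributed_def)
    have "?g \<in> borel_measurable (lborel \<Otimes>\<^sub>M lborel)" by measurable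
    from distributed_nn_integral[OF dens2[OF True] this]
    have "(\<integral>\<^sup>+\<omega>. ennreal (exp (- (\<theta> * W s \<omega> + \<eta> * W t \<omega>))) \<partial>M)
        = (\<integral>\<^sup>+p. ennreal (bivariate_gamma_density \<nu> (\<rho> (s - t)) p) * ?g p \<partial>(lborel \<Otimes>\<^sub>M lborel))"
      by simp
    also have "\<dots> = (\<integral>\<^sup>+x. \<integral>\<^sup>+y. ennreal (bivariate_gamma_density \<nu> (\<rho> (s - t)) (x, y)) * ?g (x, y) \<partial>lborel \<partial>lborel)"
      by (rule lborel.nn_integral_fst[symmetric], rule borel_measurable_times_ennreal[OF meas]) measurable
    also have "\<dots> = ennreal (gamma_laplace (\<nu> / 2) ((\<rho> (s - t))\<^sup>2) \<theta> \<eta>)"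
      using nn_integral_bivariate_gamma_density_exp[OF \<nu> True that] by simp
    finally show ?thesis .
  next
    case False
    then have 1: "\<bar>\<rho> (s - t)\<bar> = 1" using standard_gaussian_process_moments(5)[OF G s t] by simp
    \<comment> \<open>The value is kept as \<open>1\<^sup>2\<close> to match the left-hand side of
      \<open>gamma_laplace_1\<close>.\<close>
    then have sq: "(\<rho> (s - t))\<^sup>2 = 1\<^sup>2" by (metis power2_abs)
    have "(\<integral>\<^sup>+\<omega>. ennreal (exp (- (\<theta> * W s \<omega> + \<eta> * W t \<omega>))) \<partial>M)
        = (\<integral>\<^sup>+\<omega>. ennreal (exp (- ((\<theta> + \<eta>) * W s \<omega>))) \<partial>M)"
      by (rule nn_integral_cong_AE) (use eq[OF 1] in \<open>eventually_elim, simp add: algebra_simps\<close>)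
    also have "\<dots> = (\<integral>\<^sup>+x. ennreal (gamma_density (\<nu> / 2) (\<nu> / 2) x) * ennreal (exp (- ((\<theta> + \<eta>) * x))) \<partial>lborel)"
      by (rule distributed_nn_integral[OF dens[OF s], symmetric]) measurable
    also have "\<dots> = ennreal ((1 + (\<theta> + \<eta>) / (\<nu> / 2)) powr (- (\<nu> / 2)))"
      unfolding gamma_density_eq_kernel using \<nu> that by (intro nn_integral_gamma_density_exp) auto
    finally show ?thesis unfolding sq gamma_laplace_1 .
  qed
  show ?thesis
    unfolding mixing_pair_def using Wm pos s t indep laplace by blast
qed

text \<open>Continuity at the right end point is the aim, since the squared correlation is 1 at lag
  0. The summable coefficients are a majorant on the closed interval.\<close>

lemma continuous_on_hyp_sum:
  assumes "1 < a"
  shows "continuous_on {0..1} (hyp_sum a)"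
proof (rule uniform_limit_theorem)
  show "uniform_limit {0..1} (\<lambda>n x. \<Sum>k<n. hyp_coeff a k * x ^ k) (hyp_sum a) sequentially"
    unfolding hyp_sum_def
  proof (rule Weierstrass_m_test[OF _ summable_hyp_coeff[OF assms]])
    show "norm (hyp_coeff a k * x ^ k) \<le> hyp_coeff a k" if "x \<in> {0..1}" for k x
      using assms that hyp_coeff_pos[of a k] by (simp add: abs_mult mult_left_le power_le_one)
  qed
  show "\<forall>\<^sub>F n in sequentially. continuous_on {0..1} (\<lambda>x. \<Sum>k<n. hyp_coeff a k * x ^ k)"
    by (intro always_eventually allI continuous_intros)
qed simp

section \<open>Second-order structure of the \<open>t\<close> process\<close>

lemma (in prob_space) mixing_pair_moment:
  assumes "mixing_pair M a q X U V" "1 < a" "0 \<le> q" "q \<le> 1"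
  shows "integrable M (\<lambda>\<omega>. U \<omega> powr (- 1 / 2) * V \<omega> powr (- 1 / 2))"
    and "(\<integral>\<omega>. U \<omega> powr (- 1 / 2) * V \<omega> powr (- 1 / 2) \<partial>M) = t_const a * hyp_sum a q"
proof -
  let ?f = "\<lambda>\<omega>. U \<omega> powr (- 1 / 2) * V \<omega> powr (- 1 / 2)"
  have [measurable]: "U \<in> borel_measurable M" "V \<in> borel_measurable M"
    using assms(1) by (auto simp: mixing_pair_def)
  have pos: "0 < t_const a" "1 \<le> hyp_sum a q"
    using assms t_const_pos[of a] hyp_sum_mono[of a 0 q] by auto
  have "(\<integral>\<^sup>+\<omega>. ennreal (?f \<omega>) \<partial>M) = (\<Sum>k. ennreal (t_const a * (hyp_coeff a k * q ^ k)))"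
    using assms by (intro nn_integral_inverse_sqrt_product) (auto simp: mixing_pair_def)
  also have "\<dots> = ennreal (t_const a * hyp_sum a q)"
  proof (rule suminf_ennreal_eq)
    show "0 \<le> t_const a * (hyp_coeff a k * q ^ k)" for k
      using pos assms hyp_coeff_pos[of a k] by (intro mult_nonneg_nonneg) auto
    show "(\<lambda>k. t_const a * (hyp_coeff a k * q ^ k)) sums (t_const a * hyp_sum a q)"
      unfolding hyp_sum_def using assms by (intro sums_mult summable_sums summable_hyp_sum)
  qed
  finally have eq: "(\<integral>\<^sup>+\<omega>. ennreal (?f \<omega>) \<partial>M) = ennreal (t_const a * hyp_sum a q)" .
  show int: "integrable M ?f"
  proof (rule integrableI_nonneg)
    show "(\<integral>\<^sup>+\<omega>. ennreal (?f \<omega>) \<partial>M) < \<infinity>" unfolding eq by simp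
  qed auto
  show "(\<integral>\<omega>. ?f \<omega> \<partial>M) = t_const a * hyp_sum a q"
    using nn_integral_eq_integral[OF int] eq pos by simp
qed

lemma (in prob_space) standard_t_process_mixing_pair:
  assumes "standard_t_process M A \<rho> \<nu> G W Y" "2 < \<nu>" "s \<in> A" "t \<in> A"
  shows "mixing_pair M (\<nu> / 2) ((\<rho> (s - t))\<^sup>2) (\<lambda>\<omega>. (G s \<omega>, G t \<omega>)) (W s) (W t)"
proof (cases "\<nu> \<in> \<nat>")
  case True
  then obtain n where n: "\<nu> = real n" by (auto elim: Nats_cases)
  have "chi_square_mixing M A n G W"
    using assms(1) True by (simp add: standard_t_process_def gamma_mixing_def n)
  moreover have "standard_gaussian_process M A \<rho> G" using assms(1) by (simp add: standard_t_process_def)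
  ultimately show ?thesis
    using chi_square_mixing_pair assms(2-4) n by fastforce
next
  case False
  then have "gamma_law_mixing M A \<rho> \<nu> G W"
    using assms(1) by (simp add: standard_t_process_def gamma_mixing_def)
  moreover have "standard_gaussian_process M A \<rho> G" using assms(1) by (simp add: standard_t_process_def)
  ultimately show ?thesis using gamma_law_mixing_pair assms(2-4) by blast
qed

text \<open>Independence separates the Gaussian product moment \<open>\<rho>\<close> from the mixing
  moment, which depends on the lag only through \<open>\<rho>\<^sup>2\<close>.\<close>

lemma (in prob_space) standard_t_process_moments:
  assumes Y: "standard_t_process M A \<rho> \<nu> G W Y" and \<nu>: "2 < \<nu>" and s: "s \<in> A" and t: "t \<in> A"
  shows "square_integrable M (Y s)" "expectation (Y s) = 0"
    and "(\<integral>\<omega>. Y s \<omega> * Y t \<omega> \<partial>M) = t_const (\<nu> / 2) * (\<rho> (s - t) * hyp_sum (\<nu> / 2) ((\<rho> (s - t))\<^sup>2))"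
proof -
  have G: "standard_gaussian_process M A \<rho> G"
    and Yeq: "\<And>u \<omega>. u \<in> A \<Longrightarrow> \<omega> \<in> space M \<Longrightarrow> Y u \<omega> = W u \<omega> powr (- 1 / 2) * G u \<omega>"
    using Y unfolding standard_t_process_def by blast+
  have mix: "mixing_pair M (\<nu> / 2) ((\<rho> (u - v))\<^sup>2) (\<lambda>\<omega>. (G u \<omega>, G v \<omega>)) (W u) (W v)"
    if "u \<in> A" "v \<in> A" for u v
    using standard_t_process_mixing_pair[OF Y \<nu> that] .
  have Gm[measurable]: "G u \<in> borel_measurable M" "W u \<in> borel_measurable M" if "u \<in> A" for u
    using standard_gaussian_process_moments(1)[OF G that that] mix[OF that that]
    by (auto simp: square_integrable_def mixing_pair_def)
  have Ym: "Y u \<in> borel_measurable M" if "u \<in> A" for u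
  proof (subst measurable_cong[OF Yeq[OF that]])
    show "(\<lambda>\<omega>. W u \<omega> powr (- 1 / 2) * G u \<omega>) \<in> borel_measurable M" using that by measurable
  qed
  let ?w = "\<lambda>u \<omega>. W u \<omega> powr (- 1 / 2)"
  have w: "integrable M (\<lambda>\<omega>. ?w u \<omega> * ?w v \<omega>)"
    "(\<integral>\<omega>. ?w u \<omega> * ?w v \<omega> \<partial>M) = t_const (\<nu> / 2) * hyp_sum (\<nu> / 2) ((\<rho> (u - v))\<^sup>2)" if "u \<in> A" "v \<in> A" for u v
    using mixing_pair_moment[OF mix[OF that]] \<nu> standard_gaussian_process_moments(5)[OF G that]
    by (auto simp: abs_square_le_1)
  have YY: "integrable M (\<lambda>\<omega>. Y u \<omega> * Y v \<omega>)"
    "(\<integral>\<omega>. Y u \<omega> * Y v \<omega> \<partial>M) = t_const (\<nu> / 2) * (\<rho> (u - v) * hyp_sum (\<nu> / 2) ((\<rho> (u - v))\<^sup>2))"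
    if u: "u \<in> A" and v: "v \<in> A" for u v
  proof -
    have "indep_var (borel \<Otimes>\<^sub>M borel) (\<lambda>\<omega>. (G u \<omega>, G v \<omega>)) (borel \<Otimes>\<^sub>M borel) (\<lambda>\<omega>. (W u \<omega>, W v \<omega>))"
      using mix[OF that] by (simp add: mixing_pair_def)
    from indep_var_compose[OF this, of "\<lambda>p. fst p * snd p" borel "\<lambda>p. fst p powr (- 1 / 2) * snd p powr (- 1 / 2)" borel]
    have ind: "indep_var borel (\<lambda>\<omega>. G u \<omega> * G v \<omega>) borel (\<lambda>\<omega>. ?w u \<omega> * ?w v \<omega>)"
      by (simp add: comp_def)
    have GG: "integrable M (\<lambda>\<omega>. G u \<omega> * G v \<omega>)"
      using standard_gaussian_process_moments(1)[OF G] that by (intro integrable_mult_square_integrable) auto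
    have eq: "Y u \<omega> * Y v \<omega> = (G u \<omega> * G v \<omega>) * (?w u \<omega> * ?w v \<omega>)" if "\<omega> \<in> space M" for \<omega>
      using that u v by (simp add: Yeq)
    show "integrable M (\<lambda>\<omega>. Y u \<omega> * Y v \<omega>)"
      using indep_var_integrable[OF ind GG w(1)[OF that]] eq by (subst Bochner_Integration.integrable_cong) auto
    have "(\<integral>\<omega>. Y u \<omega> * Y v \<omega> \<partial>M) = (\<integral>\<omega>. (G u \<omega> * G v \<omega>) * (?w u \<omega> * ?w v \<omega>) \<partial>M)"
      using eq by (intro Bochner_Integration.integral_cong) auto
    also have "\<dots> = \<rho> (u - v) * (t_const (\<nu> / 2) * hyp_sum (\<nu> / 2) ((\<rho> (u - v))\<^sup>2))"
      using indep_var_lebesgue_integral[OF ind GG w(1)[OF that]] w(2)[OF that]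
        standard_gaussian_process_moments(3)[OF G that] by simp
    finally show "(\<integral>\<omega>. Y u \<omega> * Y v \<omega> \<partial>M)
        = t_const (\<nu> / 2) * (\<rho> (u - v) * hyp_sum (\<nu> / 2) ((\<rho> (u - v))\<^sup>2))" by simp
  qed
  show "(\<integral>\<omega>. Y s \<omega> * Y t \<omega> \<partial>M) = t_const (\<nu> / 2) * (\<rho> (s - t) * hyp_sum (\<nu> / 2) ((\<rho> (s - t))\<^sup>2))"
    using YY(2)[OF s t] .
  show "square_integrable M (Y s)"
    using YY(1)[OF s s] Ym[OF s] by (simp add: square_integrable_def power2_eq_square)
  \<comment> \<open>The first moment of the mixing factor is finite because its square is
    integrable, by the moment formula for the pair \<open>s\<close>, \<open>s\<close>.\<close>
  have wm: "?w s \<in> borel_measurable M" using s by measurable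
  have iw: "integrable M (?w s)"
    by (rule square_integrable_imp_integrable[OF wm]) (use w(1)[OF s s] in \<open>simp only: power2_eq_square\<close>)
  have iG: "integrable M (G s)"
    using standard_gaussian_process_moments(1)[OF G s s]
    by (auto simp: square_integrable_def intro: square_integrable_imp_integrable)
  have "indep_var (borel \<Otimes>\<^sub>M borel) (\<lambda>\<omega>. (G s \<omega>, G s \<omega>)) (borel \<Otimes>\<^sub>M borel) (\<lambda>\<omega>. (W s \<omega>, W s \<omega>))"
    using mix[OF s s] by (simp add: mixing_pair_def)
  from indep_var_compose[OF this, of fst borel "\<lambda>p. fst p powr (- 1 / 2)" borel]
  have "indep_var borel (G s) borel (?w s)" by (simp add: comp_def)
  from indep_var_lebesgue_integral[OF this iG iw]
  have "(\<integral>\<omega>. G s \<omega> * ?w s \<omega> \<partial>M) = 0"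
    unfolding standard_gaussian_process_moments(2)[OF G s s] by simp
  moreover have "expectation (Y s) = (\<integral>\<omega>. G s \<omega> * ?w s \<omega> \<partial>M)"
    using Yeq[OF s] by (intro Bochner_Integration.integral_cong) (auto simp: mult.commute)
  ultimately show "expectation (Y s) = 0" by simp
qed

section \<open>Correlation functions and criteria stated through them\<close>

lemma correlation_function_eq:
  assumes "\<And>s t. s \<in> A \<Longrightarrow> t \<in> A \<Longrightarrow> correlation M (Q s) (Q t) = c (s - t)" "h \<in> lags A"
  shows "correlation_function M A Q h = c h"
  unfolding correlation_function_def
proof (rule the_equality)
  obtain s t where "h = s - t" "s \<in> A" "t \<in> A" using assms(2) by (auto simp: lags_def)
  with assms(1) show "\<exists>s\<in>A. \<exists>t\<in>A. h = s - t \<and> c h = correlation M (Q s) (Q t)" by metis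
  show "r = c h" if "\<exists>s\<in>A. \<exists>t\<in>A. h = s - t \<and> r = correlation M (Q s) (Q t)" for r
    using that assms(1) by auto
qed

text \<open>The variance is the covariance at lag 0, where \<open>\<rho>\<close> is 1; dividing by
  it cancels \<open>t_const\<close> and leaves \<open>hyp_sum (\<nu> / 2) 1\<close> in the
  denominator.\<close>

lemma (in prob_space) standard_t_process_correlation:
  assumes Y: "standard_t_process M A \<rho> \<nu> G W Y" and \<nu>: "2 < \<nu>" and h: "h \<in> lags A"
  shows "correlation_function M A Y h = \<rho> h * (hyp_sum (\<nu> / 2) ((\<rho> h)\<^sup>2) / hyp_sum (\<nu> / 2) 1)"
    and "correlation_function M A G h = \<rho> h" "\<bar>\<rho> h\<bar> \<le> 1"
proof -
  have G: "standard_gaussian_process M A \<rho> G" using Y by (simp add: standard_t_process_def)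
  note m = standard_t_process_moments[OF Y \<nu>]
  have cov: "covariance M (Y s) (Y t) = t_const (\<nu> / 2) * (\<rho> (s - t) * hyp_sum (\<nu> / 2) ((\<rho> (s - t))\<^sup>2))"
    if "s \<in> A" "t \<in> A" for s t
    using m(2)[OF that] m(2)[OF that(2,1)] m(3)[OF that] by (simp add: covariance_def)
  have pos: "0 < t_const (\<nu> / 2) * hyp_sum (\<nu> / 2) 1"
    using t_const_pos[of "\<nu> / 2"] hyp_sum_bounds(3)[of "\<nu> / 2" 0] \<nu> by (intro mult_pos_pos) auto
  have var: "covariance M (Y s) (Y s) = t_const (\<nu> / 2) * hyp_sum (\<nu> / 2) 1" if "s \<in> A" for s
    using cov[OF that that] standard_gaussian_process_moments(4)[OF G that that] by simp
  show "correlation_function M A Y h = \<rho> h * (hyp_sum (\<nu> / 2) ((\<rho> h)\<^sup>2) / hyp_sum (\<nu> / 2) 1)"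
  proof (rule correlation_function_eq[OF _ h])
    fix s t assume st: "s \<in> A" "t \<in> A"
    have "t_const (\<nu> / 2) \<noteq> 0" using t_const_pos[of "\<nu> / 2"] \<nu> by simp
    with pos show "correlation M (Y s) (Y t)
        = \<rho> (s - t) * (hyp_sum (\<nu> / 2) ((\<rho> (s - t))\<^sup>2) / hyp_sum (\<nu> / 2) 1)"
      by (simp add: correlation_def cov[OF st] var[OF st(1)] var[OF st(2)])
  qed
  show "correlation_function M A G h = \<rho> h"
    by (rule correlation_function_eq[OF _ h]) (use G in \<open>unfold standard_gaussian_process_def, blast\<close>)
  show "\<bar>\<rho> h\<bar> \<le> 1"
    using h standard_gaussian_process_moments(5)[OF G] by (auto simp: lags_def)
qed

text \<open>The mean-square increment is \<open>2 * (c 0 - c (t - s))\<close>. Limits are taken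
  within \<open>A\<close>, so isolated or boundary points of \<open>A\<close> are allowed.\<close>

lemma ms_continuous_iff:
  assumes "second_order M A X"
    and c: "\<And>s t. s \<in> A \<Longrightarrow> t \<in> A \<Longrightarrow> (\<integral>\<omega>. X s \<omega> * X t \<omega> \<partial>M) = c (s - t)"
  shows "ms_continuous M A X \<longleftrightarrow> (\<forall>s\<in>A. ((\<lambda>t. c (t - s)) \<longlongrightarrow> c 0) (at s within A))"
proof -
  have "((\<lambda>t. \<integral>\<omega>. (X t \<omega> - X s \<omega>)\<^sup>2 \<partial>M) \<longlongrightarrow> 0) (at s within A)
      \<longleftrightarrow> ((\<lambda>t. c (t - s)) \<longlongrightarrow> c 0) (at s within A)" if s: "s \<in> A" for s
  proof -
    have X: "square_integrable M (X t)" if "t \<in> A" for t using assms(1) that by (simp add: second_order_iff)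
    have "(\<integral>\<omega>. (X t \<omega> - X s \<omega>)\<^sup>2 \<partial>M) = 2 * (c 0 - c (t - s))" if t: "t \<in> A" for t
    proof -
      have "(\<integral>\<omega>. (X t \<omega> - X s \<omega>)\<^sup>2 \<partial>M) = (\<integral>\<omega>. X t \<omega> * X t \<omega> - 2 * (X t \<omega> * X s \<omega>) + X s \<omega> * X s \<omega> \<partial>M)"
        by (simp add: power2_eq_square algebra_simps)
      also have "\<dots> = c 0 - 2 * c (t - s) + c 0"
        using integrable_mult_square_integrable[OF X[OF t] X[OF t]] integrable_mult_square_integrable[OF X[OF t] X[OF s]]
          integrable_mult_square_integrable[OF X[OF s] X[OF s]] s t by (simp add: c)
      finally show ?thesis by simp
    qed
    then have "((\<lambda>t. \<integral>\<omega>. (X t \<omega> - X s \<omega>)\<^sup>2 \<partial>M) \<longlongrightarrow> 0) (at s within A)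
        \<longleftrightarrow> ((\<lambda>t. 2 * (c 0 - c (t - s))) \<longlongrightarrow> 0) (at s within A)"
      by (intro tendsto_cong) (auto simp: eventually_at_filter)
    also have "\<dots> \<longleftrightarrow> ((\<lambda>t. c (t - s)) \<longlongrightarrow> c 0) (at s within A)"
    proof
      assume "((\<lambda>t. 2 * (c 0 - c (t - s))) \<longlongrightarrow> 0) (at s within A)"
      then have "((\<lambda>t. c 0 - 2 * (c 0 - c (t - s)) / 2) \<longlongrightarrow> c 0 - 0 / 2) (at s within A)"
        by (intro tendsto_intros) auto
      then show "((\<lambda>t. c (t - s)) \<longlongrightarrow> c 0) (at s within A)" by (simp add: diff_divide_distrib)
    next
      assume "((\<lambda>t. c (t - s)) \<longlongrightarrow> c 0) (at s within A)"
      then have "((\<lambda>t. 2 * (c 0 - c (t - s))) \<longlongrightarrow> 2 * (c 0 - c 0)) (at s within A)"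
        by (intro tendsto_intros)
      then show "((\<lambda>t. 2 * (c 0 - c (t - s))) \<longlongrightarrow> 0) (at s within A)" by simp
    qed
    finally show ?thesis .
  qed
  then show ?thesis using assms(1) by (simp add: ms_continuous_def)
qed

text \<open>Forwards this is continuity of the series at the end point. Backwards, the product is
  eventually positive, hence so is \<open>r x\<close>; then \<open>r x\<close> is squeezed between
  the normalised product and 1.\<close>

lemma tendsto_hyp_sum_iff:
  assumes a: "1 < a" and r: "\<forall>\<^sub>F x in F. \<bar>r x\<bar> \<le> 1"
  shows "((\<lambda>x. r x * hyp_sum a ((r x)\<^sup>2)) \<longlongrightarrow> hyp_sum a 1) F \<longleftrightarrow> (r \<longlongrightarrow> 1) F"
proof
  assume L: "(r \<longlongrightarrow> 1) F"
  then have L2: "((\<lambda>x. (r x)\<^sup>2) \<longlongrightarrow> 1\<^sup>2) F" by (rule tendsto_power)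
  have ev: "\<forall>\<^sub>F x in F. (r x)\<^sup>2 \<in> {0..1}"
    using r by eventually_elim (simp add: abs_square_le_1)
  have "((\<lambda>x. hyp_sum a ((r x)\<^sup>2)) \<longlongrightarrow> hyp_sum a 1) F"
    using continuous_on_tendsto_compose[OF continuous_on_hyp_sum[OF a] L2 _ ev] by simp
  from tendsto_mult[OF L this] show "((\<lambda>x. r x * hyp_sum a ((r x)\<^sup>2)) \<longlongrightarrow> hyp_sum a 1) F" by simp
next
  assume L: "((\<lambda>x. r x * hyp_sum a ((r x)\<^sup>2)) \<longlongrightarrow> hyp_sum a 1) F"
  have F1: "1 \<le> hyp_sum a 1" using hyp_sum_bounds(3)[OF a, of 0] by simp
  have "((\<lambda>x. r x * hyp_sum a ((r x)\<^sup>2) / hyp_sum a 1) \<longlongrightarrow> hyp_sum a 1 / hyp_sum a 1) F"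
    using F1 by (intro tendsto_divide L tendsto_const) auto
  then have L1: "((\<lambda>x. r x * hyp_sum a ((r x)\<^sup>2) / hyp_sum a 1) \<longlongrightarrow> 1) F" using F1 by simp
  have "\<forall>\<^sub>F x in F. 0 < r x * hyp_sum a ((r x)\<^sup>2)"
    using order_tendstoD(1)[OF L, of 0] F1 by simp
  then have "\<forall>\<^sub>F x in F. r x * hyp_sum a ((r x)\<^sup>2) / hyp_sum a 1 \<le> r x"
    using r
  proof eventually_elim
    case (elim x)
    note b = hyp_sum_bounds[OF a elim(2)]
    have "0 < r x" using elim(1) b(1) by (simp add: zero_less_mult_iff)
    then show ?case using b by (simp add: field_simps)
  qed
  moreover have "\<forall>\<^sub>F x in F. r x \<le> 1" using r by eventually_elim simp
  ultimately show "(r \<longlongrightarrow> 1) F"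
    using tendsto_sandwich[OF _ _ L1 tendsto_const] by blast
qed

text \<open>The correlation function may fail to be measurable, so the inequality is read off the
  supremum over simple functions. It provides the lower comparison for long-range
  dependence.\<close>

lemma nn_integral_cmult_ge: "ennreal c * (\<integral>\<^sup>+x. f x \<partial>M) \<le> (\<integral>\<^sup>+x. ennreal c * f x \<partial>M)"
  unfolding nn_integral_def SUP_mult_left_ennreal
proof (rule SUP_least)
  fix g assume g: "g \<in> {g. simple_function M g \<and> g \<le> f}"
  then have "ennreal c * integral\<^sup>S M g = integral\<^sup>S M (\<lambda>x. ennreal c * g x)"
    by (simp add: simple_integral_mult)
  also have "\<dots> \<le> (SUP g\<in>{g. simple_function M g \<and> g \<le> (\<lambda>x. ennreal c * f x)}. integral\<^sup>S M g)"
    using g by (intro SUP_upper) (auto simp: le_fun_def intro!: mult_left_mono simple_function_mult)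
  finally show "ennreal c * integral\<^sup>S M g
      \<le> (SUP g\<in>{g. simple_function M g \<and> g \<le> (\<lambda>x. ennreal c * f x)}. integral\<^sup>S M g)" .
qed

section \<open>The five assertions\<close>

lemma (in prob_space) standard_t_process_weakly_stationary:
  assumes "standard_t_process M A \<rho> \<nu> G W Y" "2 < \<nu>"
  shows "weakly_stationary M A Y"
proof -
  note m = standard_t_process_moments[OF assms]
  have "covariance M (Y s) (Y t) = t_const (\<nu> / 2) * (\<rho> (s - t) * hyp_sum (\<nu> / 2) ((\<rho> (s - t))\<^sup>2))"
    if "s \<in> A" "t \<in> A" for s t
    using m(2)[OF that] m(2)[OF that(2,1)] m(3)[OF that] by (simp add: covariance_def)
  then show ?thesis
    using m(1,2) unfolding weakly_stationary_def second_order_iff by metis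
qed

lemma (in prob_space) standard_t_process_ms_continuous_iff:
  fixes A :: "'i::euclidean_space set"
  assumes Y: "standard_t_process M A \<rho> \<nu> G W Y" and \<nu>: "2 < \<nu>"
  shows "ms_continuous M A Y \<longleftrightarrow> ms_continuous M A G"
proof -
  have G: "standard_gaussian_process M A \<rho> G" using Y by (simp add: standard_t_process_def)
  note mY = standard_t_process_moments[OF Y \<nu>] and mG = standard_gaussian_process_moments[OF G]
  let ?F = "hyp_sum (\<nu> / 2)"
  let ?c = "\<lambda>h. t_const (\<nu> / 2) * (\<rho> h * ?F ((\<rho> h)\<^sup>2))"
  have K: "t_const (\<nu> / 2) \<noteq> 0" using t_const_pos[of "\<nu> / 2"] \<nu> by simp
  have "second_order M A Y" "second_order M A G"
    using mY(1) mG(1) by (auto simp: second_order_iff)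
  from ms_continuous_iff[OF this(1), of ?c] ms_continuous_iff[OF this(2), of \<rho>]
  have iff: "ms_continuous M A Y \<longleftrightarrow> (\<forall>s\<in>A. ((\<lambda>t. ?c (t - s)) \<longlongrightarrow> ?c 0) (at s within A))"
    "ms_continuous M A G \<longleftrightarrow> (\<forall>s\<in>A. ((\<lambda>t. \<rho> (t - s)) \<longlongrightarrow> \<rho> 0) (at s within A))"
    using mY(3) mG(3) by blast+
  have "((\<lambda>t. ?c (t - s)) \<longlongrightarrow> ?c 0) (at s within A) \<longleftrightarrow> ((\<lambda>t. \<rho> (t - s)) \<longlongrightarrow> \<rho> 0) (at s within A)"
    if s: "s \<in> A" for s
  proof -
    have "((\<lambda>t. ?c (t - s)) \<longlongrightarrow> ?c 0) (at s within A)
        \<longleftrightarrow> ((\<lambda>t. \<rho> (t - s) * ?F ((\<rho> (t - s))\<^sup>2)) \<longlongrightarrow> ?F 1) (at s within A)"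
      using tendsto_mult_left_iff[OF K] mG(4)[OF s s] by simp
    also have "\<dots> \<longleftrightarrow> ((\<lambda>t. \<rho> (t - s)) \<longlongrightarrow> 1) (at s within A)"
      using \<nu> mG(5)[OF _ s] by (intro tendsto_hyp_sum_iff) (auto simp: eventually_at_filter)
    finally show ?thesis using mG(4)[OF s s] by simp
  qed
  then show ?thesis unfolding iff by blast
qed

lemma (in prob_space) standard_t_process_ms_differentiable:
  fixes A :: "'i::euclidean_space set"
  assumes Y: "standard_t_process M A \<rho> \<nu> G W Y" and \<nu>: "2 * (2 * real m + 1) < \<nu>"
    and A: "open A" and diff: "ms_continuous M A G" "ms_derivatives_exist m M A G"
  shows "ms_differentiable m M A Y"
proof -
  have \<nu>2: "2 < \<nu>" using \<nu> by simp
  have G: "standard_gaussian_process M A \<rho> G" using Y by (simp add: standard_t_process_def)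
  note mY = standard_t_process_moments[OF Y \<nu>2] and mG = standard_gaussian_process_moments[OF G]
  have \<rho>: "differentiable_upto (2 * m) \<rho> (lags A)"
    using cross_moment_differentiable[OF A diff(2) diff(2) mG(3)] by (simp add: mult_2)
  \<comment> \<open>This is the hypothesis of \<open>hyp_sum_odd_derivatives\<close> with
    \<open>n = 2m\<close> and \<open>a = \<nu>/2\<close>, and the origin of the bound on
    \<open>\<nu>\<close>.\<close>
  have "real (2 * m) + 1 < \<nu> / 2" using \<nu> by simp
  then obtain \<phi> where \<phi>: "\<And>r. \<bar>r\<bar> \<le> 1 \<Longrightarrow> \<phi> 0 r = r * hyp_sum (\<nu> / 2) (r\<^sup>2)"
    "\<And>j r. j < 2 * m \<Longrightarrow> r \<in> {-1..1} \<Longrightarrow> (\<phi> j has_field_derivative \<phi> (Suc j) r) (at r within {-1..1})"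
    using hyp_sum_odd_derivatives by blast
  have "\<rho> ` lags A \<subseteq> {-1..1}"
    using standard_t_process_correlation(3)[OF Y \<nu>2] by (auto simp: abs_le_iff minus_le_iff)
  from differentiable_upto_compose[where \<phi> = \<phi>, OF open_lags[OF A] this \<rho> \<phi>(2)]
  have "differentiable_upto (2 * m) (\<lambda>h. t_const (\<nu> / 2) * \<phi> 0 (\<rho> h)) (lags A)"
    by (intro differentiable_upto_mult differentiable_upto_const)
  moreover have "(\<integral>\<omega>. Y s \<omega> * Y t \<omega> \<partial>M) = t_const (\<nu> / 2) * \<phi> 0 (\<rho> (s - t))" if "s \<in> A" "t \<in> A" for s t
    using mY(3)[OF that] \<phi>(1)[OF mG(5)[OF that]] by simp
  moreover have "second_order M A Y" using mY(1) by (auto simp: second_order_iff)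
  ultimately have "ms_derivatives_exist m M A Y"
    by (intro ms_derivatives_existI[OF A, where c = "\<lambda>h. t_const (\<nu> / 2) * \<phi> 0 (\<rho> h)"])
  then show ?thesis
    using diff(1) standard_t_process_ms_continuous_iff[OF Y \<nu>2] by (simp add: ms_differentiable_def)
qed

text \<open>The quotient multiplying \<open>\<rho> h\<close> lies between
  \<open>1 / hyp_sum (\<nu> / 2) 1\<close> and 1. It shrinks \<open>\<rho> h\<close> towards 0, so
  the signed bound carries a sign condition.\<close>

lemma (in prob_space) standard_t_process_correlation_bounds:
  assumes Y: "standard_t_process M A \<rho> \<nu> G W Y" and \<nu>: "2 < \<nu>" and h: "h \<in> lags A"
  shows "\<bar>correlation_function M A Y h\<bar> \<le> \<bar>\<rho> h\<bar>"
    and "\<bar>\<rho> h\<bar> / hyp_sum (\<nu> / 2) 1 \<le> \<bar>correlation_function M A Y h\<bar>"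
    and "0 \<le> \<rho> h \<Longrightarrow> correlation_function M A Y h \<le> \<rho> h"
proof -
  note c = standard_t_process_correlation[OF assms]
  have b: "1 \<le> hyp_sum (\<nu> / 2) ((\<rho> h)\<^sup>2)" "hyp_sum (\<nu> / 2) ((\<rho> h)\<^sup>2) \<le> hyp_sum (\<nu> / 2) 1"
    using hyp_sum_bounds[of "\<nu> / 2" "\<rho> h"] \<nu> c(3) by auto
  then have q: "hyp_sum (\<nu> / 2) ((\<rho> h)\<^sup>2) / hyp_sum (\<nu> / 2) 1 \<le> 1"
    "1 / hyp_sum (\<nu> / 2) 1 \<le> hyp_sum (\<nu> / 2) ((\<rho> h)\<^sup>2) / hyp_sum (\<nu> / 2) 1"
    "0 \<le> hyp_sum (\<nu> / 2) ((\<rho> h)\<^sup>2) / hyp_sum (\<nu> / 2) 1"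
    by (auto simp: divide_le_eq intro!: divide_right_mono)
  have eq: "\<bar>correlation_function M A Y h\<bar> = \<bar>\<rho> h\<bar> * (hyp_sum (\<nu> / 2) ((\<rho> h)\<^sup>2) / hyp_sum (\<nu> / 2) 1)"
    unfolding c(1) abs_mult using q(3) by (simp only: abs_of_nonneg)
  show "\<bar>correlation_function M A Y h\<bar> \<le> \<bar>\<rho> h\<bar>"
    unfolding eq using q by (intro mult_left_le) auto
  show "\<bar>\<rho> h\<bar> / hyp_sum (\<nu> / 2) 1 \<le> \<bar>correlation_function M A Y h\<bar>"
    unfolding eq using mult_left_mono[OF q(2), of "\<bar>\<rho> h\<bar>"] by simp
  show "correlation_function M A Y h \<le> \<rho> h" if "0 \<le> \<rho> h"
    unfolding c(1) using q that by (intro mult_left_le) auto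
qed

text \<open>The two correlation functions are comparable up to positive constants independent of the
  lag, so their integrals are infinite together.\<close>

lemma (in prob_space) standard_t_process_long_range_dependent_iff:
  fixes Y :: "'i::euclidean_space \<Rightarrow> 'a \<Rightarrow> real"
  assumes Y: "standard_t_process M UNIV \<rho> \<nu> G W Y" and \<nu>: "2 < \<nu>"
  shows "long_range_dependent M Y \<longleftrightarrow> long_range_dependent M G"
proof -
  have lag: "h \<in> lags UNIV" for h :: 'i using lagsI[of h UNIV 0] by simp
  note c = standard_t_process_correlation[OF Y \<nu> lag]
    and b = standard_t_process_correlation_bounds[OF Y \<nu> lag]
  define S where "S = {h :: 'i. \<forall>i\<in>Basis. 0 \<le> h \<bullet> i}"
  let ?I = "\<lambda>f. \<integral>\<^sup>+h. ennreal \<bar>f h\<bar> * indicator S h \<partial>lborel"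
  let ?r = "correlation_function M UNIV Y"
  define k where "k = 1 / hyp_sum (\<nu> / 2) 1"
  have k: "0 < k" using hyp_sum_bounds(3)[of "\<nu> / 2" 0] \<nu> by (simp add: k_def)
  have le: "?I ?r \<le> ?I \<rho>"
    using b(1) by (intro nn_integral_mono mult_right_mono ennreal_leI) auto
  have "ennreal k * ?I \<rho> \<le> (\<integral>\<^sup>+h. ennreal k * (ennreal \<bar>\<rho> h\<bar> * indicator S h) \<partial>lborel)"
    by (rule nn_integral_cmult_ge)
  also have "\<dots> \<le> ?I ?r"
  proof (rule nn_integral_mono)
    fix h
    have "ennreal k * ennreal \<bar>\<rho> h\<bar> \<le> ennreal \<bar>?r h\<bar>"
      using b(2)[of h] k by (simp add: k_def ennreal_leI flip: ennreal_mult)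
    then show "ennreal k * (ennreal \<bar>\<rho> h\<bar> * indicator S h) \<le> ennreal \<bar>?r h\<bar> * indicator S h"
      by (auto simp: indicator_def)
  qed
  finally have ge: "ennreal k * ?I \<rho> \<le> ?I ?r" .
  have "?I ?r = \<infinity> \<longleftrightarrow> ?I \<rho> = \<infinity>"
  proof
    assume "?I \<rho> = \<infinity>"
    with ge k show "?I ?r = \<infinity>" by (simp add: ennreal_mult_top top_unique)
  qed (use le in \<open>simp add: top_unique\<close>)
  then show ?thesis by (simp add: long_range_dependent_def S_def c(2))
qed

lemma hyp_sum_quotient_tendsto:
  assumes "\<bar>r\<bar> \<le> 1"
  shows "((\<lambda>\<nu>. r * (hyp_sum (\<nu> / 2) (r\<^sup>2) / hyp_sum (\<nu> / 2) 1)) \<longlongrightarrow> r) at_top"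
proof -
  have "filterlim (\<lambda>\<nu>::real. \<nu> / 2) at_top at_top" by real_asymp
  from filterlim_compose[OF hyp_sum_1_tendsto this]
  have lim: "((\<lambda>\<nu>. hyp_sum (\<nu> / 2) 1) \<longlongrightarrow> 1) at_top" .
  have "((\<lambda>\<nu>. hyp_sum (\<nu> / 2) (r\<^sup>2)) \<longlongrightarrow> 1) at_top"
  proof (rule tendsto_sandwich[OF _ _ tendsto_const lim])
    show "\<forall>\<^sub>F \<nu> in at_top. 1 \<le> hyp_sum (\<nu> / 2) (r\<^sup>2)" "\<forall>\<^sub>F \<nu> in at_top. hyp_sum (\<nu> / 2) (r\<^sup>2) \<le> hyp_sum (\<nu> / 2) 1"
      using eventually_gt_at_top[of 2] by (eventually_elim; use hyp_sum_bounds assms in simp)+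
  qed
  from tendsto_mult[OF tendsto_const[of r] tendsto_divide[OF this lim]] show ?thesis by simp
qed

text \<open>Only \<open>\<rho>\<close> is shared along the family; each \<open>\<nu>\<close> may
  have its own probability space. The limit filter restricts \<open>\<nu>\<close> to
  \<open>N\<close> and is trivial when \<open>N\<close> is bounded.\<close>

theorem theorem2p2:
  fixes A :: "'a::euclidean_space set" and \<rho> :: "'a \<Rightarrow> real" and N :: "real set"
    and M :: "real \<Rightarrow> 'w measure" and G W Y :: "real \<Rightarrow> 'a \<Rightarrow> 'w \<Rightarrow> real"
  assumes "\<And>\<nu>. \<nu> \<in> N \<Longrightarrow> 2 < \<nu>"
    and "\<And>\<nu>. \<nu> \<in> N \<Longrightarrow> standard_t_process (M \<nu>) A \<rho> \<nu> (G \<nu>) (W \<nu>) (Y \<nu>)"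
  shows
    "(\<forall>\<nu>\<in>N. weakly_stationary (M \<nu>) A (Y \<nu>)) \<and>
     (\<forall>\<nu>\<in>N. ms_continuous (M \<nu>) A (Y \<nu>) \<longleftrightarrow> ms_continuous (M \<nu>) A (G \<nu>)) \<and>
     (open A \<longrightarrow> (\<forall>\<nu>\<in>N. \<forall>m::nat. ms_differentiable m (M \<nu>) A (G \<nu>) \<longrightarrow>
        (\<nu> > 2 * (2 * real m + 1) \<longrightarrow> ms_differentiable m (M \<nu>) A (Y \<nu>)) \<and>
        (\<nu> \<le> 2 * (2 * real m + 1) \<longrightarrow>
          (\<forall>k\<in>{1..m}. 2 * (2 * real (m - k) + 1) < \<nu> \<and> \<nu> \<le> 2 * (2 * real (m - k) + 3) \<longrightarrow>
             ms_differentiable (m - k) (M \<nu>) A (Y \<nu>))))) \<and>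
     (A = UNIV \<longrightarrow>
        (\<forall>\<nu>\<in>N. long_range_dependent (M \<nu>) (Y \<nu>) \<longleftrightarrow> long_range_dependent (M \<nu>) (G \<nu>))) \<and>
     (\<forall>h\<in>lags A.
        (\<forall>\<nu>\<in>N. (0 \<le> \<rho> h \<longrightarrow> correlation_function (M \<nu>) A (Y \<nu>) h \<le> \<rho> h) \<and>
           \<bar>correlation_function (M \<nu>) A (Y \<nu>) h\<bar> \<le> \<bar>\<rho> h\<bar>) \<and>
        ((\<lambda>\<nu>. correlation_function (M \<nu>) A (Y \<nu>) h) \<longlongrightarrow> \<rho> h) (inf at_top (principal N)))"
proof -
  have ps: "prob_space (M \<nu>)" if "\<nu> \<in> N" for \<nu>
    using assms(2)[OF that] by (simp add: standard_t_process_def)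
  note inst = assms(2) assms(1)
  \<comment> \<open>Both cases of (c) are this one claim, since \<open>G\<close> also has all lower
    orders of differentiability: \<open>k = m\<close> in the first and \<open>m - k\<close> in place
    of \<open>k\<close> in the second.\<close>
  have diff: "ms_differentiable k (M \<nu>) A (Y \<nu>)"
    if "open A" "\<nu> \<in> N" "ms_differentiable m (M \<nu>) A (G \<nu>)" "k \<le> m" "2 * (2 * real k + 1) < \<nu>" for \<nu> m k
    using prob_space.standard_t_process_ms_differentiable[OF ps assms(2)] that
      ms_derivatives_exist_mono[of m "M \<nu>" A "G \<nu>" k] by (auto simp: ms_differentiable_def)
  have lim: "((\<lambda>\<nu>. correlation_function (M \<nu>) A (Y \<nu>) h) \<longlongrightarrow> \<rho> h) (inf at_top (principal N))"
    if h: "h \<in> lags A" for h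
  \<comment> \<open>A member of \<open>N\<close> supplies the bound
    \<open>\<bar>\<rho> h\<bar> \<le> 1\<close>; for empty \<open>N\<close> the filter is trivial
    and the limit holds vacuously.\<close>
  proof (cases "N = {}")
    case False
    then obtain \<nu>\<^sub>0 where "\<nu>\<^sub>0 \<in> N" by blast
    then have "\<bar>\<rho> h\<bar> \<le> 1"
      using prob_space.standard_t_process_correlation(3)[OF ps inst h] by blast
    then have "((\<lambda>\<nu>. \<rho> h * (hyp_sum (\<nu> / 2) ((\<rho> h)\<^sup>2) / hyp_sum (\<nu> / 2) 1)) \<longlongrightarrow> \<rho> h) (inf at_top (principal N))"
      using hyp_sum_quotient_tendsto tendsto_mono[OF inf_le1] by blast
    moreover have "\<forall>\<^sub>F \<nu> in inf at_top (principal N). correlation_function (M \<nu>) A (Y \<nu>) h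
        = \<rho> h * (hyp_sum (\<nu> / 2) ((\<rho> h)\<^sup>2) / hyp_sum (\<nu> / 2) 1)"
      unfolding eventually_inf_principal
      using prob_space.standard_t_process_correlation(1)[OF ps inst h] by (intro always_eventually) blast
    ultimately show ?thesis by (simp only: tendsto_cong)
  qed simp
  show ?thesis
  proof (intro conjI ballI allI impI)
    show "weakly_stationary (M \<nu>) A (Y \<nu>)" if "\<nu> \<in> N" for \<nu>
      using prob_space.standard_t_process_weakly_stationary[OF ps inst] that by blast
    show "ms_continuous (M \<nu>) A (Y \<nu>) \<longleftrightarrow> ms_continuous (M \<nu>) A (G \<nu>)" if "\<nu> \<in> N" for \<nu>
      using prob_space.standard_t_process_ms_continuous_iff[OF ps inst] that by blast
    show "ms_differentiable m (M \<nu>) A (Y \<nu>)"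
      if "open A" "\<nu> \<in> N" "ms_differentiable m (M \<nu>) A (G \<nu>)" "2 * (2 * real m + 1) < \<nu>" for \<nu> m
      using diff[OF that(1-3) order.refl that(4)] .
    show "ms_differentiable (m - k) (M \<nu>) A (Y \<nu>)"
      if "open A" "\<nu> \<in> N" "ms_differentiable m (M \<nu>) A (G \<nu>)"
        "2 * (2 * real (m - k) + 1) < \<nu> \<and> \<nu> \<le> 2 * (2 * real (m - k) + 3)" for \<nu> m k
      using diff[OF that(1-3), of "m - k"] that(4) by simp
    show "long_range_dependent (M \<nu>) (Y \<nu>) \<longleftrightarrow> long_range_dependent (M \<nu>) (G \<nu>)" if "A = UNIV" "\<nu> \<in> N" for \<nu>
      using prob_space.standard_t_process_long_range_dependent_iff[OF ps] inst that by blast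
    show "correlation_function (M \<nu>) A (Y \<nu>) h \<le> \<rho> h" if "h \<in> lags A" "\<nu> \<in> N" "0 \<le> \<rho> h" for h \<nu>
      using prob_space.standard_t_process_correlation_bounds(3)[OF ps inst] that by blast
    show "\<bar>correlation_function (M \<nu>) A (Y \<nu>) h\<bar> \<le> \<bar>\<rho> h\<bar>" if "h \<in> lags A" "\<nu> \<in> N" for h \<nu>
      using prob_space.standard_t_process_correlation_bounds(1)[OF ps inst] that by blast
  qed (use lim in blast)
qed

end
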